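(* Let $X:\mathbb{R}^2\to\mathbb{R}$ be a random field satisfying Assumption (H). A deformation $\theta\in\mathcal{D}^2(\mathbb{R}^2)$ is $\chi$-isotropic (with respect to $X$) if and only if it is a spiral deformation.
   Context: Assumption (H) on $X$: $X$ is Gaussian; $X$ is stationary and isotropic (its law is invariant under translations and under rotations $\rho\in SO(2)$); $X$ is almost surely of class $\mathcal{C}^2$; for every $t\in\mathbb{R}^2$ the joint distribution of $(X'_i(t),X''_{i,j}(t))_{1\le i\le j\le 2}$ (first and second order partial derivatives) is non-degenerate; $X$ is centered, and its covariance function $C(t)=\mathrm{Cov}(X(0),X(t))$ satisfies $C(0)=1$ and $C''(0)=-I_2$ (Hessian). $\mathcal{D}^2(\mathbb{R}^2)$ is the set of $\mathcal{C}^2$-diffeomorphisms $\theta:\mathbb{R}^2\to\mathbb{R}^2$ with $\theta(0)=0$; its elements are called deformations. $X_\theta=X\circ\theta$. For $u\in\mathbb{R}$ and $T\subset\mathbb{R}^2$ compact, $A_u(X_\theta,T)=\{t\in T: X(\theta(t))\ge u\}$ is the excursion set, and $\chi$ denotes the Euler characteristic. A rectangle is a set of the form $\rho\circ\tau([0,s]\times[0,t])$ with $(s,t)\in\mathbb{R}^2$, $\rho\in SO(2)$ and $\tau$ a translation, where $[0,s]$ means $\{x: s\le x\le 0\}$ if $s<0$. $\chi$-isotropy: $\theta\in\mathcal{D}^2(\mathbb{R}^2)$ is $\chi$-isotropic if for every rectangle $T\subset\mathbb{R}^2$, every $u\in\mathbb{R}$ and every $\rho\in SO(2)$, $\mathbb{E}[\chi(A_u(X_\theta,\rho(T)))]=\mathbb{E}[\chi(A_u(X_\theta,T))]$.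 Spiral deformation: let $\mathbb{T}=\mathbb{R}/2\pi\mathbb{Z}$, $S:(0,+\infty)\times\mathbb{T}\to\mathbb{R}^2\setminus\{0\}$, $S(r,\varphi)=(r\cos\varphi,r\sin\varphi)$, and $\hat\theta=S^{-1}\circ\theta|_{\mathbb{R}^2\setminus\{0\}}\circ S$. Then $\theta$ is a spiral deformation if there exist $f:(0,+\infty)\to(0,+\infty)$ strictly increasing and surjective, $g:(0,+\infty)\to\mathbb{T}$ and $\varepsilon\in\{\pm1\}$ with $\hat\theta(r,\varphi)=(f(r),g(r)+\varepsilon\varphi)$ for all $(r,\varphi)$. *)

theory Defs
  imports "HOL-Probability.Probability" "HOL-Homology.Homology" "HOL-Library.Real_Mod"
begin

definition C2 :: "('a::real_normed_vector \<Rightarrow> 'b::real_normed_vector) \<Rightarrow> bool" where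
  "C2 f \<longleftrightarrow> (\<exists>(f' :: 'a \<Rightarrow> 'a \<Rightarrow>\<^sub>L 'b) (f'' :: 'a \<Rightarrow> 'a \<Rightarrow>\<^sub>L ('a \<Rightarrow>\<^sub>L 'b)).
     (\<forall>x. (f has_derivative blinfun_apply (f' x)) (at x)) \<and>
     (\<forall>x. (f' has_derivative blinfun_apply (f'' x)) (at x)) \<and>
     continuous_on UNIV f'')"

definition partial_deriv :: "'n \<Rightarrow> (real ^ 'n \<Rightarrow> real) \<Rightarrow> real ^ 'n \<Rightarrow> real" where
  "partial_deriv i f t = deriv (\<lambda>h. f (t + h *\<^sub>R axis i 1)) 0"

definition has_hessian :: "(real ^ 'n \<Rightarrow> real) \<Rightarrow> real ^ 'n ^ 'n \<Rightarrow> real ^ 'n \<Rightarrow> bool" where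
  "has_hessian f H x \<longleftrightarrow> (\<exists>G. (\<forall>\<^sub>F y in nhds x. GDERIV f y :> G y) \<and>
     (G has_derivative (\<lambda>h. H *v h)) (at x))"


text \<open>The Dirac case makes constants count as (degenerate) Gaussian variables.\<close>

definition gaussian_rv :: "'w measure \<Rightarrow> ('w \<Rightarrow> real) \<Rightarrow> bool" where
  "gaussian_rv M Y \<longleftrightarrow> Y \<in> borel_measurable M \<and>
     (\<exists>\<mu>. distr M borel Y = return borel \<mu> \<or>
          (\<exists>\<sigma>>0. distributed M lborel Y (\<lambda>x. ennreal (normal_density \<mu> \<sigma> x))))"

definition gaussian_field :: "'w measure \<Rightarrow> ('t \<Rightarrow> 'w \<Rightarrow> real) \<Rightarrow> bool" where
  "gaussian_field M X \<longleftrightarrow>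
     (\<forall>I a. finite I \<longrightarrow> gaussian_rv M (\<lambda>\<omega>. \<Sum>t\<in>I. a t * X t \<omega>))"

definition field_law :: "'w measure \<Rightarrow> ('t \<Rightarrow> 'w \<Rightarrow> real) \<Rightarrow> ('t \<Rightarrow> real) measure" where
  "field_law M X = distr M (\<Pi>\<^sub>M t\<in>UNIV. borel) (\<lambda>\<omega> t. X t \<omega>)"

definition stationary_field :: "'w measure \<Rightarrow> (real ^ 2 \<Rightarrow> 'w \<Rightarrow> real) \<Rightarrow> bool" where
  "stationary_field M X \<longleftrightarrow> (\<forall>a. field_law M (\<lambda>t. X (t + a)) = field_law M X)"

definition isotropic_field :: "'w measure \<Rightarrow> (real ^ 2 \<Rightarrow> 'w \<Rightarrow> real) \<Rightarrow> bool" where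
  "isotropic_field M X \<longleftrightarrow>
     (\<forall>R. rotation_matrix R \<longrightarrow> field_law M (\<lambda>t. X (R *v t)) = field_law M X)"

definition cov :: "'w measure \<Rightarrow> ('w \<Rightarrow> real) \<Rightarrow> ('w \<Rightarrow> real) \<Rightarrow> real" where
  "cov M Y Z = (\<integral>\<omega>. (Y \<omega> - integral\<^sup>L M Y) * (Z \<omega> - integral\<^sup>L M Z) \<partial>M)"

text \<open>A random vector is non-degenerate if its distribution is not carried by an affine hyperplane.\<close>

definition nondegenerate_rv :: "'w measure \<Rightarrow> ('w \<Rightarrow> 'b::euclidean_space) \<Rightarrow> bool" where
  "nondegenerate_rv M V \<longleftrightarrow> (\<forall>a c. a \<noteq> 0 \<longrightarrow> \<not> (AE \<omega> in M. a \<bullet> V \<omega> = c))"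

definition derivative_vector :: "(real ^ 2 \<Rightarrow> real) \<Rightarrow> real ^ 2 \<Rightarrow> real ^ 5" where
  "derivative_vector f t = vector
     [partial_deriv 1 f t,
      partial_deriv 2 f t,
      partial_deriv 1 (partial_deriv 1 f) t,
      partial_deriv 1 (partial_deriv 2 f) t,
      partial_deriv 2 (partial_deriv 2 f) t]"

definition assumption_H :: "'w measure \<Rightarrow> (real ^ 2 \<Rightarrow> 'w \<Rightarrow> real) \<Rightarrow> bool" where
  "assumption_H M X \<longleftrightarrow>
     gaussian_field M X \<and>
     stationary_field M X \<and>
     isotropic_field M X \<and>
     (AE \<omega> in M. C2 (\<lambda>t. X t \<omega>)) \<and>
     (\<forall>t. nondegenerate_rv M (\<lambda>\<omega>. derivative_vector (\<lambda>s. X s \<omega>) t)) \<and>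
     (\<forall>t. integral\<^sup>L M (X t) = 0) \<and>
     cov M (X 0) (X 0) = 1 \<and>
     has_hessian (\<lambda>t. cov M (X 0) (X t)) (- mat 1) 0"


definition deformation :: "(real ^ 2 \<Rightarrow> real ^ 2) \<Rightarrow> bool" where
  "deformation \<theta> \<longleftrightarrow> bij \<theta> \<and> C2 \<theta> \<and> C2 (inv_into UNIV \<theta>) \<and> \<theta> 0 = 0"

text \<open>The set \<open>closed_segment 0 s\<close> is \<open>{0..s}\<close> or \<open>{s..0}\<close> according to the sign of \<open>s\<close>.\<close>

definition rectangle :: "(real ^ 2) set \<Rightarrow> bool" where
  "rectangle T \<longleftrightarrow> (\<exists>s t R a. rotation_matrix R \<and>
     T = (\<lambda>x. R *v (x + a)) ` {x. x $ 1 \<in> closed_segment 0 s \<and> x $ 2 \<in> closed_segment 0 t})"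

definition excursion_set :: "real \<Rightarrow> (real ^ 2 \<Rightarrow> real) \<Rightarrow> (real ^ 2) set \<Rightarrow> (real ^ 2) set" where
  "excursion_set u f T = {t \<in> T. f t \<ge> u}"


text \<open>
  The Euler characteristic is the alternating sum of the ranks of the integral singular homology
  groups; it is set to 0 for spaces whose total Betti number is infinite. The rank of an abelian
  group is the maximal number of elements that are linearly independent over the integers.
\<close>

definition independent_in :: "('a, 'b) monoid_scheme \<Rightarrow> 'a set \<Rightarrow> bool" where
  "independent_in G B \<longleftrightarrow> finite B \<and> B \<subseteq> carrier G \<and>
     (\<forall>n :: 'a \<Rightarrow> int. (\<Otimes>\<^bsub>G\<^esub>x\<in>B. x [^]\<^bsub>G\<^esub> n x) = \<one>\<^bsub>G\<^esub> \<longrightarrow> (\<forall>x\<in>B. n x = 0))"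

definition group_rank :: "('a, 'b) monoid_scheme \<Rightarrow> enat" where
  "group_rank G = (SUP B \<in> Collect (independent_in G). enat (card B))"

definition betti :: "nat \<Rightarrow> 'a topology \<Rightarrow> enat" where
  "betti p T = group_rank (homology_group (int p) T)"

definition euler_characteristic :: "'a topology \<Rightarrow> int" where
  "euler_characteristic T =
     (if (\<forall>p. betti p T \<noteq> \<infinity>) \<and> finite {p. betti p T \<noteq> 0}
      then \<Sum>p | betti p T \<noteq> 0. (-1) ^ p * int (the_enat (betti p T))
      else 0)"

text \<open>
  The Euler characteristic of an excursion set is measurable only up to a null set (on which the
  field fails to be smooth or has degenerate critical points), so its expectation is taken over
  the completion of the probability space.
\<close>

definition mean_euler ::
  "'w measure \<Rightarrow> (real ^ 2 \<Rightarrow> 'w \<Rightarrow> real) \<Rightarrow> real \<Rightarrow> (real ^ 2) set \<Rightarrow> real" where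
  "mean_euler M Y u T =
     (\<integral>\<omega>. real_of_int (euler_characteristic (top_of_set (excursion_set u (\<lambda>t. Y t \<omega>) T)))
        \<partial>completion M)"

definition chi_isotropic ::
  "'w measure \<Rightarrow> (real ^ 2 \<Rightarrow> 'w \<Rightarrow> real) \<Rightarrow> (real ^ 2 \<Rightarrow> real ^ 2) \<Rightarrow> bool" where
  "chi_isotropic M X \<theta> \<longleftrightarrow>
     (\<forall>T u R. rectangle T \<longrightarrow> rotation_matrix R \<longrightarrow>
        mean_euler M (X \<circ> \<theta>) u ((\<lambda>x. R *v x) ` T) = mean_euler M (X \<circ> \<theta>) u T)"


text \<open>The circle group of real numbers modulo \<open>2\<pi>\<close>.\<close>

quotient_type angle = real / "\<lambda>x y. [x = y] (rmod (2 * pi))"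
  by (intro equivpI reflpI sympI transpI) (auto intro: rcong_sym rcong_trans)

instantiation angle :: ab_group_add
begin

lift_definition zero_angle :: angle is 0 .

lift_definition plus_angle :: "angle \<Rightarrow> angle \<Rightarrow> angle" is "(+)"
  by (rule rcong_add)

lift_definition minus_angle :: "angle \<Rightarrow> angle \<Rightarrow> angle" is "(-)"
  by (rule rcong_diff)

lift_definition uminus_angle :: "angle \<Rightarrow> angle" is uminus
  by (simp add: rcong_uminus_uminus_iff)

instance
  by standard (transfer; simp add: algebra_simps)+

end

lift_definition int_mult_angle :: "int \<Rightarrow> angle \<Rightarrow> angle" is "\<lambda>k x. of_int k * x"
  by (auto simp: rcong_altdef algebra_simps) (metis mult.assoc of_int_mult)

lift_definition cos_angle :: "angle \<Rightarrow> real" is cos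
  by (rule cos_rcong)

lift_definition sin_angle :: "angle \<Rightarrow> real" is sin
  by (rule sin_rcong)

definition polar :: "real \<times> angle \<Rightarrow> real ^ 2" where
  "polar = (\<lambda>(r, \<phi>). vector [r * cos_angle \<phi>, r * sin_angle \<phi>])"

text \<open>Polar coordinates are used on positive radii; \<open>polar_inv\<close> is meaningful away from the origin.\<close>

definition polar_inv :: "real ^ 2 \<Rightarrow> real \<times> angle" where
  "polar_inv = inv_into ({0<..} \<times> UNIV) polar"

definition polar_form :: "(real ^ 2 \<Rightarrow> real ^ 2) \<Rightarrow> real \<times> angle \<Rightarrow> real \<times> angle" where
  "polar_form \<theta> = polar_inv \<circ> \<theta> \<circ> polar"

definition spiral_deformation :: "(real ^ 2 \<Rightarrow> real ^ 2) \<Rightarrow> bool" where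
  "spiral_deformation \<theta> \<longleftrightarrow>
     (\<exists>(f :: real \<Rightarrow> real) (g :: real \<Rightarrow> angle) (\<epsilon> :: int).
        strict_mono_on {0<..} f \<and> f ` {0<..} = {0<..} \<and> \<epsilon> \<in> {1, -1} \<and>
        (\<forall>r>0. \<forall>\<phi>. polar_form \<theta> (r, \<phi>) = (f r, g r + int_mult_angle \<epsilon> \<phi>)))"

end

theory Submission
  imports Defs
begin

text \<open>
  If \<open>\<theta>\<close> is a spiral deformation, every rotation \<open>\<rho>\<close> satisfies \<open>\<theta> \<circ> \<rho> = \<rho>' \<circ> \<theta>\<close> for some rotation
  \<open>\<rho>'\<close>, so isotropy of \<open>X\<close> gives \<open>\<chi>\<close>-isotropy once the Euler characteristic of the excursion set is known to
  be, almost surely, a measurable function of the path. This holds because almost every path has no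
  critical point at level \<open>u\<close> (in the interior, on the edges and at the corners of the rectangle), and for
  such paths the homotopy type of the excursion set is stable under small \<open>C\<^sup>1\<close> perturbations.

  Conversely, segments are degenerate rectangles, and at level 0 the mean Euler characteristic on a segment
  is \<open>P(X(0) \<ge> 0)\<close> plus the limit over dyadic subdivisions of sums of probabilities \<open>P(X(s) < 0 \<le> X(t))\<close>,
  which are asymptotic to \<open>c |t - s|\<close> with \<open>c > 0\<close>. For short segments \<open>\<chi>\<close>-isotropy therefore yields
  \<open>|\<theta>'(\<rho> x) \<rho> v| = |\<theta>'(x) v|\<close>, so that \<open>\<theta> \<circ> \<rho> \<circ> \<theta>\<^sup>-\<^sup>1\<close> is an isometry fixing 0. The resulting
  differentiable action of the circle on the plane is \<open>\<alpha> \<mapsto> e\<^sup>i\<^sup>n\<^sup>\<alpha>\<close>, and injectivity of \<open>\<theta>\<close> forces \<open>n = \<plusminus>1\<close>.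
\<close>

section \<open>Euler characteristic\<close>

text \<open>Invariance of the law is a statement about the product sigma-algebra, whose measurable
  functionals see only countably many coordinates of a path. Isotropy can be applied to the Euler
  characteristic only after it has been recovered from rounded values and difference quotients at
  countably many points; a bound on the Lipschitz constant of the derivative turns such finite data
  into closeness in \<open>C\<^sup>1\<close>. The same bound gives the quadratic Taylor remainder
  behind Bulinskaya's argument. In the converse, segments take the place of a Kac-Rice formula: the
  Euler characteristic counts intervals there, and upcrossings can only increase under dyadic
  refinement, so monotone convergence yields the mean without a dominating variable. Level 0 turns a
  crossing event into a sector of the plane under the standard Gaussian measure. Its angle is
  asymptotic to the distance of the two points because the Hessian of the covariance is minus the
  identity, whence c = 1 / (2 pi). An isometry fixing 0 could still be a reflection; this is
  excluded because the isometry belonging to an angle is the square of the one belonging to half of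
  it.\<close>

lemma independent_in_iso:
  assumes "comm_group G" "comm_group H" "h \<in> iso G H" "independent_in G B"
  shows "independent_in H (h ` B)" "card (h ` B) = card B"
proof -
  interpret G: comm_group G by fact
  interpret H: comm_group H by fact
  have h: "h \<in> hom G H" "inj_on h (carrier G)"
    using assms(3) by (auto simp: iso_def bij_betw_def)
  then interpret gh: group_hom G H h
    by unfold_locales
  have B: "finite B" "B \<subseteq> carrier G"
    and ind: "\<And>n::'a \<Rightarrow> int. (\<Otimes>\<^bsub>G\<^esub>x\<in>B. x [^]\<^bsub>G\<^esub> n x) = \<one>\<^bsub>G\<^esub> \<Longrightarrow> \<forall>x\<in>B. n x = 0"
    using assms(4) by (auto simp: independent_in_def)
  have inj: "inj_on h B"
    using h B inj_on_subset by blast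
  then show "card (h ` B) = card B"
    by (rule card_image)
  have hprod: "h (\<Otimes>\<^bsub>G\<^esub>x\<in>A. f x) = (\<Otimes>\<^bsub>H\<^esub>x\<in>A. h (f x))"
    if "finite A" "f \<in> A \<rightarrow> carrier G" for A :: "'a set" and f
    using that by (induction A) (auto simp: Pi_iff)
  have "\<forall>y\<in>h ` B. n y = 0" if n: "(\<Otimes>\<^bsub>H\<^esub>y\<in>h ` B. y [^]\<^bsub>H\<^esub> n y) = \<one>\<^bsub>H\<^esub>" for n :: "'c \<Rightarrow> int"
  proof -
    have "h (\<Otimes>\<^bsub>G\<^esub>x\<in>B. x [^]\<^bsub>G\<^esub> n (h x)) = (\<Otimes>\<^bsub>H\<^esub>x\<in>B. h x [^]\<^bsub>H\<^esub> n (h x))"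
      using B by (subst hprod) (auto intro!: H.finprod_cong' simp: gh.hom_int_pow subset_iff)
    also have "\<dots> = \<one>\<^bsub>H\<^esub>"
      using B inj n by (subst (asm) H.finprod_reindex) auto
    finally have "(\<Otimes>\<^bsub>G\<^esub>x\<in>B. x [^]\<^bsub>G\<^esub> n (h x)) = \<one>\<^bsub>G\<^esub>"
      using B by (intro inj_onD [OF h(2)]) (auto intro!: G.finprod_closed)
    then show ?thesis
      using ind [of "\<lambda>x. n (h x)"] by auto
  qed
  then show "independent_in H (h ` B)"
    using B by (auto simp: independent_in_def)
qed

lemma group_rank_le:
  assumes "comm_group G" "comm_group H" "G \<cong> H"
  shows "group_rank G \<le> group_rank H"
proof -
  obtain h where "h \<in> iso G H"
    using assms by (auto simp: is_iso_def)
  note ind = independent_in_iso [OF assms(1,2) this]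
  show ?thesis
    unfolding group_rank_def
  proof (rule SUP_mono)
    fix B assume "B \<in> Collect (independent_in G)"
    then show "\<exists>B'\<in>Collect (independent_in H). enat (card B) \<le> enat (card B')"
      using ind [of B] by (intro bexI [of _ "h ` B"]) auto
  qed
qed

lemma group_rank_iso:
  assumes "comm_group G" "comm_group H" "G \<cong> H"
  shows "group_rank G = group_rank H"
  using assms by (meson antisym comm_group.axioms(2) group.iso_sym group_rank_le)

text \<open>In a trivial group the exponents constantly equal to 1 form a relation, so only the
  empty set is independent.\<close>

lemma group_rank_trivial:
  assumes "comm_group G" "trivial_group G"
  shows "group_rank G = 0"
proof -
  interpret comm_group G by fact
  have "B = {}" if "independent_in G B" for B
  proof (rule ccontr)
    assume "B \<noteq> {}"
    have "finprod G (\<lambda>x. x [^]\<^bsub>G\<^esub> (1::int)) B \<in> carrier G"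
      using that by (intro finprod_closed) (auto simp: independent_in_def)
    then have "finprod G (\<lambda>x. x [^]\<^bsub>G\<^esub> (1::int)) B = \<one>\<^bsub>G\<^esub>"
      using assms(2) by (auto simp: trivial_group_def)
    moreover have "\<forall>n::'a \<Rightarrow> int. (\<Otimes>\<^bsub>G\<^esub>x\<in>B. x [^]\<^bsub>G\<^esub> n x) = \<one>\<^bsub>G\<^esub> \<longrightarrow> (\<forall>x\<in>B. n x = 0)"
      using that by (simp add: independent_in_def)
    ultimately have "\<forall>x\<in>B. (1::int) = 0"
      by (auto dest: spec [of _ "\<lambda>_. 1 :: int"])
    then show False
      using \<open>B \<noteq> {}\<close> by auto
  qed
  then show ?thesis
    unfolding group_rank_def
    by (auto simp flip: zero_enat_def bot_enat_def intro!: SUP_bot_conv(1) [THEN iffD2]) (metis card.empty zero_enat_def bot_enat_def)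
qed

text \<open>Gaussian elimination over the integers, one coordinate at a time. It bounds the rank of
  a free abelian group from above.\<close>

lemma int_vectors_dependent:
  fixes a :: "'i \<Rightarrow> 's \<Rightarrow> int"
  assumes "finite S" "finite I" "card S < card I"
  shows "\<exists>n. (\<exists>i\<in>I. n i \<noteq> 0) \<and> (\<forall>s\<in>S. (\<Sum>i\<in>I. n i * a i s) = 0)"
  using assms
proof (induction S arbitrary: I a)
  case empty
  then show ?case
    by (intro exI [of _ "\<lambda>_. 1"]) (auto simp: card_gt_0_iff)
next
  case (insert s S)
  show ?case
  proof (cases "\<forall>i\<in>I. a i s = 0")
    case True
    obtain n where "\<exists>i\<in>I. n i \<noteq> 0" "\<forall>t\<in>S. (\<Sum>i\<in>I. n i * a i t) = 0"
      using insert.IH [of I a] insert.prems insert.hyps by auto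
    with True show ?thesis
      by (intro exI [of _ n]) auto
  next
    case False
    then obtain j where j: "j \<in> I" "a j s \<noteq> 0" by auto
    \<comment> \<open>Fraction-free elimination with pivot \<open>a j s\<close>: the vectors
      \<open>b i\<close> vanish in coordinate \<open>s\<close>, and one index and one coordinate are
      removed together.\<close>
    define b where "b i t = a j s * a i t - a i s * a j t" for i t
    have "card S < card (I - {j})"
      using insert.prems insert.hyps j by simp
    then obtain m where m: "\<exists>i\<in>I - {j}. m i \<noteq> 0" "\<forall>t\<in>S. (\<Sum>i\<in>I - {j}. m i * b i t) = 0"
      using insert.IH [of "I - {j}" b] insert.prems by auto
    \<comment> \<open>These are the coefficients obtained by expanding the relation \<open>m\<close>
      among the \<open>b i\<close> in terms of the \<open>a i\<close>.\<close>
    define n where "n i = (if i = j then - (\<Sum>k\<in>I - {j}. m k * a k s) else a j s * m i)" for i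
    have "\<exists>i\<in>I. n i \<noteq> 0"
      using m(1) j by (auto simp: n_def)
    moreover have "(\<Sum>i\<in>I. n i * a i t) = (\<Sum>i\<in>I - {j}. m i * b i t)" for t
    proof -
      have "(\<Sum>i\<in>I. n i * a i t) = n j * a j t + (\<Sum>i\<in>I - {j}. n i * a i t)"
        using insert.prems j by (simp add: sum.remove)
      also have "(\<Sum>i\<in>I - {j}. n i * a i t) = (\<Sum>i\<in>I - {j}. a j s * m i * a i t)"
        by (intro sum.cong) (auto simp: n_def)
      also have "n j * a j t = (\<Sum>i\<in>I - {j}. - (m i * a i s * a j t))"
        by (simp add: n_def sum_distrib_right sum_negf)
      finally show ?thesis
        by (simp add: b_def sum.distrib [symmetric] algebra_simps)
    qed
    moreover have "b i s = 0" for i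
      by (simp add: b_def)
    ultimately show ?thesis
      using m(2) by (intro exI [of _ n]) auto
  qed
qed

lemma finprod_free_Abelian_group:
  assumes "finite B" "B \<subseteq> carrier (free_Abelian_group S)"
  shows "(\<Otimes>\<^bsub>free_Abelian_group S\<^esub>x\<in>B. x [^]\<^bsub>free_Abelian_group S\<^esub> (n x :: int)) = (\<Sum>x\<in>B. frag_cmul (n x) x)"
proof -
  interpret comm_group "free_Abelian_group S"
    by (rule abelian_free_Abelian_group)
  show ?thesis
    using assms
  proof (induction B)
    case (insert x B)
    then have "finprod (free_Abelian_group S) (\<lambda>x. x [^]\<^bsub>free_Abelian_group S\<^esub> n x) (insert x B)
      = x [^]\<^bsub>free_Abelian_group S\<^esub> n x \<otimes>\<^bsub>free_Abelian_group S\<^esub>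
        finprod (free_Abelian_group S) (\<lambda>x. x [^]\<^bsub>free_Abelian_group S\<^esub> n x) B"
      by (intro finprod_insert) (auto simp del: carrier_free_Abelian_group_iff)
    with insert show ?case
      by simp
  qed simp
qed

text \<open>The upper bound applies \<open>int_vectors_dependent\<close> to the coefficient vectors
  of an independent set; the generators attain it.\<close>

lemma group_rank_free_Abelian_group:
  assumes "finite S"
  shows "group_rank (free_Abelian_group S) = enat (card S)"
proof -
  have le: "card B \<le> card S" if B: "independent_in (free_Abelian_group S) B" for B
  proof (rule ccontr)
    assume "\<not> card B \<le> card S"
    moreover have fin: "finite B" and sub: "B \<subseteq> carrier (free_Abelian_group S)"
      using B by (auto simp: independent_in_def)
    ultimately obtain n where n: "\<exists>x\<in>B. n x \<noteq> 0"
      and z: "\<forall>s\<in>S. (\<Sum>x\<in>B. n x * poly_mapping.lookup x s) = 0"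
      using int_vectors_dependent [OF assms, of B "\<lambda>x. poly_mapping.lookup x"] by auto
    have "(\<Sum>x\<in>B. frag_cmul (n x) x) = 0"
    proof (rule poly_mapping_eqI)
      fix s
      have "poly_mapping.lookup (\<Sum>x\<in>B. frag_cmul (n x) x) s = (\<Sum>x\<in>B. n x * poly_mapping.lookup x s)"
        by (simp add: lookup_sum)
      also have "\<dots> = 0"
      proof (cases "s \<in> S")
        case False
        then have "poly_mapping.lookup x s = 0" if "x \<in> B" for x
          using sub that by (auto simp: subset_iff in_keys_iff)
        then show ?thesis by simp
      qed (use z in auto)
      finally show "poly_mapping.lookup (\<Sum>x\<in>B. frag_cmul (n x) x) s = poly_mapping.lookup 0 s"
        by simp
    qed
    then have "(\<Otimes>\<^bsub>free_Abelian_group S\<^esub>x\<in>B. x [^]\<^bsub>free_Abelian_group S\<^esub> n x) = \<one>\<^bsub>free_Abelian_group S\<^esub>"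
      by (simp add: finprod_free_Abelian_group [OF fin sub])
    then show False
      using B n unfolding independent_in_def by blast
  qed
  have inj: "inj_on frag_of S"
    by (auto simp: inj_on_def frag_of_eq)
  have "independent_in (free_Abelian_group S) (frag_of ` S)"
    unfolding independent_in_def
  proof (intro conjI allI impI)
    fix n :: "('a \<Rightarrow>\<^sub>0 int) \<Rightarrow> int"
    have fs: "finite (frag_of ` S)" "frag_of ` S \<subseteq> carrier (free_Abelian_group S)"
      using assms by auto
    assume "(\<Otimes>\<^bsub>free_Abelian_group S\<^esub>x\<in>frag_of ` S. x [^]\<^bsub>free_Abelian_group S\<^esub> n x) = \<one>\<^bsub>free_Abelian_group S\<^esub>"
    then have *: "(\<Sum>s\<in>S. frag_cmul (n (frag_of s)) (frag_of s)) = 0"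
      by (simp add: finprod_free_Abelian_group [OF fs] sum.reindex [OF inj])
    have "n (frag_of t) = 0" if "t \<in> S" for t
    proof -
      have "poly_mapping.lookup (\<Sum>s\<in>S. frag_cmul (n (frag_of s)) (frag_of s)) t
          = (\<Sum>s\<in>S. if s = t then n (frag_of s) else 0)"
        unfolding lookup_sum by (intro sum.cong) (auto simp: lookup_single)
      also have "\<dots> = n (frag_of t)"
        using that assms by simp
      finally show ?thesis
        using * by simp
    qed
    then show "\<forall>x\<in>frag_of ` S. n x = 0" by auto
  qed (use assms in auto)
  moreover have "card (frag_of ` S) = card S"
    by (rule card_image [OF inj])
  ultimately show ?thesis
    unfolding group_rank_def
    by (intro antisym SUP_least) (auto intro!: le SUP_upper2 [of "frag_of ` S"])
qed

section \<open>Homotopy invariance and disjoint unions of convex sets\<close>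

lemma euler_characteristic_homotopy_equivalent:
  assumes "X homotopy_equivalent_space Y"
  shows "euler_characteristic X = euler_characteristic Y"
proof -
  have "betti p X = betti p Y" for p
    unfolding betti_def
    by (intro group_rank_iso abelian_homology_group
        homotopy_equivalent_space_imp_isomorphic_homology_groups assms)
  then show ?thesis
    unfolding euler_characteristic_def by presburger
qed

lemma euler_characteristic_homeomorphic:
  "X homeomorphic_space Y \<Longrightarrow> euler_characteristic X = euler_characteristic Y"
  by (simp add: euler_characteristic_homotopy_equivalent homeomorphic_imp_homotopy_equivalent_space)

text \<open>The pieces are open in their union, so the additivity axiom splits the homology into a
  direct sum; each piece is contractible and contributes one copy of the integers in degree 0
  only.\<close>

lemma euler_characteristic_Union_convex:
  fixes \<C> :: "'a::euclidean_space set set"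
  assumes fin: "finite \<C>" and disj: "disjoint \<C>"
    and \<C>: "\<And>C. C \<in> \<C> \<Longrightarrow> closed C \<and> convex C \<and> C \<noteq> {}"
  shows "euler_characteristic (top_of_set (\<Union>\<C>)) = int (card \<C>)"
proof -
  let ?X = "top_of_set (\<Union>\<C>)"
  \<comment> \<open>The complement of a piece is a finite union of closed pieces.\<close>
  have ope: "openin ?X C" if "C \<in> \<C>" for C
  proof -
    have "closed (\<Union>(\<C> - {C}))"
      using fin \<C> by (intro closed_Union) auto
    moreover have "C = \<Union>\<C> - \<Union>(\<C> - {C})"
      using disj that by (auto simp: pairwise_def disjnt_iff)
    ultimately show ?thesis
      by (metis Diff_eq openin_open_Int closed_def)
  qed
  have subtop: "subtopology ?X C = top_of_set C" if "C \<in> \<C>" for C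
    using that by (metis Union_upper inf.absorb_iff2 subtopology_subtopology)
  have iso: "homology_group p ?X \<cong> sum_group \<C> (\<lambda>C. homology_group p (top_of_set C))" for p
  proof -
    have "sum_group \<C> (\<lambda>C. homology_group p (subtopology ?X C)) \<cong> homology_group p ?X"
      using homology_additivity_axiom [of \<C> ?X p] disj ope by (auto intro: is_isoI)
    moreover have "sum_group \<C> (\<lambda>C. homology_group p (subtopology ?X C)) = sum_group \<C> (\<lambda>C. homology_group p (top_of_set C))"
      unfolding sum_group_def product_group_def using subtop
      by (auto intro!: arg_cong2 [of _ _ _ _ subgroup_generated] Collect_cong cong: PiE_cong conj_cong restrict_cong)
    ultimately show ?thesis
      by (metis group.iso_sym group_relative_homology_group sum_group)
  qed
  have "betti p ?X = 0" if "p \<noteq> 0" for p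
  proof -
    have "trivial_group (homology_group (int p) (top_of_set C))" if "C \<in> \<C>" for C
    proof -
      obtain a where "a \<in> C" using \<C> \<open>C \<in> \<C>\<close> by blast
      have "contractible_space (top_of_set C)"
        using \<C> \<open>C \<in> \<C>\<close> by (simp add: convex_imp_contractible)
      then have "trivial_group (reduced_homology_group (int p) (top_of_set C))"
        by (rule trivial_reduced_homology_group_contractible_space)
      then show ?thesis
        using \<open>p \<noteq> 0\<close> by (simp add: un_reduced_homology_group)
    qed
    then have triv: "carrier (homology_group (int p) (top_of_set C)) = {\<one>\<^bsub>homology_group (int p) (top_of_set C)\<^esub>}"
      if "C \<in> \<C>" for C
      using that by (auto simp: trivial_group_def)
    let ?S = "sum_group \<C> (\<lambda>C. homology_group (int p) (top_of_set C))"
    have grp: "group ?S" by simp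
    have "carrier ?S \<subseteq> {\<one>\<^bsub>?S\<^esub>}"
    proof
      fix x assume "x \<in> carrier ?S"
      then have "x \<in> (\<Pi>\<^sub>E C\<in>\<C>. {\<one>\<^bsub>homology_group (int p) (top_of_set C)\<^esub>})"
        by (simp add: carrier_sum_group triv cong: PiE_cong)
      then show "x \<in> {\<one>\<^bsub>?S\<^esub>}"
        by (auto simp: PiE_iff extensional_def restrict_def fun_eq_iff)
    qed
    then have "trivial_group ?S"
      using grp monoid.one_closed [OF group.is_monoid [OF grp]] by (auto simp: trivial_group_def)
    then have "trivial_group (homology_group (int p) ?X)"
      using isomorphic_group_triviality [OF iso] by auto
    then show ?thesis
      by (simp add: betti_def group_rank_trivial abelian_homology_group)
  qed
  moreover have "betti 0 ?X = enat (card \<C>)"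
  proof -
    have "homology_group 0 ?X \<cong> sum_group \<C> (\<lambda>C. integer_group)"
    proof (rule iso_trans [OF iso], rule iso_sum_groupI)
      show "homology_group 0 (top_of_set C) \<cong> integer_group" if "C \<in> \<C>" for C
        using \<C> [OF that]
        by (intro isomorphic_integer_zeroth_homology_group) (auto simp: convex_imp_path_connected)
    qed auto
    also have "\<dots> \<cong> free_Abelian_group \<C>"
      by (rule isomorphic_sum_integer_group)
    finally have "group_rank (homology_group 0 ?X) = group_rank (free_Abelian_group \<C>)"
      by (intro group_rank_iso abelian_homology_group abelian_free_Abelian_group)
    then show ?thesis
      by (simp add: betti_def group_rank_free_Abelian_group [OF fin])
  qed
  ultimately have b: "betti p ?X = (if p = 0 then enat (card \<C>) else 0)" for p
    by simp
  \<comment> \<open>For the empty family even the Betti number in degree 0 vanishes, hence the case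
    distinction on the index set of the sum.\<close>
  then have "{p. betti p ?X \<noteq> 0} \<subseteq> {0}"
    by (auto split: if_splits)
  then have "{p. betti p ?X \<noteq> 0} = (if card \<C> = 0 then {} else {0})"
    using b by (auto simp: zero_enat_def)
  moreover have "\<forall>p. betti p ?X \<noteq> \<infinity>"
    using b by (auto simp: zero_enat_def)
  ultimately show ?thesis
    unfolding euler_characteristic_def using b by simp
qed

section \<open>Excursion sets of regular functions\<close>

text \<open>The consequence of \<open>C2\<close> that is used throughout: it is stable under
  composition and gives a quadratic Taylor remainder. The derivative is a parameter so that critical
  points can be expressed through it.\<close>

definition C1_Lip :: "('a::euclidean_space \<Rightarrow> 'b::real_normed_vector) \<Rightarrow> ('a \<Rightarrow> 'a \<Rightarrow>\<^sub>L 'b) \<Rightarrow> bool" where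
  "C1_Lip f f' \<longleftrightarrow> (\<forall>x. (f has_derivative blinfun_apply (f' x)) (at x)) \<and>
     (\<forall>S. bounded S \<longrightarrow> (\<exists>L. L-lipschitz_on S f'))"

lemma C1_Lip_has_derivative:
  "C1_Lip f f' \<Longrightarrow> (f has_derivative blinfun_apply (f' x)) (at x within S)"
  by (auto simp: C1_Lip_def has_derivative_at_withinI)

lemma C1_Lip_continuous: "C1_Lip f f' \<Longrightarrow> continuous_on S f"
  by (meson C1_Lip_has_derivative continuous_on_eq_continuous_within has_derivative_continuous)

lemma C1_Lip_continuous_deriv:
  assumes "C1_Lip f f'" shows "continuous_on S f'"
proof -
  have "continuous_on UNIV f'"
  proof (rule continuous_at_imp_continuous_on, intro ballI)
    fix x
    obtain L where "L-lipschitz_on (ball x 1) f'"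
      using assms bounded_ball unfolding C1_Lip_def by blast
    then have "continuous_on (ball x 1) f'"
      by (rule lipschitz_on_continuous_on)
    then show "isCont f' x"
      by (simp add: continuous_on_interior)
  qed
  then show ?thesis
    by (rule continuous_on_subset) auto
qed

lemma continuous_bounded_image:
  fixes f :: "'a::heine_borel \<Rightarrow> 'b::real_normed_vector"
  assumes "continuous_on UNIV f" "bounded S"
  obtains B where "B > 0" "\<And>x. x \<in> S \<Longrightarrow> norm (f x) \<le> B"
proof -
  have "compact (f ` closure S)"
    using assms by (intro compact_continuous_image) (auto intro: continuous_on_subset)
  then have "bounded (f ` S)"
    by (meson bounded_subset closure_subset compact_imp_bounded image_mono)
  then show ?thesis
    using that by (auto simp: bounded_pos)
qed

lemma C1_Lip_lipschitz:
  assumes "C1_Lip f f'" "bounded S"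
  obtains L where "L > 0" "L-lipschitz_on S f"
proof -
  obtain a r where S: "S \<subseteq> cball a r"
    using assms(2) by (auto simp: bounded_def cball_def subset_iff)
  obtain B where B: "B > 0" "\<And>x. x \<in> cball a r \<Longrightarrow> norm (f' x) \<le> B"
    using continuous_bounded_image [OF C1_Lip_continuous_deriv [OF assms(1)] bounded_cball] by metis
  have "B-lipschitz_on (cball a r) f"
    using B by (intro bounded_derivative_imp_lipschitz [of _ _ "\<lambda>x. blinfun_apply (f' x)"])
      (auto simp: C1_Lip_has_derivative [OF assms(1)] norm_blinfun.rep_eq [symmetric])
  then show ?thesis
    using that B(1) S lipschitz_on_subset by blast
qed

text \<open>Raising the constant to at least 1 makes it usable as a divisor.\<close>

lemma C1_Lip_deriv_lipschitz:
  assumes "C1_Lip f f'" "bounded S"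
  obtains L where "L > 0" "L-lipschitz_on S f'"
proof -
  obtain L where "L-lipschitz_on S f'"
    using assms by (auto simp: C1_Lip_def)
  then have "(max L 1)-lipschitz_on S f'"
    by (rule lipschitz_on_mono) auto
  then show ?thesis
    using that by (metis less_max_iff_disj zero_less_one)
qed

text \<open>The second derivative is bounded on a closed ball around \<open>S\<close>; the ball is
  convex, as the mean value inequality requires.\<close>

lemma C2_imp_C1_Lip:
  fixes f :: "'a::euclidean_space \<Rightarrow> 'b::real_normed_vector"
  assumes "C2 f"
  obtains f' where "C1_Lip f f'"
proof -
  obtain f' :: "'a \<Rightarrow> 'a \<Rightarrow>\<^sub>L 'b" and f'' :: "'a \<Rightarrow> 'a \<Rightarrow>\<^sub>L 'a \<Rightarrow>\<^sub>L 'b"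
    where f': "\<And>x. (f has_derivative blinfun_apply (f' x)) (at x)"
    and f'': "\<And>x. (f' has_derivative blinfun_apply (f'' x)) (at x)"
    and cont: "continuous_on UNIV f''"
    using assms by (auto simp: C2_def)
  have "\<exists>L. L-lipschitz_on S f'" if "bounded S" for S
  proof -
    obtain a r where S: "S \<subseteq> cball a r"
      using \<open>bounded S\<close> bounded_subset_cball by blast
    obtain B where B: "B > 0" "\<And>x. x \<in> cball a r \<Longrightarrow> norm (f'' x) \<le> B"
      using continuous_bounded_image [OF cont bounded_cball] by metis
    have "B-lipschitz_on (cball a r) f'"
      using B by (intro bounded_derivative_imp_lipschitz [of _ _ "\<lambda>x. blinfun_apply (f'' x)"])
        (auto simp: has_derivative_at_withinI [OF f''] norm_blinfun.rep_eq [symmetric])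
    then show ?thesis
      using S lipschitz_on_subset by blast
  qed
  with f' show ?thesis
    by (intro that [of f']) (auto simp: C1_Lip_def)
qed

lemma C1_Lip_compose:
  fixes h :: "'a::euclidean_space \<Rightarrow> 'b::euclidean_space"
  assumes g: "C1_Lip g g'" and h: "C1_Lip h h'"
  shows "C1_Lip (\<lambda>x. g (h x)) (\<lambda>x. g' (h x) o\<^sub>L h' x)"
  unfolding C1_Lip_def
proof (intro conjI allI impI)
  fix x
  show "((\<lambda>x. g (h x)) has_derivative blinfun_apply (g' (h x) o\<^sub>L h' x)) (at x)"
    using has_derivative_compose [OF C1_Lip_has_derivative [OF h, of x UNIV] C1_Lip_has_derivative [OF g, of _ UNIV]]
    by (simp add: blinfun_compose.rep_eq o_def)
next
  fix S :: "'a set" assume S: "bounded S"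
  obtain L1 where L1: "L1 > 0" "L1-lipschitz_on S h" using C1_Lip_lipschitz [OF h S] .
  obtain L2 where L2: "L2 > 0" "L2-lipschitz_on S h'" using C1_Lip_deriv_lipschitz [OF h S] .
  obtain B where "\<And>x. x \<in> S \<Longrightarrow> norm (h x) \<le> B"
    using continuous_bounded_image [OF C1_Lip_continuous [OF h] S] by metis
  then have hS: "bounded (h ` S)"
    by (auto simp: bounded_iff)
  obtain L3 where L3: "L3 > 0" "L3-lipschitz_on (h ` S) g'" using C1_Lip_deriv_lipschitz [OF g hS] .
  obtain B1 where B1: "B1 > 0" "\<And>x. x \<in> S \<Longrightarrow> norm (h' x) \<le> B1"
    using continuous_bounded_image [OF C1_Lip_continuous_deriv [OF h] S] by metis
  obtain B2 where B2: "B2 > 0" "\<And>x. x \<in> h ` S \<Longrightarrow> norm (g' x) \<le> B2"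
    using continuous_bounded_image [OF C1_Lip_continuous_deriv [OF g] hS] by metis
  have "(L3 * L1 * B1 + B2 * L2)-lipschitz_on S (\<lambda>x. g' (h x) o\<^sub>L h' x)"
  proof (rule lipschitz_onI)
    fix x y assume xy: "x \<in> S" "y \<in> S"
    \<comment> \<open>The difference of the products is telescoped so that each term contains a
      difference of one factor only.\<close>
    have "(g' (h x) o\<^sub>L h' x) - (g' (h y) o\<^sub>L h' y) =
        ((g' (h x) - g' (h y)) o\<^sub>L h' x) + (g' (h y) o\<^sub>L (h' x - h' y))"
      by (rule blinfun_eqI) (simp add: blinfun.bilinear_simps)
    then have "dist (g' (h x) o\<^sub>L h' x) (g' (h y) o\<^sub>L h' y)
       \<le> norm (g' (h x) - g' (h y)) * norm (h' x) + norm (g' (h y)) * norm (h' x - h' y)"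
      unfolding dist_norm by (metis norm_triangle_le add_mono norm_blinfun_compose)
    also have "\<dots> \<le> (L3 * (L1 * dist x y)) * B1 + B2 * (L2 * dist x y)"
    proof (intro add_mono mult_mono)
      have "norm (g' (h x) - g' (h y)) \<le> L3 * dist (h x) (h y)"
        using lipschitz_onD [OF L3(2)] xy by (auto simp: dist_norm)
      also have "\<dots> \<le> L3 * (L1 * dist x y)"
        using lipschitz_onD [OF L1(2)] xy L3(1) by simp
      finally show "norm (g' (h x) - g' (h y)) \<le> L3 * (L1 * dist x y)" .
      show "norm (h' x - h' y) \<le> L2 * dist x y"
        using lipschitz_onD [OF L2(2)] xy by (auto simp: dist_norm)
    qed (use B1 B2 L1 L3 xy in auto)
    finally show "dist (g' (h x) o\<^sub>L h' x) (g' (h y) o\<^sub>L h' y) \<le> (L3 * L1 * B1 + B2 * L2) * dist x y"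
      by (simp add: algebra_simps)
  qed (use L1 L2 L3 B1 B2 in auto)
  then show "\<exists>L. L-lipschitz_on S (\<lambda>x. g' (h x) o\<^sub>L h' x)" ..
qed

lemma C1_Lip_bounded_linear:
  fixes h :: "'a::euclidean_space \<Rightarrow> 'b::real_normed_vector"
  assumes "bounded_linear h"
  shows "C1_Lip (\<lambda>x. h x + a) (\<lambda>_. Blinfun h)"
  unfolding C1_Lip_def
proof (intro conjI allI impI)
  show "((\<lambda>x. h x + a) has_derivative blinfun_apply (Blinfun h)) (at x)" for x
    using assms by (auto simp: bounded_linear_Blinfun_apply intro!: derivative_eq_intros bounded_linear_imp_has_derivative)
  show "\<exists>L. L-lipschitz_on S (\<lambda>_. Blinfun h)" for S :: "'a set"
    by (intro exI [of _ 0]) (auto simp: lipschitz_on_def)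
qed

text \<open>Along the segment the derivative moves by at most \<open>L * norm (y - x)\<close>, which
  bounds the linearization error. The sharp factor 1/2 is given away.\<close>

lemma C1_Lip_taylor:
  assumes f: "C1_Lip f f'" and L: "L-lipschitz_on S f'" and S: "convex S" "x \<in> S" "y \<in> S"
  shows "norm (f y - f x - f' x (y - x)) \<le> L * (norm (y - x))\<^sup>2"
proof -
  have sub: "closed_segment x y \<subseteq> S"
    using S by (simp add: closed_segment_subset)
  have "norm (f y - f x - blinfun_apply (f' x) (y - x)) \<le> norm (y - x) * (L * norm (y - x))"
  proof (rule differentiable_bound_linearization [where S="closed_segment x y"])
    show "x + t *\<^sub>R (y - x) \<in> closed_segment x y" if "t \<in> {0..1}" for t
      using that by (auto simp: in_segment algebra_simps)
    show "(f has_derivative blinfun_apply (f' z)) (at z within closed_segment x y)" for z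
      by (rule C1_Lip_has_derivative [OF f])
    show "onorm (blinfun_apply (f' z) - blinfun_apply (f' x)) \<le> L * norm (y - x)"
      if "z \<in> closed_segment x y" for z
    proof -
      have "onorm (blinfun_apply (f' z) - blinfun_apply (f' x)) = norm (f' z - f' x)"
        by (simp add: norm_blinfun.rep_eq minus_blinfun.rep_eq fun_diff_def)
      also have "\<dots> \<le> L * norm (z - x)"
        using lipschitz_onD [OF L, of z x] that sub S by (auto simp: dist_norm)
      also have "\<dots> \<le> L * norm (y - x)"
        using segment_bound(1) [OF that] lipschitz_on_nonneg [OF L]
        by (intro mult_left_mono) (auto simp: norm_minus_commute)
      finally show ?thesis .
    qed
  qed auto
  then show ?thesis
    by (simp add: power2_eq_square algebra_simps)
qed

section \<open>Stability of excursion sets\<close>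

text \<open>For convex \<open>T\<close> this says that no point at level \<open>u\<close> satisfies
  the first-order condition for a maximum of \<open>f\<close> on \<open>T\<close>. One condition
  treats interior points, edges and corners alike.\<close>

definition regular_on :: "real \<Rightarrow> ('a::euclidean_space \<Rightarrow> real) \<Rightarrow> ('a \<Rightarrow> 'a \<Rightarrow>\<^sub>L real) \<Rightarrow> 'a set \<Rightarrow> bool" where
  "regular_on u f f' T \<longleftrightarrow> (\<forall>t\<in>T. f t = u \<longrightarrow> (\<exists>p\<in>T. f' t (p - t) > 0))"

lemma convex_flow:
  assumes "convex T" "finite P" "P \<subseteq> T" "x \<in> T" "\<And>p. p \<in> P \<Longrightarrow> 0 \<le> w p" "sum w P \<le> 1"
  shows "x + (\<Sum>p\<in>P. w p *\<^sub>R (p - x)) \<in> T"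
proof (cases "sum w P = 0")
  case True
  then have "\<forall>p\<in>P. w p = 0"
    using assms by (simp add: sum_nonneg_eq_0_iff)
  then show ?thesis using assms by simp
next
  case False
  define \<sigma> where "\<sigma> = sum w P"
  have \<sigma>: "0 < \<sigma>" "\<sigma> \<le> 1"
    using False assms sum_nonneg [of P w] by (auto simp: \<sigma>_def less_le)
  have "(\<Sum>p\<in>P. (w p / \<sigma>) *\<^sub>R p) \<in> T"
    using assms \<sigma> by (intro convex_sum) (auto simp: sum_divide_distrib [symmetric] \<sigma>_def [symmetric])
  then have "(1 - \<sigma>) *\<^sub>R x + \<sigma> *\<^sub>R (\<Sum>p\<in>P. (w p / \<sigma>) *\<^sub>R p) \<in> T"
    using assms \<sigma> by (intro convexD) auto
  also have "(1 - \<sigma>) *\<^sub>R x + \<sigma> *\<^sub>R (\<Sum>p\<in>P. (w p / \<sigma>) *\<^sub>R p) = x + (\<Sum>p\<in>P. w p *\<^sub>R (p - x))"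
    using \<sigma> by (simp add: scaleR_right_diff_distrib sum_subtractf scaleR_sum_right scaleR_left_diff_distrib
        \<sigma>_def scaleR_sum_left)
  finally show ?thesis .
qed

text \<open>
  The flow \<open>x + s V x\<close> raises the values of \<open>f\<close> near the level \<open>u\<close> and does not leave \<open>T\<close>, because
  the weights of the directions \<open>p - x\<close> are switched off where \<open>f\<close> does not increase towards \<open>p\<close>.
\<close>

lemma excursion_homotopy_stable:
  fixes T :: "'a::euclidean_space set"
  assumes T: "compact T" "convex T" and f: "C1_Lip f f'" and reg: "regular_on u f f' T"
  shows "\<exists>\<delta>>0. \<forall>g. continuous_on T g \<longrightarrow> (\<forall>t\<in>T. \<bar>g t - f t\<bar> \<le> \<delta>) \<longrightarrow>
     (\<forall>s\<in>T. \<forall>t\<in>T. \<bar>(g s - f s) - (g t - f t)\<bar> \<le> \<delta> * norm (s - t)) \<longrightarrow>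
     top_of_set {t \<in> T. f t \<ge> u} homotopy_equivalent_space top_of_set {t \<in> T. g t \<ge> u}"
proof -
  have contf: "continuous_on S f" and contf': "continuous_on S f'" for S
    using f C1_Lip_continuous C1_Lip_continuous_deriv by blast+
  define L where "L = {t \<in> T. f t = u}"
  have "compact L"
  proof -
    have "L = T \<inter> f -` {u}" by (auto simp: L_def)
    then show ?thesis
      using T contf by (metis continuous_closed_vimage closed_singleton compact_Int_closed continuous_on_eq_continuous_at open_UNIV UNIV_I)
  qed
  moreover have "open {x. f' x (p - x) > 0}" for p
    by (intro open_Collect_less continuous_intros contf')
  moreover have "L \<subseteq> (\<Union>p\<in>T. {x. f' x (p - x) > 0})"
    using reg by (auto simp: L_def regular_on_def)
  \<comment> \<open>Compactness of the level set leaves finitely many target points, so the field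
    \<open>V\<close> below is a finite sum.\<close>
  ultimately obtain P where P: "P \<subseteq> T" "finite P" "L \<subseteq> (\<Union>p\<in>P. {x. f' x (p - x) > 0})"
    by (metis (no_types, lifting) compactE_image)
  define w where "w x p = max 0 (f' x (p - x))" for x p
  define V where "V x = (\<Sum>p\<in>P. w x p *\<^sub>R (p - x))" for x
  have contw: "continuous_on S (\<lambda>x. w x p)" for p S
    unfolding w_def by (intro continuous_intros contf')
  have contV: "continuous_on S V" for S
    unfolding V_def by (intro continuous_intros contw)
  have f'V: "f' x (V x) = (\<Sum>p\<in>P. w x p * f' x (p - x))" for x
    by (simp add: V_def blinfun.sum_right blinfun.scaleR_right)
  have ge0: "0 \<le> w x p * f' x (p - x)" for x p
    by (simp add: w_def max_def)
  have pos: "f' x (V x) > 0" if "x \<in> L" for x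
  proof -
    obtain p where "p \<in> P" "f' x (p - x) > 0" using subsetD [OF P(3) \<open>x \<in> L\<close>] by auto
    then show ?thesis
      unfolding f'V using P ge0 by (intro sum_pos2 [of P p]) (auto simp: w_def)
  qed
  have bT: "bounded T" using T by (simp add: compact_imp_bounded)
  obtain B where B: "B > 0" "\<And>x. x \<in> T \<Longrightarrow> norm (V x) \<le> B"
    using continuous_bounded_image [OF contV bT] by metis
  obtain \<Lambda> where \<Lambda>: "\<Lambda> > 0" "\<And>x. x \<in> T \<Longrightarrow> norm (\<Sum>p\<in>P. w x p) \<le> \<Lambda>"
  proof -
    have "continuous_on UNIV (\<lambda>x. \<Sum>p\<in>P. w x p)"
      by (intro continuous_intros contw)
    then show ?thesis
      using continuous_bounded_image [OF _ bT] that by metis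
  qed
  obtain K where K: "K > 0" "K-lipschitz_on T f'"
    using C1_Lip_deriv_lipschitz [OF f bT] .
  obtain M where M: "M > 0" "M-lipschitz_on T f"
    using C1_Lip_lipschitz [OF f bT] .
  \<comment> \<open>The maximum of the distance to the level and of the rate of ascent along
    \<open>V\<close> is positive on \<open>T\<close>, hence at least \<open>2 * m\<close>; within
    \<open>m\<close> of the level, the rate must be the large one.\<close>
  obtain m where m: "m > 0" "\<And>x. x \<in> T \<Longrightarrow> \<bar>f x - u\<bar> \<le> m \<Longrightarrow> f' x (V x) \<ge> 2 * m"
  proof (cases "T = {}")
    case False
    have cont: "continuous_on T (\<lambda>x. max \<bar>f x - u\<bar> (f' x (V x)))"
      by (intro continuous_intros contf contf' contV)
    obtain x0 where x0: "x0 \<in> T" "\<And>x. x \<in> T \<Longrightarrow> max \<bar>f x0 - u\<bar> (f' x0 (V x0)) \<le> max \<bar>f x - u\<bar> (f' x (V x))"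
      using continuous_attains_inf [OF T(1) False cont] by blast
    define m where "m = max \<bar>f x0 - u\<bar> (f' x0 (V x0)) / 2"
    have "m > 0"
      using pos [of x0] x0(1) by (cases "f x0 = u") (auto simp: m_def L_def)
    moreover have "f' x (V x) \<ge> 2 * m" if "x \<in> T" "\<bar>f x - u\<bar> \<le> m" for x
    proof -
      have "2 * m \<le> max \<bar>f x - u\<bar> (f' x (V x))"
        using x0(2) [OF that(1)] by (simp add: m_def)
      then show ?thesis
        using that(2) \<open>m > 0\<close> by (auto simp: le_max_iff_disj)
    qed
    ultimately show ?thesis using that by blast
  qed (use that [of 1] in auto)
  \<comment> \<open>The three bounds keep the flow inside \<open>T\<close>, keep the Taylor error
    below half of the gain in height, and keep points above \<open>u + m\<close> above
    \<open>u + m / 2\<close>.\<close>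
  define \<epsilon> where "\<epsilon> = min (1 / \<Lambda>) (min (m / (K * B\<^sup>2)) (m / (2 * M * B)))"
  have \<epsilon>: "\<epsilon> > 0" "\<epsilon> * \<Lambda> \<le> 1" "K * \<epsilon> * B\<^sup>2 \<le> m" "M * \<epsilon> * B \<le> m / 2"
  proof -
    have "\<epsilon> \<le> 1 / \<Lambda>" "\<epsilon> \<le> m / (K * B\<^sup>2)" "\<epsilon> \<le> m / (2 * M * B)"
      by (auto simp: \<epsilon>_def)
    then show "\<epsilon> * \<Lambda> \<le> 1" "K * \<epsilon> * B\<^sup>2 \<le> m" "M * \<epsilon> * B \<le> m / 2"
      using \<Lambda> K B M by (simp_all add: field_simps)
    show "\<epsilon> > 0" using \<Lambda> K B M m by (simp add: \<epsilon>_def)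
  qed
  \<comment> \<open>The first bound prevents the variation of \<open>g - f\<close> along the flow
    from cancelling the gain, the second controls points away from the level, and the third makes
    the gain up to time 1 exceed the distance of \<open>g\<close> from \<open>f\<close>.\<close>
  define \<delta> where "\<delta> = min (m / (2 * B)) (min (m / 4) (\<epsilon> * m))"
  have \<delta>: "\<delta> > 0" "\<delta> * B \<le> m / 2" "\<delta> \<le> m / 4" "\<delta> \<le> \<epsilon> * m"
  proof -
    have "\<delta> \<le> m / (2 * B)" by (auto simp: \<delta>_def)
    then show "\<delta> * B \<le> m / 2" using B by (simp add: field_simps)
  qed (use m \<epsilon> B in \<open>auto simp: \<delta>_def\<close>)
  define h where "h s x = x + (s * \<epsilon>) *\<^sub>R V x" for s x
  have hT: "h s x \<in> T" if "x \<in> T" "s \<in> {0..1}" for s x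
  proof -
    have "s * \<epsilon> * sum (w x) P \<le> \<epsilon> * \<Lambda>"
    proof (rule mult_mono)
      show "sum (w x) P \<le> \<Lambda>"
        using \<Lambda>(2) [OF that(1)] by simp
      show "0 \<le> sum (w x) P"
        by (intro sum_nonneg) (auto simp: w_def)
    qed (use that \<epsilon> in \<open>auto simp: mult_left_le_one_le\<close>)
    then have "(\<Sum>p\<in>P. s * \<epsilon> * w x p) \<le> 1"
      using \<epsilon>(2) by (simp add: sum_distrib_left [symmetric])
    moreover have "0 \<le> s * \<epsilon> * w x p" for p
      using that(2) \<epsilon>(1) by (simp add: w_def)
    ultimately have "x + (\<Sum>p\<in>P. (s * \<epsilon> * w x p) *\<^sub>R (p - x)) \<in> T"
      using that P T by (intro convex_flow) auto
    then show ?thesis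
      by (simp add: h_def V_def scaleR_sum_right)
  qed
  have near: "f (h s x) \<ge> f x + s * \<epsilon> * m" if "x \<in> T" "s \<in> {0..1}" "\<bar>f x - u\<bar> \<le> m" for s x
  proof -
    have "\<bar>f (h s x) - f x - s * \<epsilon> * f' x (V x)\<bar> \<le> K * ((s * \<epsilon>) * norm (V x))\<^sup>2"
      using C1_Lip_taylor [OF f K(2) T(2) that(1) hT [OF that(1,2)]] that(2) \<epsilon>(1)
      by (simp add: h_def blinfun.scaleR_right)
    also have "\<dots> \<le> K * ((s * \<epsilon>) * B)\<^sup>2"
      using B(2) [OF that(1)] K(1) that(2) \<epsilon>(1) by (intro mult_left_mono power_mono) auto
    also have "\<dots> = (s * \<epsilon>) * (K * (s * \<epsilon>) * B\<^sup>2)"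
      by (simp add: power2_eq_square)
    also have "\<dots> \<le> (s * \<epsilon>) * m"
    proof (rule mult_left_mono)
      have "K * (s * \<epsilon>) * B\<^sup>2 \<le> K * \<epsilon> * B\<^sup>2"
        using that(2) \<epsilon>(1) K(1) by (intro mult_right_mono mult_left_mono) (auto simp: mult_left_le_one_le)
      with \<epsilon>(3) show "K * (s * \<epsilon>) * B\<^sup>2 \<le> m" by linarith
    qed (use that(2) \<epsilon>(1) in auto)
    finally have *: "f (h s x) - f x \<ge> s * \<epsilon> * f' x (V x) - s * \<epsilon> * m" by linarith
    have "s * \<epsilon> * f' x (V x) \<ge> s * \<epsilon> * (2 * m)"
      using m(2) [OF that(1,3)] that(2) \<epsilon>(1) by (intro mult_left_mono) auto
    with * show ?thesis by (simp add: algebra_simps)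
  qed
  have dist_h: "norm (h s x - x) \<le> s * \<epsilon> * B" if "x \<in> T" "s \<in> {0..1}" for s x
    using B(2) [OF that(1)] that(2) \<epsilon>(1) by (simp add: h_def mult_left_mono)
  have far: "f (h s x) \<ge> u + m / 2" if "x \<in> T" "s \<in> {0..1}" "f x > u + m" for s x
  proof -
    have "\<bar>f (h s x) - f x\<bar> \<le> M * norm (h s x - x)"
      using lipschitz_onD [OF M(2) hT [OF that(1,2)] that(1)] by (simp add: dist_norm)
    also have "\<dots> \<le> M * (1 * \<epsilon> * B)"
    proof (rule mult_left_mono)
      have "s * \<epsilon> * B \<le> 1 * \<epsilon> * B"
        using that(2) \<epsilon>(1) B(1) by (intro mult_right_mono) auto
      with dist_h [OF that(1,2)] show "norm (h s x - x) \<le> 1 * \<epsilon> * B" by linarith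
    qed (use M in auto)
    finally show ?thesis using \<epsilon>(4) that(3) by (simp add: algebra_simps)
  qed
  have conth: "continuous_on ({0..1} \<times> S) (\<lambda>(s, x). h s x)" for S
    unfolding h_def case_prod_unfold
    by (intro continuous_intros continuous_on_compose2 [OF contV [of UNIV]]) auto
  have h0: "h 0 x = x" for x by (simp add: h_def)
  show ?thesis
  proof (intro exI [of _ \<delta>] conjI allI impI \<delta>(1))
    fix g :: "'a \<Rightarrow> real"
    assume "continuous_on T g" and close: "\<forall>t\<in>T. \<bar>g t - f t\<bar> \<le> \<delta>"
      and closeL: "\<forall>s\<in>T. \<forall>t\<in>T. \<bar>(g s - f s) - (g t - f t)\<bar> \<le> \<delta> * norm (s - t)"
    define A where "A = {t \<in> T. f t \<ge> u}"
    define A' where "A' = {t \<in> T. g t \<ge> u}"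
    have fA: "h s x \<in> A" if "x \<in> A" "s \<in> {0..1}" for s x
    proof (cases "f x \<le> u + m")
      case True
      have "0 \<le> s * \<epsilon> * m" using that \<epsilon> m by auto
      with near [of x s] True that show ?thesis by (auto simp: A_def hT)
    next
      case False
      with far [of x s] that m show ?thesis by (auto simp: A_def hT)
    qed
    have gA: "h s x \<in> A'" if "x \<in> A'" "s \<in> {0..1}" for s x
    proof (cases "f x \<le> u + m")
      case True
      have x: "x \<in> T" "g x \<ge> u" using that by (auto simp: A'_def)
      have "\<bar>g x - f x\<bar> \<le> \<delta>" using close x by blast
      then have "f x \<ge> u - m" using x \<delta>(3) m(1) by linarith
      then have "f (h s x) \<ge> f x + s * \<epsilon> * m" using near [of x s] True x that by auto
      moreover have "\<bar>(g (h s x) - f (h s x)) - (g x - f x)\<bar> \<le> \<delta> * (s * \<epsilon> * B)"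
        using bspec [OF bspec [OF closeL hT [OF x(1) that(2)]] x(1)]
          mult_left_mono [OF dist_h [OF x(1) that(2)], of \<delta>] \<delta>(1)
        by linarith
      moreover have "\<delta> * (s * \<epsilon> * B) \<le> s * \<epsilon> * m"
      proof -
        have "(s * \<epsilon>) * (\<delta> * B) \<le> (s * \<epsilon>) * m"
          using \<delta>(2) m(1) that(2) \<epsilon>(1) by (intro mult_left_mono) auto
        then show ?thesis by (simp add: algebra_simps)
      qed
      ultimately have "g (h s x) \<ge> g x" by linarith
      then show ?thesis using x hT that by (auto simp: A'_def)
    next
      case False
      have x: "x \<in> T" using that by (auto simp: A'_def)
      then have "\<bar>g (h s x) - f (h s x)\<bar> \<le> \<delta>" using close hT that by blast
      moreover have "f (h s x) \<ge> u + m / 2" using far x False that by auto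
      ultimately have "g (h s x) \<ge> u" using \<delta>(3) m(1) by linarith
      then show ?thesis using x hT that by (auto simp: A'_def)
    qed
    have fg: "h 1 x \<in> A'" if "x \<in> A" for x
    proof -
      have x: "x \<in> T" "f x \<ge> u" "h 1 x \<in> T" using that hT [of x 1] by (auto simp: A_def)
      then have "\<bar>g (h 1 x) - f (h 1 x)\<bar> \<le> \<delta>" using close by blast
      moreover have "f (h 1 x) \<ge> f x + \<epsilon> * m \<or> f (h 1 x) \<ge> u + m / 2"
        using near [of x 1] far [of x 1] x by (cases "f x \<le> u + m") auto
      ultimately have "g (h 1 x) \<ge> u" using \<delta>(3,4) m(1) x by linarith
      then show ?thesis using x by (simp add: A'_def)
    qed
    have gf: "h 1 x \<in> A" if "x \<in> A'" for x
    proof -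
      have x: "x \<in> T" "g x \<ge> u" "h 1 x \<in> T" using that hT [of x 1] by (auto simp: A'_def)
      then have "\<bar>g x - f x\<bar> \<le> \<delta>" using close by blast
      then have fx: "f x \<ge> u - \<delta>" using x by linarith
      then have "f (h 1 x) \<ge> f x + \<epsilon> * m \<or> f (h 1 x) \<ge> u + m / 2"
        using near [of x 1] far [of x 1] x \<delta>(3) m(1) by (cases "f x \<le> u + m") auto
      then have "f (h 1 x) \<ge> u" using fx \<delta>(4) m(1) by linarith
      then show ?thesis using x by (simp add: A_def)
    qed
    have conth1: "continuous_on S (h 1)" for S
      unfolding h_def by (intro continuous_intros contV)
    \<comment> \<open>Both excursion sets are preserved at every time, so applying
      \<open>h s\<close> twice joins the identity to \<open>h 1 \<circ> h 1\<close> inside either of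
      them.\<close>
    have hom: "homotopic_with (\<lambda>_. True) (top_of_set S) (top_of_set S) (h 1 \<circ> h 1) id"
      if S: "\<And>x s. x \<in> S \<Longrightarrow> s \<in> {0..1} \<Longrightarrow> h s x \<in> S" for S
    proof -
      have "continuous_on ({0..1} \<times> S) (\<lambda>z. h (fst z) (h (fst z) (snd z)))"
      proof -
        have 1: "continuous_on ({0..1} \<times> S) (\<lambda>z. (fst z, h (fst z) (snd z)))"
          using conth [of S] by (intro continuous_intros) (auto simp: case_prod_unfold)
        have "continuous_on ({0..1} \<times> S) ((\<lambda>(s, x). h s x) \<circ> (\<lambda>z. (fst z, h (fst z) (snd z))))"
          using S by (intro continuous_on_compose 1 continuous_on_subset [OF conth [of UNIV]]) auto
        then show ?thesis by (simp add: o_def)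
      qed
      moreover have "prod_topology (top_of_set {0..1::real}) (top_of_set S) = top_of_set ({0..1} \<times> S)"
        by (simp flip: subtopology_Times)
      ultimately have "homotopic_with_canon (\<lambda>_. True) S S id (h 1 \<circ> h 1)"
        unfolding homotopic_with_def using S
        by (intro exI [of _ "\<lambda>z. h (fst z) (h (fst z) (snd z))"])
          (auto simp: h0 continuous_map_in_subtopology image_subset_iff)
      then show ?thesis
        by (simp add: homotopic_with_sym)
    qed
    \<comment> \<open>The same map \<open>h 1\<close> serves in both directions.\<close>
    have "top_of_set A homotopy_equivalent_space top_of_set A'"
      unfolding homotopy_equivalent_space_def
      by (intro exI [of _ "h 1"] conjI hom)
        (use fA gA fg gf in \<open>auto simp: conth1\<close>)
    then show "top_of_set {t \<in> T. f t \<ge> u} homotopy_equivalent_space top_of_set {t \<in> T. g t \<ge> u}"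
      by (simp add: A_def A'_def)
  qed
qed

section \<open>Recovering the Euler characteristic from countable data\<close>

text \<open>The inequality is a closed condition in each variable, so it passes to the closure one
  variable at a time.\<close>

lemma lipschitz_from_dense:
  fixes h :: "'a::real_normed_vector \<Rightarrow> real"
  assumes h: "continuous_on UNIV h" and Q: "T \<subseteq> closure Q"
    and lip: "\<And>p q. p \<in> Q \<Longrightarrow> q \<in> Q \<Longrightarrow> \<bar>h p - h q\<bar> \<le> K * norm (p - q)"
    and pq: "p \<in> T" "q \<in> T"
  shows "\<bar>h p - h q\<bar> \<le> K * norm (p - q)"
proof -
  have 1: "closure Q \<subseteq> {p. \<bar>h p - h q\<bar> \<le> K * norm (p - q)}" if "q \<in> Q" for q
    using lip that by (intro closure_minimal closed_Collect_le continuous_intros h) auto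
  have "closure Q \<subseteq> {q. \<bar>h p - h q\<bar> \<le> K * norm (p - q)}"
    using 1 pq Q by (intro closure_minimal closed_Collect_le continuous_intros h) auto
  then show ?thesis using pq Q by auto
qed

lemma floor_eq_imp_close:
  fixes x y c :: real
  assumes "\<lfloor>c * x\<rfloor> = \<lfloor>c * y\<rfloor>" "c > 0"
  shows "\<bar>x - y\<bar> \<le> 1 / c"
proof -
  have "\<bar>c * x - c * y\<bar> \<le> 1" using assms(1) by linarith
  then have "c * \<bar>x - y\<bar> \<le> 1" using assms(2) by (simp add: abs_mult flip: right_diff_distrib)
  then show ?thesis using assms(2) by (simp add: field_simps)
qed

text \<open>A directional derivative as a limit along a sequence: it is defined for every path and
  depends on countably many coordinates, hence is measurable on path space.\<close>

definition deriv_seq :: "'a::real_normed_vector \<Rightarrow> ('a \<Rightarrow> real) \<Rightarrow> 'a \<Rightarrow> real" where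
  "deriv_seq b f p = lim (\<lambda>k. (f (p + (1 / real (Suc k)) *\<^sub>R b) - f p) * real (Suc k))"

lemma deriv_seq_eq:
  assumes "(f has_derivative f') (at p)"
  shows "deriv_seq b f p = f' b"
proof -
  have "((\<lambda>h. f (p + h *\<^sub>R b)) has_derivative (\<lambda>h. f' (h *\<^sub>R b))) (at 0)"
    using assms by (auto intro!: derivative_eq_intros has_derivative_compose [of "\<lambda>h. p + h *\<^sub>R b" _ _ _ f])
  then have "((\<lambda>h. f (p + h *\<^sub>R b)) has_real_derivative f' b) (at 0)"
    using linear_cmul [OF has_derivative_linear [OF assms]]
    by (simp add: has_field_derivative_def mult_commute_abs)
  then have *: "((\<lambda>h. (f (p + h *\<^sub>R b) - f p) / h) \<longlongrightarrow> f' b) (at 0)"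
    by (simp add: has_field_derivative_iff)
  have "filterlim (\<lambda>k. 1 / real (Suc k)) (at 0) sequentially"
    unfolding filterlim_at by (auto simp del: of_nat_Suc intro!: LIMSEQ_Suc [OF lim_1_over_n])
  from filterlim_compose [OF * this]
  have "(\<lambda>k. (f (p + (1 / real (Suc k)) *\<^sub>R b) - f p) * real (Suc k)) \<longlonglongrightarrow> f' b"
    by simp
  then show ?thesis
    unfolding deriv_seq_def by (rule limI)
qed

lemma deriv_seq_measurable [measurable]:
  "(\<lambda>f. deriv_seq b f p) \<in> borel_measurable (\<Pi>\<^sub>M t\<in>UNIV. borel)"
  unfolding deriv_seq_def by measurable

text \<open>\<open>K\<close> bounds the oscillation of the partial derivatives on a countable dense
  set, while \<open>a\<close> and \<open>d\<close> record values and partial derivatives on a finite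
  net, rounded down to multiples of \<open>1 / (n + 1)\<close>. The integer data make the number of
  classes countable.\<close>

definition sample_class :: "'a set \<Rightarrow> (nat \<Rightarrow> 'a set) \<Rightarrow> nat \<Rightarrow> nat \<Rightarrow> ('a::euclidean_space \<Rightarrow> int) \<Rightarrow> ('a \<times> 'a \<Rightarrow> int) \<Rightarrow> ('a \<Rightarrow> real) set" where
  "sample_class Q G K n a d = {f.
     (\<forall>p\<in>Q. \<forall>q\<in>Q. \<forall>b\<in>Basis. \<bar>deriv_seq b f p - deriv_seq b f q\<bar> \<le> real K * norm (p - q)) \<and>
     (\<forall>p\<in>G n. \<lfloor>real (Suc n) * f p\<rfloor> = a p) \<and>
     (\<forall>b\<in>Basis. \<forall>p\<in>G n. \<lfloor>real (Suc n) * deriv_seq b f p\<rfloor> = d (b, p))}"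

lemma sample_class_measurable:
  assumes "countable Q" "finite (G n)"
  shows "sample_class Q G K n a d \<in> sets (\<Pi>\<^sub>M t\<in>UNIV. borel)"
proof -
  have [measurable]: "(\<lambda>f. f p) \<in> borel_measurable (\<Pi>\<^sub>M t\<in>UNIV. borel)" for p :: 'a
    by simp
  have [simp]: "countable (G n)" using assms(2) by (rule countable_finite)
  have "{f \<in> space (\<Pi>\<^sub>M t\<in>UNIV. borel).
     (\<forall>p\<in>Q. \<forall>q\<in>Q. \<forall>b\<in>Basis. \<bar>deriv_seq b f p - deriv_seq b f q\<bar> \<le> real K * norm (p - q)) \<and>
     (\<forall>p\<in>G n. \<lfloor>real (Suc n) * f p\<rfloor> = a p) \<and>
     (\<forall>b\<in>Basis. \<forall>p\<in>G n. \<lfloor>real (Suc n) * deriv_seq b f p\<rfloor> = d (b, p))} \<in> sets (\<Pi>\<^sub>M t\<in>UNIV. borel)"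
    using assms(1) by (intro sets.sets_Collect_conj sets.sets_Collect_countable_Ball) (auto intro: countable_finite)
  then show ?thesis
    by (simp add: sample_class_def space_PiM)
qed

text \<open>At a net point the partial derivatives differ by at most \<open>1 / (n + 1)\<close>;
  passing to a nearby point costs \<open>K / (n + 1)\<close> for each of the two functions. Summing
  over the basis produces the factor \<open>DIM('a)\<close>.\<close>

lemma sample_class_close:
  fixes T :: "'a::euclidean_space set"
  assumes Q: "T \<subseteq> closure Q" and G: "T \<subseteq> (\<Union>p\<in>G n. ball p (1 / real (Suc n)))" "G n \<subseteq> T" and T: "convex T"
    and f: "f \<in> sample_class Q G K n a d" "C1_Lip f f'"
    and g: "g \<in> sample_class Q G K n a d" "C1_Lip g g'"
  defines "\<eta> \<equiv> real DIM('a) * ((2 * real K + 1) / real (Suc n))"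
  shows "\<And>s t. s \<in> T \<Longrightarrow> t \<in> T \<Longrightarrow> \<bar>(g s - f s) - (g t - f t)\<bar> \<le> \<eta> * norm (s - t)"
    and "\<And>t. t \<in> T \<Longrightarrow> \<bar>g t - f t\<bar> \<le> 1 / real (Suc n) + \<eta>"
proof -
  define N where "N = 1 / real (Suc n)"
  have N: "0 < N" "N \<le> 1" by (auto simp: N_def)
  have lip: "\<bar>h' p b - h' q b\<bar> \<le> real K * norm (p - q)"
    if "h \<in> sample_class Q G K n a d" "C1_Lip h h'" "p \<in> T" "q \<in> T" "b \<in> Basis" for h h' p q b
  proof (rule lipschitz_from_dense [OF _ Q _ that(3,4)])
    show "continuous_on UNIV (\<lambda>x. blinfun_apply (h' x) b)"
      by (intro continuous_intros C1_Lip_continuous_deriv [OF that(2)])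
    show "\<bar>h' p b - h' q b\<bar> \<le> real K * norm (p - q)" if "p \<in> Q" "q \<in> Q" for p q
      using \<open>h \<in> _\<close> that \<open>b \<in> Basis\<close> unfolding sample_class_def
      by (auto simp: deriv_seq_eq [OF C1_Lip_has_derivative [OF \<open>C1_Lip h h'\<close>]])
  qed
  have d': "norm (g' t - f' t) \<le> \<eta>" if "t \<in> T" for t
  proof -
    obtain p where p: "p \<in> G n" "norm (t - p) \<le> N" "p \<in> T"
    proof -
      obtain p where "p \<in> G n" "t \<in> ball p N"
        using subsetD [OF G(1) \<open>t \<in> T\<close>] unfolding N_def by blast
      then show ?thesis
        using that [of p] G(2) by (auto simp: dist_norm norm_minus_commute)
    qed
    have "norm ((g' t - f' t) b) \<le> (2 * real K + 1) * N" if b: "b \<in> Basis" for b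
    proof -
      have "\<bar>g' p b - f' p b\<bar> \<le> N"
        unfolding N_def using f g p b
        by (intro floor_eq_imp_close)
          (auto simp: sample_class_def deriv_seq_eq [OF C1_Lip_has_derivative [OF \<open>C1_Lip f f'\<close>]]
            deriv_seq_eq [OF C1_Lip_has_derivative [OF \<open>C1_Lip g g'\<close>]])
      moreover have "real K * norm (t - p) \<le> real K * N"
        using p by (intro mult_left_mono) auto
      ultimately show ?thesis
        using lip [OF f \<open>t \<in> T\<close> p(3) b] lip [OF g \<open>t \<in> T\<close> p(3) b]
        by (simp add: blinfun.diff_left algebra_simps)
    qed
    then have "norm (g' t - f' t) \<le> (\<Sum>b\<in>(Basis::'a set). (2 * real K + 1) * N)"
      by (intro order_trans [OF norm_blinfun_euclidean_le] sum_mono)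
    then show ?thesis by (simp add: \<eta>_def N_def)
  qed
  show L: "\<bar>(g s - f s) - (g t - f t)\<bar> \<le> \<eta> * norm (s - t)" if "s \<in> T" "t \<in> T" for s t
  proof -
    have "norm ((g s - f s) - (g t - f t)) \<le> \<eta> * norm (s - t)"
    proof (rule differentiable_bound [where f = "\<lambda>x. g x - f x" and f' = "\<lambda>x. blinfun_apply (g' x - f' x)", OF T _ _ that])
      show "((\<lambda>x. g x - f x) has_derivative blinfun_apply (g' x - f' x)) (at x within T)" for x
        using has_derivative_diff [OF C1_Lip_has_derivative [OF g(2)] C1_Lip_has_derivative [OF f(2)]]
        by (simp add: minus_blinfun.rep_eq)
      show "onorm (blinfun_apply (g' x - f' x)) \<le> \<eta>" if "x \<in> T" for x
        using d' [OF that] by (simp add: norm_blinfun.rep_eq)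
    qed
    then show ?thesis by simp
  qed
  show "\<bar>g t - f t\<bar> \<le> 1 / real (Suc n) + \<eta>" if "t \<in> T" for t
  proof -
    obtain p where p: "p \<in> G n" "norm (t - p) \<le> N" "p \<in> T"
    proof -
      obtain p where "p \<in> G n" "t \<in> ball p N"
        using subsetD [OF G(1) \<open>t \<in> T\<close>] unfolding N_def by blast
      then show ?thesis
        using that [of p] G(2) by (auto simp: dist_norm norm_minus_commute)
    qed
    have "\<bar>g p - f p\<bar> \<le> N"
      unfolding N_def using f g p by (intro floor_eq_imp_close) (auto simp: sample_class_def)
    moreover have "\<eta> * norm (t - p) \<le> \<eta> * 1"
      using p N by (intro mult_left_mono) (auto simp: \<eta>_def)
    ultimately show ?thesis
      using L [OF that p(3)] by (simp add: N_def)
  qed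
qed

text \<open>By stability, every regular function lies in a sample class on which the Euler
  characteristic is constant. Countable unions of such classes are measurable and determine the
  value.\<close>

lemma euler_characteristic_measurable:
  fixes T :: "'a::euclidean_space set"
  assumes T: "compact T" "convex T"
  obtains \<Phi> where "\<Phi> \<in> borel_measurable (\<Pi>\<^sub>M t\<in>UNIV. borel)"
    and "\<And>f f'. C1_Lip f f' \<Longrightarrow> regular_on u f f' T \<Longrightarrow>
           \<Phi> f = real_of_int (euler_characteristic (top_of_set {t \<in> T. f t \<ge> u}))"
proof -
  let ?M = "\<Pi>\<^sub>M t\<in>(UNIV::'a set). (borel :: real measure)"
  define ec where "ec f = euler_characteristic (top_of_set {t \<in> T. f t \<ge> u})" for f
  obtain Q where Q: "countable Q" "Q \<subseteq> T" "T \<subseteq> closure Q"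
    using separable by blast
  have "\<exists>G. finite G \<and> G \<subseteq> T \<and> T \<subseteq> (\<Union>p\<in>G. ball p (1 / real (Suc n)))" for n
  proof (rule compactE_image [OF T(1), of T "\<lambda>p. ball p (1 / real (Suc n))"])
    show "T \<subseteq> (\<Union>p\<in>T. ball p (1 / real (Suc n)))" by force
  qed auto
  then obtain G where G: "\<And>n. finite (G n)" "\<And>n. G n \<subseteq> T" "\<And>n. T \<subseteq> (\<Union>p\<in>G n. ball p (1 / real (Suc n)))"
    by metis
  define J where "J = (UNIV :: nat set) \<times> (SIGMA n:UNIV. (G n \<rightarrow>\<^sub>E (UNIV::int set)) \<times> (((Basis::'a set) \<times> G n) \<rightarrow>\<^sub>E (UNIV::int set)))"
  define cls where "cls = (\<lambda>(K, n, a, d). sample_class Q G K n a d)"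
  \<comment> \<open>All \<open>C1_Lip\<close> members of a class are tested, regular or not; this is
    what makes the value \<open>k\<close> unique on \<open>S k\<close>.\<close>
  define good where "good k i \<longleftrightarrow> (\<forall>f\<in>cls i. \<forall>f'. C1_Lip f f' \<longrightarrow> ec f = k)" for k i
  define S where "S k = (\<Union>i\<in>{i \<in> J. good k i}. cls i)" for k
  have "countable J"
    unfolding J_def using G by (intro countable_SIGMA countable_PiE) auto
  moreover have "cls i \<in> sets ?M" for i
    unfolding cls_def by (auto intro!: sample_class_measurable G Q split: prod.split)
  ultimately have S [measurable]: "S k \<in> sets ?M" for k
    unfolding S_def by (intro sets.countable_UN'') (auto intro: countable_subset)
  have uniq: "k = ec f" if "f \<in> S k" "C1_Lip f f'" for f f' k
    using that by (auto simp: S_def good_def)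
  have mem: "f \<in> S (ec f)" if f: "C1_Lip f f'" and reg: "regular_on u f f' T" for f f'
  proof -
    obtain \<delta> where \<delta>: "\<delta> > 0" and hom: "\<And>g. continuous_on T g \<Longrightarrow> \<forall>t\<in>T. \<bar>g t - f t\<bar> \<le> \<delta> \<Longrightarrow>
       \<forall>s\<in>T. \<forall>t\<in>T. \<bar>(g s - f s) - (g t - f t)\<bar> \<le> \<delta> * norm (s - t) \<Longrightarrow>
       top_of_set {t \<in> T. f t \<ge> u} homotopy_equivalent_space top_of_set {t \<in> T. g t \<ge> u}"
      using excursion_homotopy_stable [OF T f reg] by blast
    obtain L where L: "L-lipschitz_on T f'"
      using C1_Lip_deriv_lipschitz [OF f compact_imp_bounded [OF T(1)]] .
    obtain K :: nat where K: "L \<le> real K"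
      using real_arch_simple by blast
    \<comment> \<open>\<open>c / (n + 1)\<close> is the total error in
      \<open>sample_class_close\<close>; \<open>n\<close> is then chosen to bring it below
      \<open>\<delta>\<close>.\<close>
    define c where "c = 1 + real DIM('a) * (2 * real K + 1)"
    have c: "c > 0" by (auto simp: c_def add_pos_nonneg)
    obtain n where n: "inverse (real (Suc n)) < \<delta> / c"
      using reals_Archimedean [of "\<delta> / c"] \<delta> c by auto
    then have n': "c / real (Suc n) \<le> \<delta>"
      using c by (simp add: field_simps)
    define a where "a = (\<lambda>p\<in>G n. \<lfloor>real (Suc n) * f p\<rfloor>)"
    define d where "d = (\<lambda>(b, p)\<in>Basis \<times> G n. \<lfloor>real (Suc n) * deriv_seq b f p\<rfloor>)"
    have J: "(K, n, a, d) \<in> J"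
      by (auto simp: J_def a_def d_def)
    have fc: "f \<in> sample_class Q G K n a d"
      unfolding sample_class_def
    proof (intro CollectI conjI ballI)
      fix p q b :: 'a assume pq: "p \<in> Q" "q \<in> Q" "b \<in> Basis"
      have "\<bar>f' p b - f' q b\<bar> = norm ((f' p - f' q) b)"
        by (simp add: blinfun.diff_left)
      also have "\<dots> \<le> norm (f' p - f' q)"
        using norm_blinfun [of "f' p - f' q" b] pq by simp
      also have "\<dots> \<le> L * norm (p - q)"
        using lipschitz_onD [OF L, of p q] pq Q by (auto simp: dist_norm)
      also have "\<dots> \<le> real K * norm (p - q)"
        using K by (intro mult_right_mono) auto
      finally show "\<bar>deriv_seq b f p - deriv_seq b f q\<bar> \<le> real K * norm (p - q)"
        by (simp add: deriv_seq_eq [OF C1_Lip_has_derivative [OF f]])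
    qed (auto simp: a_def d_def)
    have "ec g = ec f" if g: "g \<in> sample_class Q G K n a d" "C1_Lip g g'" for g g'
    proof -
      let ?\<eta> = "real DIM('a) * ((2 * real K + 1) / real (Suc n))"
      have "?\<eta> \<le> c / real (Suc n)"
        unfolding c_def by (simp add: field_simps)
      then have 1: "?\<eta> \<le> \<delta>" using n' by linarith
      have "1 / real (Suc n) + ?\<eta> = c / real (Suc n)"
        unfolding c_def by (simp add: field_simps)
      then have 2: "1 / real (Suc n) + ?\<eta> \<le> \<delta>" using n' by linarith
      note close = sample_class_close [OF Q(3) G(3) G(2) T(2) fc f g]
      have "\<bar>(g s - f s) - (g t - f t)\<bar> \<le> \<delta> * norm (s - t)" if "s \<in> T" "t \<in> T" for s t
        using close(1) [OF that] mult_right_mono [OF 1, of "norm (s - t)"] by simp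
      moreover have "\<bar>g t - f t\<bar> \<le> \<delta>" if "t \<in> T" for t
        using close(2) [OF that] 2 by linarith
      ultimately show ?thesis
        unfolding ec_def
        by (intro euler_characteristic_homotopy_equivalent [symmetric] hom C1_Lip_continuous [OF g(2)]) auto
    qed
    then have "good (ec f) (K, n, a, d)"
      by (auto simp: good_def cls_def)
    with J fc show ?thesis
      by (auto simp: S_def cls_def intro!: bexI [of _ "(K, n, a, d)"])
  qed
  \<comment> \<open>Searching through an enumeration of the integers keeps the choice of value
    measurable.\<close>
  define \<Phi> where "\<Phi> f = real_of_int (int_decode (LEAST j. f \<in> S (int_decode j)))" for f
  have "(\<lambda>f. LEAST j. f \<in> S (int_decode j)) \<in> measurable ?M (count_space UNIV)"
    by measurable
  then have "\<Phi> \<in> borel_measurable ?M"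
    unfolding \<Phi>_def by (rule measurable_compose) simp
  moreover have "\<Phi> f = real_of_int (ec f)" if "C1_Lip f f'" "regular_on u f f' T" for f f'
  proof -
    have "(LEAST j. f \<in> S (int_decode j)) = int_encode (ec f)"
    proof (rule Least_equality)
      show "f \<in> S (int_decode (int_encode (ec f)))"
        using mem [OF that] by simp
      show "int_encode (ec f) \<le> j" if "f \<in> S (int_decode j)" for j
        using uniq [OF that \<open>C1_Lip f f'\<close>] by (metis int_decode_inverse order_refl)
    qed
    then show ?thesis
      by (simp add: \<Phi>_def)
  qed
  ultimately show ?thesis
    using that by (auto simp: ec_def)
qed

section \<open>Gaussian variables\<close>

lemma (in prob_space) char_distr:
  assumes [measurable]: "Y \<in> borel_measurable M"
  shows "char (distr M borel Y) t = (CLINT \<omega>|M. iexp (t * Y \<omega>))"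
  unfolding char_def by (subst integral_distr) auto

lemma (in prob_space) distributed_std_normal_iexp:
  assumes "distributed M lborel Y std_normal_density"
  shows "(CLINT \<omega>|M. iexp (t * Y \<omega>)) = of_real (exp (- t\<^sup>2 / 2))"
proof -
  have Y: "Y \<in> borel_measurable M" and D: "distr M lborel Y = std_normal_distribution"
    using assms by (auto simp: distributed_def)
  have "distr M borel Y = distr M lborel Y"
    by (intro distr_cong) auto
  then show ?thesis
    using char_distr [OF Y, of t] D by (simp add: char_std_normal_distribution)
qed

lemma (in prob_space) gaussian_rv_square_integrable:
  assumes "gaussian_rv M Y"
  shows "integrable M Y" "integrable M (\<lambda>\<omega>. (Y \<omega>)\<^sup>2)"
proof -
  have [measurable]: "Y \<in> borel_measurable M" using assms by (simp add: gaussian_rv_def)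
  from assms consider \<mu> where "distr M borel Y = return borel \<mu>"
    | \<mu> \<sigma> where "\<sigma> > 0" "distributed M lborel Y (normal_density \<mu> \<sigma>)"
    unfolding gaussian_rv_def by blast
  then have "integrable M Y \<and> integrable M (\<lambda>\<omega>. (Y \<omega>)\<^sup>2)"
  proof cases
    case 1
    have "AE y in distr M borel Y. y = \<mu>"
      unfolding 1 by (subst AE_return) auto
    then have "AE \<omega> in M. Y \<omega> = \<mu>"
      by (subst (asm) AE_distr_iff) auto
    then have "AE \<omega> in M. norm (Y \<omega>) \<le> \<bar>\<mu>\<bar>" "AE \<omega> in M. norm ((Y \<omega>)\<^sup>2) \<le> \<mu>\<^sup>2"
      by auto
    then show ?thesis
      using integrable_const_bound [of Y] integrable_const_bound [of "\<lambda>\<omega>. (Y \<omega>)\<^sup>2"] by simp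
  next
    case 2
    have i: "integrable lborel (\<lambda>x. normal_density \<mu> \<sigma> x * x)"
      by (rule integrable_normal_moment_nz_1 [OF 2(1)])
    have "integrable lborel (\<lambda>x. normal_density \<mu> \<sigma> x * (x - \<mu>)\<^sup>2)"
      using integrable_normal_moment [OF 2(1), of \<mu> 2] .
    \<comment> \<open>The square is expanded around the mean, where the second moment is known to be
      finite.\<close>
    then have "integrable lborel (\<lambda>x. normal_density \<mu> \<sigma> x * (x - \<mu>)\<^sup>2 + 2 * \<mu> * (normal_density \<mu> \<sigma> x * x) - \<mu>\<^sup>2 * normal_density \<mu> \<sigma> x)"
      using i 2(1) by (intro Bochner_Integration.integrable_add Bochner_Integration.integrable_diff integrable_mult_right) auto
    also have "(\<lambda>x. normal_density \<mu> \<sigma> x * (x - \<mu>)\<^sup>2 + 2 * \<mu> * (normal_density \<mu> \<sigma> x * x) - \<mu>\<^sup>2 * normal_density \<mu> \<sigma> x)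
      = (\<lambda>x. normal_density \<mu> \<sigma> x * x\<^sup>2)"
      by (auto simp: power2_eq_square algebra_simps)
    finally show ?thesis
      using distributed_integrable [OF 2(2), of "\<lambda>x. x"] distributed_integrable [OF 2(2), of "\<lambda>x. x\<^sup>2"] i by auto
  qed
  then show "integrable M Y" "integrable M (\<lambda>\<omega>. (Y \<omega>)\<^sup>2)" by auto
qed

lemma (in prob_space) gaussian_rv_char:
  assumes g: "gaussian_rv M Y" and m: "expectation Y = 0"
  shows "(CLINT \<omega>|M. iexp (Y \<omega>)) = of_real (exp (- expectation (\<lambda>\<omega>. (Y \<omega>)\<^sup>2) / 2))"
proof -
  have [measurable]: "Y \<in> borel_measurable M" using g by (simp add: gaussian_rv_def)
  from g consider \<mu> where "distr M borel Y = return borel \<mu>"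
    | \<mu> \<sigma> where "\<sigma> > 0" "distributed M lborel Y (normal_density \<mu> \<sigma>)"
    unfolding gaussian_rv_def by blast
  then show ?thesis
  proof cases
    case 1
    have i: "(LINT \<omega>|M. h (Y \<omega>)) = h \<mu>" if [measurable]: "h \<in> borel_measurable borel" for h :: "real \<Rightarrow> real"
      using integral_distr [of Y M borel h] 1 by (simp add: integral_return)
    have ic: "(CLINT \<omega>|M. iexp (Y \<omega>)) = iexp \<mu>"
      using integral_distr [of Y M borel "\<lambda>y. iexp y"] 1 by (simp add: integral_return)
    have "\<mu> = 0" using i [of "\<lambda>x. x"] m by simp
    then show ?thesis using i [of "\<lambda>x. x\<^sup>2"] ic by simp
  next
    case 2
    have \<mu>: "\<mu> = 0" using normal_distributed_expectation [OF 2] m by simp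
    have v: "expectation (\<lambda>\<omega>. (Y \<omega>)\<^sup>2) = \<sigma>\<^sup>2"
      using normal_distributed_variance [OF 2] m by simp
    have "distributed M lborel (\<lambda>\<omega>. Y \<omega> / \<sigma>) std_normal_density"
      using normal_standard_normal_convert [OF 2(1), of Y \<mu>] 2(2) \<mu> by simp
    \<comment> \<open>Evaluating at frequency \<open>\<sigma>\<close> undoes the
      standardization.\<close>
    from distributed_std_normal_iexp [OF this, of \<sigma>] show ?thesis
      using 2(1) v by simp
  qed
qed

text \<open>Reweighting encodes joint information about \<open>h\<close> and \<open>W\<close> in the
  law of the single variable \<open>W\<close>, to which univariate uniqueness applies.\<close>

lemma (in prob_space) real_distribution_weighted:
  assumes [measurable]: "h \<in> borel_measurable M" "W \<in> borel_measurable M"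
    and h: "\<And>\<omega>. h \<omega> \<ge> 0" "integrable M h" "expectation h = 1"
  shows "real_distribution (distr (density M h) borel W)"
    and "char (distr (density M h) borel W) t = (CLINT \<omega>|M. h \<omega> * iexp (t * W \<omega>))"
    and "B \<in> sets borel \<Longrightarrow> measure (distr (density M h) borel W) B = (LINT \<omega>|M. h \<omega> * indicator B (W \<omega>))"
proof -
  have "emeasure (density M h) (space (density M h)) = (\<integral>\<^sup>+\<omega>. h \<omega> \<partial>M)"
    by (simp add: emeasure_density cong: nn_integral_cong)
  also have "\<dots> = 1"
    using nn_integral_eq_integral [OF h(2)] h by simp
  finally interpret D: prob_space "density M h"
    by (rule prob_spaceI)
  have "prob_space (distr (density M h) borel W)"
    by (intro D.prob_space_distr) simp
  then show r: "real_distribution (distr (density M h) borel W)"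
    by (intro real_distribution.intro) (auto simp: real_distribution_axioms_def)
  show "char (distr (density M h) borel W) t = (CLINT \<omega>|M. h \<omega> * iexp (t * W \<omega>))"
    unfolding char_def
    by (subst integral_distr, simp, simp, subst integral_density) (use h in \<open>auto simp: scaleR_conv_of_real\<close>)
  assume [measurable]: "B \<in> sets borel"
  have "measure (distr (density M h) borel W) B = (LINT x|distr (density M h) borel W. indicator B x)"
    by simp
  also have "\<dots> = (LINT \<omega>|density M h. indicator B (W \<omega>))"
    by (subst integral_distr) auto
  also have "\<dots> = (LINT \<omega>|M. h \<omega> * indicator B (W \<omega>))"
    by (subst integral_density) (use h in auto)
  finally show "measure (distr (density M h) borel W) B = (LINT \<omega>|M. h \<omega> * indicator B (W \<omega>))" .
qed

text \<open>Splits a cosine weight into two exponentials, so that the joint characteristic function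
  can be inserted.\<close>

lemma cos_mult_iexp:
  "of_real (cos (x + p)) * iexp w = iexp p / 2 * iexp (x + w) + iexp (- p) / 2 * iexp (- x + w)"
proof -
  have c: "complex_of_real (cos y) = (iexp y + iexp (- y)) / 2" for y
    by (simp add: cos_of_real [symmetric] cos_exp_eq del: cos_of_real)
  have i: "iexp (a + b) = iexp a * iexp b" for a b
    by (simp add: exp_add distrib_left)
  have i': "iexp (- (x + p)) = iexp (- x) * iexp (- p)"
    using i [of "- x" "- p"] by simp
  show ?thesis
    unfolding c [of "x + p"] i i' by (simp add: algebra_simps add_divide_distrib del: of_real_minus)
qed

text \<open>
  Only the one-dimensional Levy uniqueness theorem is available; it is applied to the
  law of \<open>W\<close> under the measures with density \<open>2 + cos (s Y + p)\<close>, and then to the law of \<open>Y\<close>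
  under the measure conditioned on \<open>W \<in> B\<close>.
\<close>

lemma (in prob_space) independent_std_normal:
  assumes [measurable]: "Y \<in> borel_measurable M" "W \<in> borel_measurable M"
    and ch: "\<And>a b. (CLINT \<omega>|M. iexp (a * Y \<omega> + b * W \<omega>)) = of_real (exp (- (a\<^sup>2 + b\<^sup>2) / 2))"
  shows "distr M (borel \<Otimes>\<^sub>M borel) (\<lambda>\<omega>. (Y \<omega>, W \<omega>)) = std_normal_distribution \<Otimes>\<^sub>M std_normal_distribution"
proof -
  let ?N = "std_normal_distribution"
  interpret N: real_distribution ?N by (rule real_dist_normal_dist)
  have int: "integrable M (\<lambda>\<omega>. iexp (f \<omega>))" if [measurable]: "f \<in> borel_measurable M" for f
    by (rule integrable_iexp) auto
  have lawW: "distr M borel W = ?N"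
    using ch [of 0] by (intro Levy_uniqueness real_distribution_distr real_dist_normal_dist)
      (auto simp: char_distr char_std_normal_distribution)
  have iW: "(LINT \<omega>|M. indicator B (W \<omega>)) = measure ?N B" if [measurable]: "B \<in> sets borel" for B
  proof -
    have "measure ?N B = (LINT x|distr M borel W. indicator B x)"
      by (simp add: lawW)
    also have "\<dots> = (LINT \<omega>|M. indicator B (W \<omega>))"
      by (subst integral_distr) auto
    finally show ?thesis by simp
  qed
  have cosint: "(LINT \<omega>|M. cos (s * Y \<omega> + p) * indicator B (W \<omega>)) = cos p * exp (- s\<^sup>2 / 2) * measure ?N B"
    if [measurable]: "B \<in> sets borel" for s p B
  proof -
    \<comment> \<open>\<open>c\<close> is the mean of the weight
      \<open>2 + cos (s * Y \<omega> + p)\<close>; the summand 2 keeps the weight positive.\<close>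
    define c where "c = 2 + cos p * exp (- s\<^sup>2 / 2)"
    have "\<bar>cos p * exp (- s\<^sup>2 / 2)\<bar> \<le> 1"
      unfolding abs_mult by (intro mult_le_one) auto
    then have c: "c > 0" by (simp add: c_def)
    have cch: "(CLINT \<omega>|M. of_real (cos (s * Y \<omega> + p)) * iexp (b * W \<omega>)) = of_real (cos p * exp (- s\<^sup>2 / 2) * exp (- b\<^sup>2 / 2))" for b
    proof -
      have "(CLINT \<omega>|M. of_real (cos (s * Y \<omega> + p)) * iexp (b * W \<omega>))
        = (CLINT \<omega>|M. iexp p / 2 * iexp (s * Y \<omega> + b * W \<omega>) + iexp (- p) / 2 * iexp ((- s) * Y \<omega> + b * W \<omega>))"
        by (intro Bochner_Integration.integral_cong refl) (simp only: cos_mult_iexp mult_minus_left)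
      also have "\<dots> = iexp p / 2 * of_real (exp (- (s\<^sup>2 + b\<^sup>2) / 2)) + iexp (- p) / 2 * of_real (exp (- (s\<^sup>2 + b\<^sup>2) / 2))"
      proof -
        have i: "integrable M (\<lambda>\<omega>. iexp p / 2 * iexp (s * Y \<omega> + b * W \<omega>))"
          "integrable M (\<lambda>\<omega>. iexp (- p) / 2 * iexp ((- s) * Y \<omega> + b * W \<omega>))"
          by (intro integrable_mult_right int; measurable)+
        show ?thesis
          by (simp only: Bochner_Integration.integral_add [OF i] integral_mult_right_zero ch power2_minus)
      qed
      also have "\<dots> = of_real (cos p) * of_real (exp (- (s\<^sup>2 + b\<^sup>2) / 2))"
        using cos_mult_iexp [of 0 p 0] by (simp add: algebra_simps)
      also have "exp (- (s\<^sup>2 + b\<^sup>2) / 2) = exp (- s\<^sup>2 / 2) * exp (- b\<^sup>2 / 2)"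
        by (simp add: exp_add [symmetric] add_divide_distrib)
      finally show ?thesis by simp
    qed
    have ibd: "integrable M (\<lambda>\<omega>. cos (s * Y \<omega> + p))"
      by (rule integrable_const_bound [of _ 1]) auto
    have ecos: "expectation (\<lambda>\<omega>. cos (s * Y \<omega> + p)) = cos p * exp (- s\<^sup>2 / 2)"
    proof -
      have "complex_of_real (expectation (\<lambda>\<omega>. cos (s * Y \<omega> + p))) = of_real (cos p * exp (- s\<^sup>2 / 2))"
        using cch [of 0] by simp
      then show ?thesis by (simp only: of_real_eq_iff)
    qed
    define h where "h \<omega> = (2 + cos (s * Y \<omega> + p)) / c" for \<omega>
    have [measurable]: "h \<in> borel_measurable M" unfolding h_def by measurable
    have "h \<omega> \<ge> 0" for \<omega>
      using c cos_ge_minus_one [of "s * Y \<omega> + p"] unfolding h_def by (intro divide_nonneg_nonneg) linarith+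
    moreover have "integrable M h"
      unfolding h_def using ibd by auto
    moreover have "expectation h = 1"
      unfolding h_def using ibd ecos c by (simp add: c_def prob_space)
    ultimately have h: "\<And>\<omega>. h \<omega> \<ge> 0" "integrable M h" "expectation h = 1" by auto
    let ?D = "distr (density M h) borel W"
    have "char ?D b = char ?N b" for b
    proof -
      have "char ?D b = (CLINT \<omega>|M. h \<omega> * iexp (b * W \<omega>))"
        by (rule real_distribution_weighted(2)) (use h in auto)
      also have "\<dots> = (CLINT \<omega>|M. complex_of_real (2 / c) * iexp (0 * Y \<omega> + b * W \<omega>) + complex_of_real (1 / c) * (of_real (cos (s * Y \<omega> + p)) * iexp (b * W \<omega>)))"
        by (intro Bochner_Integration.integral_cong refl) (simp add: h_def add_divide_distrib algebra_simps)
      also have "\<dots> = complex_of_real (2 / c) * of_real (exp (- (0\<^sup>2 + b\<^sup>2) / 2)) + complex_of_real (1 / c) * of_real (cos p * exp (- s\<^sup>2 / 2) * exp (- b\<^sup>2 / 2))"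
      proof (subst Bochner_Integration.integral_add)
        show "integrable M (\<lambda>\<omega>. complex_of_real (1 / c) * (complex_of_real (cos (s * Y \<omega> + p)) * iexp (b * W \<omega>)))"
          by (intro integrable_mult_right integrable_const_bound [of _ 1])
            (auto simp: norm_mult simp del: of_real_mult)
        show "integrable M (\<lambda>\<omega>. complex_of_real (2 / c) * iexp (0 * Y \<omega> + b * W \<omega>))"
          by (intro integrable_mult_right int) auto
      qed (simp only: integral_mult_right_zero ch cch)
      also have "\<dots> = of_real (exp (- b\<^sup>2 / 2)) * (of_real (2 + cos p * exp (- s\<^sup>2 / 2)) / c)"
        by (simp add: algebra_simps add_divide_distrib)
      also have "\<dots> = char ?N b"
      proof -
        have "complex_of_real (2 + cos p * exp (- s\<^sup>2 / 2)) = complex_of_real c"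
          by (simp only: c_def)
        then show ?thesis
          using c by (simp only: char_std_normal_distribution) simp
      qed
      finally show ?thesis .
    qed
    then have "?D = ?N"
      by (intro Levy_uniqueness real_distribution_weighted(1) real_dist_normal_dist h) auto
    then have D: "(LINT \<omega>|M. h \<omega> * indicator B (W \<omega>)) = measure ?N B" if "B \<in> sets borel" for B
      using real_distribution_weighted(3) [OF _ _ h that, of W] by simp
    have i: "integrable M (\<lambda>\<omega>. indicator B (W \<omega>) :: real)" "integrable M (\<lambda>\<omega>. cos (s * Y \<omega> + p) * indicator B (W \<omega>))"
      by (auto intro!: integrable_const_bound [of _ 1] simp: indicator_def)
    \<comment> \<open>Expanding the weight gives a linear equation, which is solved for the integral
      of the cosine over the event that \<open>W\<close> lies in \<open>B\<close>.\<close>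
    have "(LINT \<omega>|M. h \<omega> * indicator B (W \<omega>))
        = (LINT \<omega>|M. (2 / c) * indicator B (W \<omega>) + (1 / c) * (cos (s * Y \<omega> + p) * indicator B (W \<omega>)))"
      by (intro Bochner_Integration.integral_cong refl) (simp add: h_def add_divide_distrib algebra_simps)
    also have "\<dots> = (2 / c) * measure ?N B + (1 / c) * (LINT \<omega>|M. cos (s * Y \<omega> + p) * indicator B (W \<omega>))"
      using i by (simp add: iW)
    finally have "measure ?N B = (2 / c) * measure ?N B + (1 / c) * (LINT \<omega>|M. cos (s * Y \<omega> + p) * indicator B (W \<omega>))"
      by (simp add: D)
    then have "c * measure ?N B = 2 * measure ?N B + (LINT \<omega>|M. cos (s * Y \<omega> + p) * indicator B (W \<omega>))"
      using c by (simp add: field_simps)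
    then show ?thesis
      by (simp add: c_def algebra_simps)
  qed
  have joint: "(LINT \<omega>|M. indicator A (Y \<omega>) * indicator B (W \<omega>)) = measure ?N A * measure ?N B"
    if [measurable]: "A \<in> sets borel" "B \<in> sets borel" for A B
  proof (cases "measure ?N B = 0")
    \<comment> \<open>Conditioning on a null event is impossible, but here both sides
      vanish.\<close>
    case True
    have "(LINT \<omega>|M. indicator A (Y \<omega>) * indicator B (W \<omega>) :: real) \<le> (LINT \<omega>|M. indicator B (W \<omega>))"
      by (intro integral_mono integrable_const_bound [of _ 1]) (auto simp: indicator_def)
    moreover have "0 \<le> (LINT \<omega>|M. indicator A (Y \<omega>) * indicator B (W \<omega>) :: real)"
      by (intro Bochner_Integration.integral_nonneg) auto
    ultimately show ?thesis using True by (simp add: iW)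
  next
    case False
    define m where "m = measure ?N B"
    have m: "m > 0" using False by (simp add: m_def less_le)
    define h where "h \<omega> = indicator B (W \<omega>) / m" for \<omega>
    have [measurable]: "h \<in> borel_measurable M" unfolding h_def by measurable
    have iB: "integrable M (\<lambda>\<omega>. indicator B (W \<omega>) :: real)"
      by (auto intro!: integrable_const_bound [of _ 1] simp: indicator_def)
    have h: "\<And>\<omega>. h \<omega> \<ge> 0" "integrable M h" "expectation h = 1"
      unfolding h_def using iB m iW [of B] by (auto simp: m_def)
    have "char (distr (density M h) borel Y) s = char ?N s" for s
    proof -
      have ci: "integrable M (\<lambda>\<omega>. cos (s * Y \<omega> + p) * indicator B (W \<omega>))" for p
        by (auto intro!: integrable_const_bound [of _ 1] simp: indicator_def)
      have "char (distr (density M h) borel Y) s = (CLINT \<omega>|M. h \<omega> * iexp (s * Y \<omega>))"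
        by (rule real_distribution_weighted(2)) (use h in auto)
      also have "\<dots> = (CLINT \<omega>|M. complex_of_real (1 / m) * (complex_of_real (cos (s * Y \<omega> + 0) * indicator B (W \<omega>)) +
          \<i> * complex_of_real (cos (s * Y \<omega> + (- pi / 2)) * indicator B (W \<omega>))))"
      proof (intro Bochner_Integration.integral_cong refl)
        fix \<omega>
        \<comment> \<open>The sine is a cosine with phase \<open>- pi / 2\<close>; this is why
          \<open>cosint\<close> carries the phase \<open>p\<close>.\<close>
        have e: "iexp (s * Y \<omega>) = complex_of_real (cos (s * Y \<omega> + 0)) + \<i> * complex_of_real (cos (s * Y \<omega> + (- pi / 2)))"
          by (simp add: complex_eq_iff Re_exp Im_exp cos_diff)
        show "complex_of_real (h \<omega>) * iexp (s * Y \<omega>) = complex_of_real (1 / m) * (complex_of_real (cos (s * Y \<omega> + 0) * indicator B (W \<omega>)) +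
          \<i> * complex_of_real (cos (s * Y \<omega> + (- pi / 2)) * indicator B (W \<omega>)))"
          unfolding e by (simp add: h_def indicator_def)
      qed
      also have "\<dots> = complex_of_real (1 / m) * (complex_of_real (cos 0 * exp (- s\<^sup>2 / 2) * m) +
          \<i> * complex_of_real (cos (- pi / 2) * exp (- s\<^sup>2 / 2) * m))"
        using ci [of 0] ci [of "- pi / 2"]
        by (subst integral_mult_right_zero, subst Bochner_Integration.integral_add)
          (simp_all only: integrable_of_real integrable_mult_right integral_mult_right_zero
            integral_of_real integral_complex_of_real cosint [OF that(2)] m_def)
      also have "\<dots> = char ?N s"
        using m by (simp add: char_std_normal_distribution)
      finally show ?thesis .
    qed
    then have "distr (density M h) borel Y = ?N"
      by (intro Levy_uniqueness real_distribution_weighted(1) real_dist_normal_dist h) auto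
    then have "(LINT \<omega>|M. h \<omega> * indicator A (Y \<omega>)) = measure ?N A"
      using real_distribution_weighted(3) [OF _ _ h that(1), of Y] by simp
    moreover have "(LINT \<omega>|M. h \<omega> * indicator A (Y \<omega>)) = (LINT \<omega>|M. (1 / m) * (indicator A (Y \<omega>) * indicator B (W \<omega>)))"
      by (intro Bochner_Integration.integral_cong refl) (simp add: h_def)
    ultimately show ?thesis
      using m by (simp add: m_def field_simps)
  qed
  have "?N \<Otimes>\<^sub>M ?N = distr M (borel \<Otimes>\<^sub>M borel) (\<lambda>\<omega>. (Y \<omega>, W \<omega>))"
  proof (rule pair_measure_eqI)
    show "sigma_finite_measure ?N" "sigma_finite_measure ?N" by unfold_locales
    show "sets (?N \<Otimes>\<^sub>M ?N) = sets (distr M (borel \<Otimes>\<^sub>M borel) (\<lambda>\<omega>. (Y \<omega>, W \<omega>)))"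
      by (simp cong: sets_pair_measure_cong)
    fix A B :: "real set" assume "A \<in> sets ?N" "B \<in> sets ?N"
    then have [measurable]: "A \<in> sets borel" "B \<in> sets borel" by auto
    let ?E = "{\<omega> \<in> space M. Y \<omega> \<in> A \<and> W \<omega> \<in> B}"
    have "emeasure (distr M (borel \<Otimes>\<^sub>M borel) (\<lambda>\<omega>. (Y \<omega>, W \<omega>))) (A \<times> B) = emeasure M ?E"
      by (subst emeasure_distr) (auto intro!: arg_cong [where f = "emeasure M"])
    also have "\<dots> = ennreal (measure M ?E)"
      by (rule emeasure_eq_measure)
    also have "measure M ?E = (LINT \<omega>|M. indicator ?E \<omega>)"
      by (auto simp: Int_def intro!: arg_cong [where f = prob])
    also have "\<dots> = (LINT \<omega>|M. indicator A (Y \<omega>) * indicator B (W \<omega>))"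
      by (intro Bochner_Integration.integral_cong refl) (auto simp: indicator_def)
    also have "\<dots> = measure ?N A * measure ?N B" by (rule joint) auto
    finally show "emeasure ?N A * emeasure ?N B = emeasure (distr M (borel \<Otimes>\<^sub>M borel) (\<lambda>\<omega>. (Y \<omega>, W \<omega>))) (A \<times> B)"
      by (simp add: N.emeasure_eq_measure ennreal_mult)
  qed
  then show ?thesis by simp
qed

section \<open>Normal measure of intervals and plane sectors\<close>

text \<open>The density never exceeds \<open>1 / sqrt (2 * pi)\<close>, which is below 1.\<close>

lemma std_normal_small_ball:
  assumes "a \<le> b"
  shows "measure std_normal_distribution {a..b} \<le> b - a"
proof -
  interpret N: real_distribution std_normal_distribution by (rule real_dist_normal_dist)
  have "std_normal_density x \<le> 1" for x
  proof -
    have "1 \<le> sqrt (2 * pi)" using pi_gt3 by simp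
    then have "1 / sqrt (2 * pi) \<le> 1" by simp
    then have "1 / sqrt (2 * pi) * exp (- x\<^sup>2 / 2) \<le> 1 * 1"
      by (intro mult_mono) auto
    then show ?thesis by (simp add: std_normal_density_def)
  qed
  then have le: "ennreal (std_normal_density x) * indicator {a..b} x \<le> indicator {a..b} x" for x
    by (auto simp: indicator_def ennreal_le_1)
  have "emeasure std_normal_distribution {a..b} = (\<integral>\<^sup>+x. ennreal (std_normal_density x) * indicator {a..b} x \<partial>lborel)"
    by (subst emeasure_density) auto
  also have "\<dots> \<le> (\<integral>\<^sup>+x. indicator {a..b} x \<partial>lborel)"
    using le by (intro nn_integral_mono)
  also have "\<dots> = ennreal (b - a)" using assms by simp
  finally show ?thesis
    using assms by (simp add: N.emeasure_eq_measure)
qed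

text \<open>The density decreases on the interval, so its values at the two ends give an upper and a
  lower rectangle.\<close>

lemma measure_std_normal_bounds:
  assumes "x \<ge> 0"
  shows "measure std_normal_distribution {0<..x} \<le> std_normal_density 0 * x"
    and "std_normal_density x * x \<le> measure std_normal_distribution {0<..x}"
proof -
  interpret N: real_distribution std_normal_distribution by (rule real_dist_normal_dist)
  have e: "ennreal (measure std_normal_distribution {0<..x})
      = (\<integral>\<^sup>+y. ennreal (std_normal_density y) * indicator {0<..x} y \<partial>lborel)"
    by (subst N.emeasure_eq_measure [symmetric], subst emeasure_density) auto
  have const: "(\<integral>\<^sup>+y. ennreal c * indicator {0<..x} y \<partial>lborel) = ennreal (c * x)" if "c \<ge> 0" for c
    using assms that by (subst nn_integral_cmult_indicator) (auto simp: ennreal_mult)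
  have "ennreal (measure std_normal_distribution {0<..x}) \<le> ennreal (std_normal_density 0 * x)"
    unfolding e const [OF normal_density_nonneg, symmetric]
    by (intro nn_integral_mono mult_right_mono) (auto simp: std_normal_density_def intro!: divide_right_mono)
  then show "measure std_normal_distribution {0<..x} \<le> std_normal_density 0 * x"
    using assms by (simp add: ennreal_le_iff)
  have "ennreal (std_normal_density x * x) \<le> ennreal (measure std_normal_distribution {0<..x})"
    unfolding e const [OF normal_density_nonneg, symmetric]
    by (intro nn_integral_mono) (auto simp: std_normal_density_def indicator_def intro!: ennreal_leI divide_right_mono power_mono)
  then show "std_normal_density x * x \<le> measure std_normal_distribution {0<..x}"
    by (simp add: ennreal_le_iff)
qed

text \<open>For positive \<open>\<tau>\<close> this is the standard Gaussian measure of a plane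
  sector of angle arctan \<open>\<tau>\<close>, that is arctan \<open>\<tau>\<close> / (2 pi). A
  sign change of a correlated pair becomes such a sector after orthogonalization.\<close>

definition cross_prob :: "real \<Rightarrow> real" where
  "cross_prob \<tau> = measure (std_normal_distribution \<Otimes>\<^sub>M std_normal_distribution) {(y, w). 0 < y \<and> y \<le> \<tau> * w}"

text \<open>Integrating out the first coordinate leaves the mean of \<open>g (\<tau> * w)\<close>.
  The rectangle bounds for \<open>g\<close> squeeze the quotient between \<open>c\<close> and
  \<open>c - K * \<tau>\<^sup>2\<close>, where \<open>K\<close> comes from the third absolute
  moment.\<close>

lemma cross_prob_asymp:
  "\<exists>c>0. ((\<lambda>\<tau>. cross_prob \<tau> / \<tau>) \<longlongrightarrow> c) (at_right 0)"
proof -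
  let ?N = "std_normal_distribution"
  interpret N: real_distribution ?N by (rule real_dist_normal_dist)
  interpret NN: pair_prob_space ?N ?N ..
  define g where "g x = measure ?N {0<..x}" for x
  have mono: "mono g"
    by (auto simp: mono_def g_def intro!: N.finite_measure_mono)
  have g01: "0 \<le> g x" "g x \<le> 1" for x
    by (auto simp: g_def)
  have [measurable]: "g \<in> borel_measurable borel" by (rule borel_measurable_mono [OF mono])
  have g: "cross_prob \<tau> = (LINT w|?N. g (\<tau> * w))" if "\<tau> > 0" for \<tau>
  proof -
    let ?A = "{(y, w). 0 < y \<and> y \<le> \<tau> * w}"
    have A: "?A \<in> sets (?N \<Otimes>\<^sub>M ?N)"
    proof -
      have "{z \<in> space (borel \<Otimes>\<^sub>M borel). 0 < fst z \<and> fst z \<le> \<tau> * snd z} \<in> sets (borel \<Otimes>\<^sub>M borel)"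
        by measurable
      also have "{z \<in> space (borel \<Otimes>\<^sub>M borel). 0 < fst z \<and> fst z \<le> \<tau> * snd z} = ?A"
        by (auto simp: space_pair_measure)
      finally show ?thesis by (simp cong: sets_pair_measure_cong)
    qed
    have "emeasure (?N \<Otimes>\<^sub>M ?N) ?A = (\<integral>\<^sup>+w. emeasure ?N ((\<lambda>y. (y, w)) -` ?A) \<partial>?N)"
      by (rule NN.emeasure_pair_measure_alt2 [OF A])
    also have "\<dots> = (\<integral>\<^sup>+w. ennreal (g (\<tau> * w)) \<partial>?N)"
      by (intro nn_integral_cong) (auto simp: g_def N.emeasure_eq_measure intro!: arg_cong [where f = "measure ?N"])
    also have "\<dots> = ennreal (LINT w|?N. g (\<tau> * w))"
      by (intro nn_integral_eq_integral N.integrable_const_bound [of _ 1]) (auto simp: g01)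
    finally show ?thesis
      unfolding cross_prob_def measure_def by (simp add: g01)
  qed
  define c where "c = std_normal_density 0 * (LINT w|?N. max 0 w)"
  define K where "K = std_normal_density 0 / 2 * (LINT w|?N. \<bar>w ^ 3\<bar>)"
  have i1: "integrable ?N (\<lambda>w. w)" and i3: "integrable ?N (\<lambda>w. \<bar>w ^ 3\<bar>)"
    using integrable_std_normal_distribution_moment [of 1] integrable_std_normal_distribution_moment [of 3] by auto
  then have im: "integrable ?N (\<lambda>w. max 0 w)" by auto
  \<comment> \<open>The positive part is written through the absolute value, whose moments are
    explicit.\<close>
  have "(LINT w|?N. max 0 w) = (LINT w|?N. (\<bar>w\<bar> + w) / 2)"
    by (intro Bochner_Integration.integral_cong) (auto simp: max_def)
  also have "\<dots> = sqrt (2 / pi) / 2"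
    using i1 std_normal_distribution_odd_moments_abs [of 0] integral_std_normal_distribution_moment_odd [of 1] by simp
  finally have L: "(LINT w|?N. max 0 w) = sqrt (2 / pi) / 2" .
  have "(LINT w|?N. max 0 w) > 0"
    unfolding L by simp
  then have cpos: "c > 0"
    unfolding c_def by (intro mult_pos_pos normal_density_pos) auto
  have ig: "integrable ?N (\<lambda>w. g (\<tau> * w))" for \<tau>
    by (intro N.integrable_const_bound [of _ 1]) (auto simp: g01)
  have up: "cross_prob \<tau> / \<tau> \<le> c" if "\<tau> > 0" for \<tau>
  proof -
    have "g (\<tau> * w) \<le> std_normal_density 0 * \<tau> * max 0 w" for w
    proof (cases "w \<ge> 0")
      case True
      then show ?thesis using measure_std_normal_bounds(1) [of "\<tau> * w"] that by (simp add: g_def mult.assoc)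
    next
      case False
      then have "{0<..\<tau> * w} = {}" using that by (simp add: mult_le_0_iff)
      then show ?thesis by (simp add: g_def that less_imp_le)
    qed
    then have "(LINT w|?N. g (\<tau> * w)) \<le> (LINT w|?N. std_normal_density 0 * \<tau> * max 0 w)"
      using ig im by (intro Bochner_Integration.integral_mono) auto
    then show ?thesis
      using that by (simp add: g c_def field_simps)
  qed
  have low: "c - K * \<tau>\<^sup>2 \<le> cross_prob \<tau> / \<tau>" if "\<tau> > 0" for \<tau>
  proof -
    \<comment> \<open>For positive \<open>w\<close> this is
      \<open>exp (- x\<^sup>2 / 2) \<ge> 1 - x\<^sup>2 / 2\<close> at \<open>x = \<tau> * w\<close>;
      for negative \<open>w\<close> the absolute value makes the left side nonpositive.\<close>
    have "std_normal_density 0 * \<tau> * (max 0 w - \<tau>\<^sup>2 / 2 * \<bar>w ^ 3\<bar>) \<le> g (\<tau> * w)" for w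
    proof (cases "w \<ge> 0")
      case True
      have "1 - (\<tau> * w)\<^sup>2 / 2 \<le> exp (- (\<tau> * w)\<^sup>2 / 2)"
        using exp_ge_add_one_self [of "- (\<tau> * w)\<^sup>2 / 2"] by simp
      then have "std_normal_density 0 * (1 - (\<tau> * w)\<^sup>2 / 2) \<le> std_normal_density (\<tau> * w)"
        by (simp add: std_normal_density_def divide_right_mono)
      then have "std_normal_density 0 * (1 - (\<tau> * w)\<^sup>2 / 2) * (\<tau> * w) \<le> std_normal_density (\<tau> * w) * (\<tau> * w)"
        using True that by (intro mult_right_mono) auto
      also have "\<dots> \<le> g (\<tau> * w)"
        using measure_std_normal_bounds(2) [of "\<tau> * w"] True that by (simp add: g_def)
      finally show ?thesis
        using True by (simp add: algebra_simps power2_eq_square power3_eq_cube)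
    next
      case False
      have "std_normal_density 0 * \<tau> * (max 0 w - \<tau>\<^sup>2 / 2 * \<bar>w ^ 3\<bar>) \<le> 0"
      proof (rule mult_nonneg_nonpos)
        have "0 \<le> \<tau>\<^sup>2 / 2 * \<bar>w ^ 3\<bar>" by simp
        then show "max 0 w - \<tau>\<^sup>2 / 2 * \<bar>w ^ 3\<bar> \<le> 0" using False by linarith
      qed (use that in auto)
      also have "0 \<le> g (\<tau> * w)" by (simp add: g_def)
      finally show ?thesis .
    qed
    then have "(LINT w|?N. std_normal_density 0 * \<tau> * (max 0 w - \<tau>\<^sup>2 / 2 * \<bar>w ^ 3\<bar>)) \<le> (LINT w|?N. g (\<tau> * w))"
      using ig im i3 by (intro Bochner_Integration.integral_mono) auto
    then have "\<tau> * (c - K * \<tau>\<^sup>2) \<le> cross_prob \<tau>"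
      using im i3 that by (simp add: g c_def K_def algebra_simps)
    then show ?thesis
      using that by (simp add: field_simps)
  qed
  have "((\<lambda>\<tau>. cross_prob \<tau> / \<tau>) \<longlongrightarrow> c) (at_right 0)"
  proof (rule tendsto_sandwich)
    show "\<forall>\<^sub>F \<tau> in at_right 0. c - K * \<tau>\<^sup>2 \<le> cross_prob \<tau> / \<tau>"
      using low by (auto simp: eventually_at_filter intro!: always_eventually)
    show "\<forall>\<^sub>F \<tau> in at_right 0. cross_prob \<tau> / \<tau> \<le> c"
      using up by (auto simp: eventually_at_filter intro!: always_eventually)
    have "((\<lambda>\<tau>. c - K * \<tau>\<^sup>2) \<longlongrightarrow> c - K * 0\<^sup>2) (at_right 0)"
      by (intro tendsto_intros)
    then show "((\<lambda>\<tau>. c - K * \<tau>\<^sup>2) \<longlongrightarrow> c) (at_right 0)" by simp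
  qed auto
  with cpos show ?thesis by blast
qed

section \<open>The covariance of the field\<close>

lemma field_law_integral:
  fixes h :: "('t \<Rightarrow> real) \<Rightarrow> real"
  assumes [measurable]: "\<And>t. Y t \<in> borel_measurable M" "\<And>t. Z t \<in> borel_measurable M"
    and law: "field_law M Y = field_law M Z"
    and [measurable]: "h \<in> borel_measurable (\<Pi>\<^sub>M t\<in>UNIV. borel)"
  shows "(LINT \<omega>|M. h (\<lambda>t. Y t \<omega>)) = (LINT \<omega>|M. h (\<lambda>t. Z t \<omega>))"
proof -
  have *: "(LINT x|field_law M V. h x) = (LINT \<omega>|M. h (\<lambda>t. V t \<omega>))"
    if V: "\<And>t. V t \<in> borel_measurable M" for V
  proof -
    have "(\<lambda>\<omega> t. V t \<omega>) \<in> measurable M (\<Pi>\<^sub>M t\<in>UNIV. borel)"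
      using V by (intro measurable_PiM_single') auto
    then show ?thesis
      unfolding field_law_def by (intro integral_distr assms(4))
  qed
  show ?thesis
    using * [of Y] * [of Z] law by simp
qed

section \<open>Second moments and joint laws of the field\<close>

locale smooth_gaussian_field = prob_space M for M :: "'w measure" +
  fixes X :: "real ^ 2 \<Rightarrow> 'w \<Rightarrow> real"
  assumes H: "assumption_H M X"
begin

lemma gaussian_sum: "finite I \<Longrightarrow> gaussian_rv M (\<lambda>\<omega>. \<Sum>t\<in>I. a t * X t \<omega>)"
  using H by (simp add: assumption_H_def gaussian_field_def)

lemma X_measurable [measurable]: "X t \<in> borel_measurable M"
  using gaussian_sum [of "{t}" "\<lambda>_. 1"] by (simp add: gaussian_rv_def)

lemma X_mean: "expectation (X t) = 0"
  using H by (simp add: assumption_H_def)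

lemma stationary_integral:
  assumes "h \<in> borel_measurable (\<Pi>\<^sub>M t\<in>UNIV. borel)"
  shows "(LINT \<omega>|M. h (\<lambda>t. X (t + a) \<omega>)) = (LINT \<omega>|M. h (\<lambda>t. X t \<omega>) :: real)"
  using H assms by (intro field_law_integral) (auto simp: assumption_H_def stationary_field_def)

lemma isotropic_integral:
  assumes "rotation_matrix R" "h \<in> borel_measurable (\<Pi>\<^sub>M t\<in>UNIV. borel)"
  shows "(LINT \<omega>|M. h (\<lambda>t. X (R *v t) \<omega>)) = (LINT \<omega>|M. h (\<lambda>t. X t \<omega>) :: real)"
  using H assms by (intro field_law_integral) (auto simp: assumption_H_def isotropic_field_def)

text \<open>\<open>gaussian_sum\<close> sums over a set of indices, so coinciding indices must be
  merged into one coefficient.\<close>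

lemma gaussian_pair: "gaussian_rv M (\<lambda>\<omega>. a * X s \<omega> + b * X t \<omega>)"
proof (cases "s = t")
  case True
  with gaussian_sum [of "{t}" "\<lambda>_. a + b"] show ?thesis by (simp add: distrib_right)
next
  case False
  with gaussian_sum [of "{s, t}" "\<lambda>r. if r = s then a else b"] show ?thesis by simp
qed

lemma X_integrable: "integrable M (X t)"
  using gaussian_rv_square_integrable(1) [OF gaussian_pair [of 1 t 0 t]] by simp

lemma X_square_integrable: "integrable M (\<lambda>\<omega>. (X t \<omega>)\<^sup>2)"
  using gaussian_rv_square_integrable(2) [OF gaussian_pair [of 1 t 0 t]] by simp

lemma X_prod_integrable: "integrable M (\<lambda>\<omega>. X s \<omega> * X t \<omega>)"
proof (rule Bochner_Integration.integrable_bound)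
  show "integrable M (\<lambda>\<omega>. (X s \<omega>)\<^sup>2 + (X t \<omega>)\<^sup>2)"
    by (intro Bochner_Integration.integrable_add X_square_integrable)
  have "\<bar>x * y\<bar> \<le> x\<^sup>2 + y\<^sup>2" for x y :: real
  proof -
    have "2 * (\<bar>x\<bar> * \<bar>y\<bar>) \<le> x\<^sup>2 + y\<^sup>2" "0 \<le> \<bar>x\<bar> * \<bar>y\<bar>"
      using sum_squares_bound [of "\<bar>x\<bar>" "\<bar>y\<bar>"] by auto
    then show ?thesis unfolding abs_mult by linarith
  qed
  then show "AE \<omega> in M. norm (X s \<omega> * X t \<omega>) \<le> norm ((X s \<omega>)\<^sup>2 + (X t \<omega>)\<^sup>2)"
    by simp
qed measurable

definition covf :: "real ^ 2 \<Rightarrow> real" where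
  "covf t = expectation (\<lambda>\<omega>. X 0 \<omega> * X t \<omega>)"

lemma cov_eq: "cov M (X 0) (X t) = covf t"
  by (simp add: cov_def covf_def X_mean)

lemma covf_0: "covf 0 = 1"
  using H by (simp add: assumption_H_def cov_eq)

lemma expectation_prod: "expectation (\<lambda>\<omega>. X s \<omega> * X t \<omega>) = covf (t - s)"
  using stationary_integral [of "\<lambda>x. x 0 * x (t - s)" s] by (simp add: covf_def)

lemma expectation_square: "expectation (\<lambda>\<omega>. (X s \<omega>)\<^sup>2) = 1"
  using expectation_prod [of s s] by (simp add: covf_0 power2_eq_square)

lemma expectation_pair_square:
  "expectation (\<lambda>\<omega>. (a * X s \<omega> + b * X t \<omega>)\<^sup>2) = a\<^sup>2 + b\<^sup>2 + 2 * a * b * covf (t - s)"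
proof -
  have "expectation (\<lambda>\<omega>. (a * X s \<omega> + b * X t \<omega>)\<^sup>2)
     = expectation (\<lambda>\<omega>. a\<^sup>2 * (X s \<omega>)\<^sup>2 + b\<^sup>2 * (X t \<omega>)\<^sup>2 + 2 * a * b * (X s \<omega> * X t \<omega>))"
    by (intro Bochner_Integration.integral_cong) (auto simp: power2_eq_square algebra_simps)
  also have "\<dots> = a\<^sup>2 + b\<^sup>2 + 2 * a * b * covf (t - s)"
    by (simp add: X_square_integrable X_prod_integrable expectation_square expectation_prod)
  finally show ?thesis .
qed

text \<open>The second moments of \<open>X 0 + X h\<close> and \<open>X 0 - X h\<close> are
  nonnegative.\<close>

lemma covf_le_1: "\<bar>covf h\<bar> \<le> 1"
proof -
  have "0 \<le> 2 + 2 * b * covf h" if "b\<^sup>2 = 1" for b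
  proof -
    have "0 \<le> expectation (\<lambda>\<omega>. (1 * X 0 \<omega> + b * X h \<omega>)\<^sup>2)"
      by (intro Bochner_Integration.integral_nonneg) auto
    also have "\<dots> = 2 + 2 * b * covf h"
      unfolding expectation_pair_square using that by simp
    finally show ?thesis .
  qed
  from this [of 1] this [of "- 1"] show ?thesis by simp
qed

lemma pair_char:
  "(CLINT \<omega>|M. iexp (a * X s \<omega> + b * X t \<omega>)) = of_real (exp (- (a\<^sup>2 + b\<^sup>2 + 2 * a * b * covf (t - s)) / 2))"
proof -
  have "expectation (\<lambda>\<omega>. a * X s \<omega> + b * X t \<omega>) = 0"
    by (simp add: X_integrable X_mean)
  from gaussian_rv_char [OF gaussian_pair this] show ?thesis
    by (simp only: expectation_pair_square)
qed

text \<open>Gram-Schmidt: the normalized residual of \<open>X t\<close> after projection on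
  \<open>X s\<close> is uncorrelated with \<open>X s\<close>, and the joint characteristic function
  factors. The sign \<open>\<sigma>\<close> allows \<open>X s\<close> to be reflected when crossings
  are described by a sector.\<close>

lemma pair_law:
  assumes "\<bar>covf (t - s)\<bar> < 1" "\<sigma>\<^sup>2 = 1"
  defines "r \<equiv> covf (t - s)"
  defines "q \<equiv> sqrt (1 - r\<^sup>2)"
  shows "distr M (borel \<Otimes>\<^sub>M borel) (\<lambda>\<omega>. (\<sigma> * X s \<omega>, (X t \<omega> - r * X s \<omega>) / q)) =
     std_normal_distribution \<Otimes>\<^sub>M std_normal_distribution"
proof (rule independent_std_normal)
  have q: "q > 0" "q\<^sup>2 = 1 - r\<^sup>2"
    using assms(1) by (auto simp: q_def r_def abs_square_less_1 abs_square_le_1 less_imp_le)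
  fix a b
  have "(CLINT \<omega>|M. iexp (a * (\<sigma> * X s \<omega>) + b * ((X t \<omega> - r * X s \<omega>) / q)))
      = (CLINT \<omega>|M. iexp ((a * \<sigma> - b * r / q) * X s \<omega> + (b / q) * X t \<omega>))"
    using q(1) by (intro Bochner_Integration.integral_cong refl arg_cong [where f = iexp]) (simp add: field_simps)
  also have "\<dots> = of_real (exp (- ((a * \<sigma> - b * r / q)\<^sup>2 + (b / q)\<^sup>2 + 2 * (a * \<sigma> - b * r / q) * (b / q) * r) / 2))"
    unfolding pair_char r_def ..
  also have "(a * \<sigma> - b * r / q)\<^sup>2 + (b / q)\<^sup>2 + 2 * (a * \<sigma> - b * r / q) * (b / q) * r
     = a\<^sup>2 * \<sigma>\<^sup>2 + b\<^sup>2 * (1 - r\<^sup>2) / q\<^sup>2"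
    using q(1) by (simp add: power2_eq_square field_simps)
  also have "\<dots> = a\<^sup>2 + b\<^sup>2"
    using q assms(2) by (metis mult.right_neutral nonzero_mult_div_cancel_right power_not_zero less_irrefl)
  finally show "(CLINT \<omega>|M. iexp (a * (\<sigma> * X s \<omega>) + b * ((X t \<omega> - r * X s \<omega>) / q))) = of_real (exp (- (a\<^sup>2 + b\<^sup>2) / 2))" .
qed measurable

lemma X_law: "distr M borel (X t) = std_normal_distribution"
  using pair_char [of 1 t 0] pair_char [of _ t 0]
  by (intro Levy_uniqueness real_distribution_distr real_dist_normal_dist)
    (auto simp: char_distr char_std_normal_distribution)

lemma X_small_ball:
  assumes "\<delta> \<ge> 0" shows "prob {\<omega> \<in> space M. \<bar>X t \<omega> - u\<bar> \<le> \<delta>} \<le> 2 * \<delta>"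
proof -
  have "prob {\<omega> \<in> space M. \<bar>X t \<omega> - u\<bar> \<le> \<delta>} = measure (distr M borel (X t)) {u - \<delta>..u + \<delta>}"
    by (subst measure_distr) (auto intro!: arg_cong [where f = prob] simp: abs_le_iff)
  also have "\<dots> \<le> (u + \<delta>) - (u - \<delta>)"
    unfolding X_law using assms by (intro std_normal_small_ball) auto
  finally show ?thesis by simp
qed

text \<open>In the orthogonalized coordinates the event lies in a rectangle with sides
  \<open>2 * \<delta>\<close> and \<open>4 * \<delta> / q\<close>.\<close>

lemma X_pair_small_ball:
  assumes "\<bar>covf (t - s)\<bar> < 1" "\<delta> \<ge> 0"
  shows "prob {\<omega> \<in> space M. \<bar>X s \<omega> - u\<bar> \<le> \<delta> \<and> \<bar>X t \<omega> - u\<bar> \<le> \<delta>} \<le> 8 * \<delta>\<^sup>2 / sqrt (1 - (covf (t - s))\<^sup>2)"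
proof -
  let ?N = std_normal_distribution
  interpret N: real_distribution ?N by (rule real_dist_normal_dist)
  interpret NN: pair_prob_space ?N ?N ..
  define r where "r = covf (t - s)"
  define q where "q = sqrt (1 - r\<^sup>2)"
  have q: "q > 0"
    using assms(1) by (auto simp: q_def r_def abs_square_less_1)
  \<comment> \<open>The value of the residual when both variables equal \<open>u\<close>.\<close>
  define m where "m = (u - r * u) / q"
  let ?D = "distr M (borel \<Otimes>\<^sub>M borel) (\<lambda>\<omega>. (1 * X s \<omega>, (X t \<omega> - r * X s \<omega>) / q))"
  have D: "?D = ?N \<Otimes>\<^sub>M ?N"
    using pair_law [of t s 1] assms(1) by (simp add: r_def q_def)
  have sub: "\<bar>(y - r * x) / q - m\<bar> \<le> 2 * \<delta> / q" if "\<bar>x - u\<bar> \<le> \<delta>" "\<bar>y - u\<bar> \<le> \<delta>" for x y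
  proof -
    have "\<bar>r * (x - u)\<bar> \<le> 1 * \<delta>"
      unfolding abs_mult using that assms by (intro mult_mono) (auto simp: r_def)
    then have "\<bar>(y - u) - r * (x - u)\<bar> \<le> 2 * \<delta>" using that(2) by linarith
    moreover have "(y - r * x) / q - m = ((y - u) - r * (x - u)) / q"
      by (simp only: m_def diff_divide_distrib [symmetric]) (simp add: algebra_simps)
    ultimately show ?thesis using q by (simp add: divide_right_mono)
  qed
  have "prob {\<omega> \<in> space M. \<bar>X s \<omega> - u\<bar> \<le> \<delta> \<and> \<bar>X t \<omega> - u\<bar> \<le> \<delta>}
      \<le> prob ((\<lambda>\<omega>. (1 * X s \<omega>, (X t \<omega> - r * X s \<omega>) / q)) -` ({u - \<delta>..u + \<delta>} \<times> {m - 2 * \<delta> / q..m + 2 * \<delta> / q}) \<inter> space M)"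
  proof (intro finite_measure_mono subsetI)
    fix \<omega> assume "\<omega> \<in> {\<omega> \<in> space M. \<bar>X s \<omega> - u\<bar> \<le> \<delta> \<and> \<bar>X t \<omega> - u\<bar> \<le> \<delta>}"
    then have "\<omega> \<in> space M" "\<bar>X s \<omega> - u\<bar> \<le> \<delta>" "\<bar>(X t \<omega> - r * X s \<omega>) / q - m\<bar> \<le> 2 * \<delta> / q"
      using sub by auto
    then show "\<omega> \<in> (\<lambda>\<omega>. (1 * X s \<omega>, (X t \<omega> - r * X s \<omega>) / q)) -` ({u - \<delta>..u + \<delta>} \<times> {m - 2 * \<delta> / q..m + 2 * \<delta> / q}) \<inter> space M"
      unfolding abs_le_iff vimage_def by (intro IntI CollectI) (auto simp: diff_le_eq le_diff_eq)
  qed measurable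
  also have "\<dots> = measure ?D ({u - \<delta>..u + \<delta>} \<times> {m - 2 * \<delta> / q..m + 2 * \<delta> / q})"
    by (subst measure_distr) auto
  also have "\<dots> = measure ?N {u - \<delta>..u + \<delta>} * measure ?N {m - 2 * \<delta> / q..m + 2 * \<delta> / q}"
    unfolding D by (simp add: measure_def N.emeasure_pair_measure_Times enn2real_mult)
  also have "\<dots> \<le> ((u + \<delta>) - (u - \<delta>)) * ((m + 2 * \<delta> / q) - (m - 2 * \<delta> / q))"
    using assms(2) q by (intro mult_mono std_normal_small_ball) auto
  also have "\<dots> = 8 * \<delta>\<^sup>2 / q"
    by (simp add: power2_eq_square)
  finally show ?thesis by (simp add: q_def r_def)
qed

section \<open>Crossing probabilities\<close>

text \<open>With y = - \<open>X s\<close> and residual w one has \<open>X t\<close> = q w - r y; as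
  r > 0, the crossing event reads 0 < y and y at most (q / r) w.\<close>

lemma prob_crossing:
  assumes "0 < covf (t - s)" "covf (t - s) < 1"
  shows "prob {\<omega> \<in> space M. X s \<omega> < 0 \<and> 0 \<le> X t \<omega>} = cross_prob (sqrt (1 - (covf (t - s))\<^sup>2) / covf (t - s))"
proof -
  let ?N = std_normal_distribution
  define r where "r = covf (t - s)"
  define q where "q = sqrt (1 - r\<^sup>2)"
  have r: "0 < r" "r < 1" using assms by (auto simp: r_def)
  then have q: "q > 0"
    by (auto simp: q_def abs_square_less_1)
  let ?f = "\<lambda>\<omega>. ((- 1) * X s \<omega>, (X t \<omega> - r * X s \<omega>) / q)"
  let ?D = "distr M (borel \<Otimes>\<^sub>M borel) ?f"
  let ?A = "{(y, w). 0 < y \<and> y \<le> (q / r) * w}"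
  have D: "?D = ?N \<Otimes>\<^sub>M ?N"
    using pair_law [of t s "- 1"] r by (simp add: r_def q_def)
  have "{z \<in> space (borel \<Otimes>\<^sub>M borel). 0 < fst z \<and> fst z \<le> (q / r) * snd z} \<in> sets (borel \<Otimes>\<^sub>M borel)"
    by measurable
  also have "{z \<in> space (borel \<Otimes>\<^sub>M borel). 0 < fst z \<and> fst z \<le> (q / r) * snd z} = ?A"
    by (auto simp: space_pair_measure)
  finally have A: "?A \<in> sets (borel \<Otimes>\<^sub>M borel)" .
  have "cross_prob (q / r) = measure ?D ?A"
    by (simp only: cross_prob_def D)
  also have "\<dots> = prob (?f -` ?A \<inter> space M)"
    by (intro measure_distr A) measurable
  also have "?f -` ?A \<inter> space M = {\<omega> \<in> space M. X s \<omega> < 0 \<and> 0 \<le> X t \<omega>}"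
    using r q by (auto simp: field_simps zero_le_mult_iff)
  finally show ?thesis by (simp add: q_def r_def)
qed

text \<open>The Hessian is given at 0 only, so the expansion is of Peano type: the mean value
  inequality is applied to \<open>covf y + (y \<bullet> y) / 2\<close>, whose gradient
  \<open>G y + y\<close> is small relative to \<open>norm y\<close>.\<close>

lemma covf_taylor:
  assumes "\<epsilon> > 0"
  shows "\<exists>d>0. \<forall>h. norm h < d \<longrightarrow> \<bar>covf h - 1 + (norm h)\<^sup>2 / 2\<bar> \<le> \<epsilon> * (norm h)\<^sup>2"
proof -
  have "has_hessian covf (- mat 1) 0"
    using H by (simp add: assumption_H_def cov_eq [abs_def])
  then obtain G where G: "\<forall>\<^sub>F y in nhds 0. GDERIV covf y :> G y"
    and G': "(G has_derivative (\<lambda>h. (- mat 1) *v h)) (at 0)"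
    by (auto simp: has_hessian_def)
  obtain d1 where d1: "d1 > 0" "\<And>y. norm y < d1 \<Longrightarrow> (covf has_derivative (\<lambda>h. h \<bullet> G y)) (at y)"
    using G unfolding eventually_nhds_metric gderiv_def by (auto simp: dist_norm)
  \<comment> \<open>The covariance attains its maximum at 0, so its gradient vanishes there.\<close>
  have "(\<lambda>h. h \<bullet> G 0) = (\<lambda>h. 0)"
  proof (rule differential_zero_maxmin [of 0 UNIV covf])
    show "(\<forall>y\<in>UNIV. covf y \<le> covf 0) \<or> (\<forall>y\<in>UNIV. covf 0 \<le> covf y)"
      using covf_le_1 by (auto simp: covf_0 abs_le_iff)
  qed (use d1 in auto)
  then have G0: "G 0 = 0"
    by (metis inner_eq_zero_iff)
  have minus: "(- mat 1) *v h = - h" for h :: "real ^ 2"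
  proof -
    have "(- A) *v h = - (A *v h)" for A :: "real ^ 2 ^ 2"
      by (simp add: vec_eq_iff matrix_vector_mult_def sum_negf)
    then show ?thesis by simp
  qed
  obtain d2 where d2: "d2 > 0" "\<And>y. norm y < d2 \<Longrightarrow> norm (G y + y) \<le> \<epsilon> * norm y"
    using G' assms unfolding has_derivative_at_alt
    by (auto simp: G0 minus)
  show ?thesis
  proof (intro exI [of _ "min d1 d2"] conjI allI impI)
    fix h :: "real ^ 2" assume h: "norm h < min d1 d2"
    let ?F = "\<lambda>y. covf y + (y \<bullet> y) / 2"
    have "norm (?F h - ?F 0) \<le> \<epsilon> * norm h * norm (h - 0)"
    proof (rule differentiable_bound [where f' = "\<lambda>y v. v \<bullet> (G y + y)"])
      show "convex (closed_segment 0 h)" by simp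
      fix y assume "y \<in> closed_segment 0 h"
      then have y: "norm y \<le> norm h"
        using segment_bound(1) [of y 0 h] by simp
      show "(?F has_derivative (\<lambda>v. v \<bullet> (G y + y))) (at y within closed_segment 0 h)"
        using y h by (auto intro!: derivative_eq_intros has_derivative_at_withinI [OF d1(2)]
            simp: inner_add_right inner_commute)
      have "norm (G y + y) \<le> \<epsilon> * norm y"
        using y h by (intro d2) auto
      also have "\<dots> \<le> \<epsilon> * norm h"
        using y assms by simp
      finally have "norm (G y + y) \<le> \<epsilon> * norm h" .
      then show "onorm (\<lambda>v. v \<bullet> (G y + y)) \<le> \<epsilon> * norm h"
        by (intro onorm_le) (metis Cauchy_Schwarz_ineq2 mult.commute mult_right_mono norm_ge_zero order_trans real_norm_def)
    qed auto
    then show "\<bar>covf h - 1 + (norm h)\<^sup>2 / 2\<bar> \<le> \<epsilon> * (norm h)\<^sup>2"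
      by (simp add: covf_0 dot_square_norm power2_eq_square algebra_simps)
  qed (use d1 d2 in auto)
qed

text \<open>The expansion with tolerance 1/4 gives
  \<open>1 - covf h \<ge> (norm h)\<^sup>2 / 4\<close>, and the other factor
  \<open>1 + covf h\<close> of the difference of squares is at least 1. Lags below 1 keep the
  covariance positive.\<close>

lemma covf_bounds:
  "\<exists>d>0. \<forall>h. 0 < norm h \<longrightarrow> norm h < d \<longrightarrow> 0 < covf h \<and> covf h < 1 \<and> (norm h)\<^sup>2 / 4 \<le> 1 - (covf h)\<^sup>2"
proof -
  obtain d where d: "d > 0" "\<And>h. norm h < d \<Longrightarrow> \<bar>covf h - 1 + (norm h)\<^sup>2 / 2\<bar> \<le> (1 / 4) * (norm h)\<^sup>2"
    using covf_taylor [of "1 / 4"] by auto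
  show ?thesis
  proof (intro exI [of _ "min d 1"] conjI allI impI)
    fix h :: "real ^ 2" assume h: "0 < norm h" "norm h < min d 1"
    have n: "0 < (norm h)\<^sup>2" "(norm h)\<^sup>2 < 1"
      using h by (auto simp: abs_square_less_1)
    have "\<bar>covf h - 1 + (norm h)\<^sup>2 / 2\<bar> \<le> (1 / 4) * (norm h)\<^sup>2" using d h by auto
    then have 1: "covf h \<le> 1 - (norm h)\<^sup>2 / 4" "covf h > 0" using n by linarith+
    then show lt: "covf h < 1" "0 < covf h" using n by linarith+
    have "(norm h)\<^sup>2 / 4 * 1 \<le> (1 - covf h) * (1 + covf h)"
      using 1 n lt by (intro mult_mono) auto
    then show "(norm h)\<^sup>2 / 4 \<le> 1 - (covf h)\<^sup>2"
      by (simp add: power2_eq_square algebra_simps)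
  qed (use d in auto)
qed

lemma prob_crossing_shift:
  "prob {\<omega> \<in> space M. X s \<omega> < 0 \<and> 0 \<le> X t \<omega>} = prob {\<omega> \<in> space M. X 0 \<omega> < 0 \<and> 0 \<le> X (t - s) \<omega>}"
proof -
  have *: "prob {\<omega> \<in> space M. X s \<omega> < 0 \<and> 0 \<le> X t \<omega>} = (LINT \<omega>|M. indicator {..<0} (X s \<omega>) * indicator {0..} (X t \<omega>))"
    for s t
  proof -
    have "prob {\<omega> \<in> space M. X s \<omega> < 0 \<and> 0 \<le> X t \<omega>} = (LINT \<omega>|M. indicator {\<omega> \<in> space M. X s \<omega> < 0 \<and> 0 \<le> X t \<omega>} \<omega>)"
      by (auto simp: Int_def intro!: arg_cong [where f = prob])
    also have "\<dots> = (LINT \<omega>|M. indicator {..<0} (X s \<omega>) * indicator {0..} (X t \<omega>))"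
      by (intro Bochner_Integration.integral_cong) (auto simp: indicator_def)
    finally show ?thesis .
  qed
  show ?thesis
    unfolding * using stationary_integral [of "\<lambda>x. indicator {..<0} (x 0) * indicator {0..} (x (t - s))" s]
    by simp
qed

text \<open>The sector parameter \<open>\<tau> h\<close> is asymptotic to \<open>norm h\<close>: in
  the difference of squares, \<open>1 - covf h\<close> behaves like
  \<open>(norm h)\<^sup>2 / 2\<close> and \<open>1 + covf h\<close> tends to 2.\<close>

lemma crossing_asymp:
  "\<exists>c>0. ((\<lambda>h. prob {\<omega> \<in> space M. X 0 \<omega> < 0 \<and> 0 \<le> X h \<omega>} / norm h) \<longlongrightarrow> c) (at 0)"
proof -
  obtain c where c: "c > 0" "((\<lambda>\<tau>. cross_prob \<tau> / \<tau>) \<longlongrightarrow> c) (at_right 0)"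
    using cross_prob_asymp by blast
  define \<tau> where "\<tau> h = sqrt (1 - (covf h)\<^sup>2) / covf h" for h
  obtain d where d: "d > 0" "\<And>h. 0 < norm h \<Longrightarrow> norm h < d \<Longrightarrow> 0 < covf h \<and> covf h < 1"
    using covf_bounds by blast
  have ev: "\<forall>\<^sub>F h in at 0. 0 < norm h \<and> 0 < covf h \<and> covf h < 1"
    unfolding eventually_at using d by (intro exI [of _ d]) (auto simp: dist_norm)
  have l1: "((\<lambda>h. (1 - covf h) / (norm h)\<^sup>2) \<longlongrightarrow> 1 / 2) (at 0)"
  proof (rule tendstoI)
    fix e :: real assume "e > 0"
    then obtain d where d: "d > 0" "\<And>h. norm h < d \<Longrightarrow> \<bar>covf h - 1 + (norm h)\<^sup>2 / 2\<bar> \<le> (e / 2) * (norm h)\<^sup>2"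
      using covf_taylor [of "e / 2"] by auto
    have "dist ((1 - covf h) / (norm h)\<^sup>2) (1 / 2) < e" if "0 < norm h" "norm h < d" for h
    proof -
      have "(1 - covf h) / (norm h)\<^sup>2 - 1 / 2 = - ((covf h - 1 + (norm h)\<^sup>2 / 2) / (norm h)\<^sup>2)"
        using that by (simp add: field_simps)
      then have "\<bar>(1 - covf h) / (norm h)\<^sup>2 - 1 / 2\<bar> = \<bar>covf h - 1 + (norm h)\<^sup>2 / 2\<bar> / (norm h)\<^sup>2"
        by simp
      also have "\<dots> \<le> e / 2"
        using d(2) [OF that(2)] that(1) by (simp add: field_simps)
      finally show ?thesis using \<open>e > 0\<close> by (simp add: dist_real_def)
    qed
    then show "\<forall>\<^sub>F h in at 0. dist ((1 - covf h) / (norm h)\<^sup>2) (1 / 2) < e"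
      unfolding eventually_at using d by (intro exI [of _ d]) (auto simp: dist_norm)
  qed
  have n0: "((\<lambda>h::real ^ 2. norm h) \<longlongrightarrow> 0) (at 0)"
    by (intro tendsto_norm_zero tendsto_ident_at)
  have lC: "(covf \<longlongrightarrow> 1) (at 0)"
  proof -
    have "((\<lambda>h. 1 - ((1 - covf h) / (norm h)\<^sup>2) * (norm h)\<^sup>2) \<longlongrightarrow> 1 - (1 / 2) * 0\<^sup>2) (at 0)"
      by (intro tendsto_intros l1 n0)
    moreover have "\<forall>\<^sub>F h in at 0. 1 - ((1 - covf h) / (norm h)\<^sup>2) * (norm h)\<^sup>2 = covf h"
      using ev by eventually_elim auto
    ultimately show ?thesis
      by (auto intro: Lim_transform_eventually)
  qed
  have l2: "((\<lambda>h. \<tau> h / norm h) \<longlongrightarrow> 1) (at 0)"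
  proof -
    have "((\<lambda>h. sqrt ((1 - covf h) / (norm h)\<^sup>2 * (1 + covf h)) / covf h) \<longlongrightarrow> sqrt (1 / 2 * (1 + 1)) / 1) (at 0)"
      by (intro tendsto_intros l1 lC) auto
    moreover have "\<forall>\<^sub>F h in at 0. sqrt ((1 - covf h) / (norm h)\<^sup>2 * (1 + covf h)) / covf h = \<tau> h / norm h"
      using ev
    proof eventually_elim
      case (elim h)
      have "(1 - covf h) / (norm h)\<^sup>2 * (1 + covf h) = (1 - (covf h)\<^sup>2) / (norm h)\<^sup>2"
        by (simp add: power2_eq_square algebra_simps)
      then show ?case using elim by (simp add: \<tau>_def real_sqrt_divide)
    qed
    ultimately show ?thesis
      by (auto intro: Lim_transform_eventually)
  qed
  have "filterlim \<tau> (at_right 0) (at 0)"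
    unfolding filterlim_at
  proof
    show "\<forall>\<^sub>F h in at 0. \<tau> h \<in> {0<..} \<and> \<tau> h \<noteq> 0"
      using ev
    proof eventually_elim
      case (elim h)
      then have "\<tau> h > 0" by (auto simp: \<tau>_def abs_square_less_1)
      then show ?case by simp
    qed
    have "((\<lambda>h. \<tau> h / norm h * norm h) \<longlongrightarrow> 1 * 0) (at 0)"
      by (intro tendsto_mult l2 n0)
    moreover have "\<forall>\<^sub>F h in at 0. \<tau> h / norm h * norm h = \<tau> h"
      using ev by eventually_elim auto
    ultimately show "(\<tau> \<longlongrightarrow> 0) (at 0)"
      by (auto intro: Lim_transform_eventually)
  qed
  from filterlim_compose [OF c(2) this]
  have "((\<lambda>h. cross_prob (\<tau> h) / \<tau> h * (\<tau> h / norm h)) \<longlongrightarrow> c * 1) (at 0)"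
    by (intro tendsto_mult l2)
  moreover have "\<forall>\<^sub>F h in at 0. cross_prob (\<tau> h) / \<tau> h * (\<tau> h / norm h) = prob {\<omega> \<in> space M. X 0 \<omega> < 0 \<and> 0 \<le> X h \<omega>} / norm h"
    using ev
  proof eventually_elim
    case (elim h)
    then have "\<tau> h > 0" by (auto simp: \<tau>_def abs_square_less_1)
    moreover have "prob {\<omega> \<in> space M. X 0 \<omega> < 0 \<and> 0 \<le> X h \<omega>} = cross_prob (\<tau> h)"
      using prob_crossing [of h 0] elim by (simp add: \<tau>_def)
    ultimately show ?case using elim by simp
  qed
  ultimately have "((\<lambda>h. prob {\<omega> \<in> space M. X 0 \<omega> < 0 \<and> 0 \<le> X h \<omega>} / norm h) \<longlongrightarrow> c) (at 0)"
    by (auto intro: Lim_transform_eventually)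
  with c(1) show ?thesis by blast
qed

end

section \<open>Bulinskaya's lemma\<close>

text \<open>\<open>N\<close> is not assumed measurable; it is enclosed in the intersection of
  measurable covers of vanishing probability.\<close>

lemma (in prob_space) AE_not_in_small:
  assumes "\<And>\<epsilon>. \<epsilon> > 0 \<Longrightarrow> \<exists>A\<in>sets M. N \<subseteq> A \<and> prob A \<le> \<epsilon>"
  shows "AE \<omega> in M. \<omega> \<notin> N"
proof -
  have "\<forall>n. \<exists>A\<in>sets M. N \<subseteq> A \<and> prob A \<le> 1 / real (Suc n)"
    using assms by simp
  then obtain A where A: "\<And>n. A n \<in> sets M" "\<And>n. N \<subseteq> A n" "\<And>n. prob (A n) \<le> 1 / real (Suc n)"
    by metis
  have I: "(\<Inter>n. A n) \<in> sets M" using A(1) by auto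
  have "prob (\<Inter>n. A n) \<le> 1 / real (Suc n)" for n
    using A finite_measure_mono [of "\<Inter>n. A n" "A n"] by (meson INT_lower UNIV_I order_trans)
  then have "prob (\<Inter>n. A n) \<le> 0"
    by (intro LIMSEQ_le_const [OF LIMSEQ_Suc [OF lim_1_over_n]]) auto
  then have "(\<Inter>n. A n) \<in> null_sets M"
    using I by (simp add: null_setsI emeasure_eq_measure measure_le_0_iff)
  then show ?thesis
    by (rule AE_I') (use A(2) in auto)
qed

lemma (in prob_space) AE_not_in_vanishing:
  assumes A: "\<And>n. A n \<in> sets M" and N: "\<And>n. n \<ge> 1 \<Longrightarrow> N \<subseteq> A n"
    and c: "\<And>n. n \<ge> k \<Longrightarrow> prob (A n) \<le> c / real n"
  shows "AE \<omega> in M. \<omega> \<notin> N"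
proof (rule AE_not_in_small)
  fix \<epsilon> :: real assume "\<epsilon> > 0"
  have "(\<lambda>n. c / real n) \<longlonglongrightarrow> 0"
    using tendsto_mult_right_zero [OF lim_1_over_n, of c] by simp
  then have "\<forall>\<^sub>F n in sequentially. c / real n < \<epsilon>"
    using \<open>\<epsilon> > 0\<close> by (rule order_tendstoD)
  then obtain n1 where "\<And>n. n \<ge> n1 \<Longrightarrow> c / real n < \<epsilon>"
    by (auto simp: eventually_sequentially)
  then have "c / real (max 1 (max k n1)) < \<epsilon>" by simp
  moreover have "prob (A (max 1 (max k n1))) \<le> c / real (max 1 (max k n1))" by (rule c) simp
  ultimately show "\<exists>A\<in>sets M. N \<subseteq> A \<and> prob A \<le> \<epsilon>"
    using A N by (intro bexI [of _ "A (max 1 (max k n1))"]) auto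
qed

lemma segment_grid:
  fixes s :: real
  assumes "0 \<le> s" "s \<le> 1" "n \<ge> 1"
  obtains k :: nat where "k \<le> n" "\<bar>s - real k / real n\<bar> \<le> 1 / real n"
proof
  define k where "k = nat \<lfloor>s * real n\<rfloor>"
  have k: "real k \<le> s * real n" "s * real n < real k + 1"
    using assms by (auto simp: k_def)
  then have "real k \<le> real n"
    using assms by (meson mult_left_le_one_le of_nat_0_le_iff order_trans)
  then show "k \<le> n" by simp
  have "s - real k / real n = (s * real n - real k) / real n"
    using assms by (simp add: field_simps)
  then show "\<bar>s - real k / real n\<bar> \<le> 1 / real n"
    using k by (simp add: divide_right_mono)
qed

context smooth_gaussian_field
begin

lemma AE_C1_Lip: "AE \<omega> in M. \<exists>f'. C1_Lip (\<lambda>t. X t \<omega>) f'"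
proof -
  have "AE \<omega> in M. C2 (\<lambda>t. X t \<omega>)"
    using H by (simp add: assumption_H_def)
  then show ?thesis
    by eventually_elim (meson C2_imp_C1_Lip)
qed

text \<open>
  Bulinskaya's lemma on a segment: a critical point at level \<open>u\<close> forces a value within \<open>O(1/n\<^sup>2)\<close> of \<open>u\<close>
  at one of \<open>n + 1\<close> grid points.
\<close>

lemma AE_segment_noncritical:
  "AE \<omega> in M. \<forall>f'. C1_Lip (\<lambda>t. X (\<eta> t) \<omega>) f' \<longrightarrow>
     (\<forall>t\<in>closed_segment a b. X (\<eta> t) \<omega> = u \<longrightarrow> f' t (b - a) \<noteq> 0)"
proof -
  define D where "D = (norm (b - a))\<^sup>2"
  \<comment> \<open>Stratifying by a bound on the Lipschitz constant gives countably many
    exceptional sets, each with a uniform Taylor remainder.\<close>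
  define N where "N K = {\<omega> \<in> space M. \<exists>f'. C1_Lip (\<lambda>t. X (\<eta> t) \<omega>) f' \<and> (real K)-lipschitz_on (closed_segment a b) f' \<and>
     (\<exists>t\<in>closed_segment a b. X (\<eta> t) \<omega> = u \<and> f' t (b - a) = 0)}" for K :: nat
  have "AE \<omega> in M. \<omega> \<notin> N K" for K
  proof (rule AE_not_in_vanishing [where k = 1 and c = "4 * real K * D"])
    define p where "p n k = a + (real k / real n) *\<^sub>R (b - a)" for n k :: nat
    define E where "E n k = {\<omega> \<in> space M. \<bar>X (\<eta> (p n k)) \<omega> - u\<bar> \<le> real K * D / (real n)\<^sup>2}" for n k
    have E [measurable]: "E n k \<in> sets M" for n k
      unfolding E_def by measurable
    show "(\<Union>k\<le>n. E n k) \<in> sets M" for n by auto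
    have D: "D \<ge> 0" by (simp add: D_def)
    show "prob (\<Union>k\<le>n. E n k) \<le> 4 * real K * D / real n" if "n \<ge> 1" for n
    proof -
      have "prob (\<Union>k\<le>n. E n k) \<le> (\<Sum>k\<le>n. prob (E n k))"
        by (intro finite_measure_subadditive_finite) auto
      also have "\<dots> \<le> (\<Sum>k\<le>n. 2 * (real K * D / (real n)\<^sup>2))"
        unfolding E_def using D by (intro sum_mono X_small_ball) auto
      also have "\<dots> = (real n + 1) * (2 * (real K * D / (real n)\<^sup>2))"
        by simp
      also have "\<dots> \<le> (2 * real n) * (2 * (real K * D / (real n)\<^sup>2))"
        using that D by (intro mult_right_mono) auto
      also have "\<dots> = 4 * real K * D / real n"
        using that by (simp add: power2_eq_square field_simps)
      finally show ?thesis .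
    qed
    show "N K \<subseteq> (\<Union>k\<le>n. E n k)" if n: "n \<ge> 1" for n
    proof
      fix \<omega> assume "\<omega> \<in> N K"
      then obtain f' t where \<omega>: "\<omega> \<in> space M" and f: "C1_Lip (\<lambda>t. X (\<eta> t) \<omega>) f'"
        and K: "(real K)-lipschitz_on (closed_segment a b) f'"
        and t: "t \<in> closed_segment a b" "X (\<eta> t) \<omega> = u" "f' t (b - a) = 0"
        by (auto simp: N_def)
      obtain s where s: "0 \<le> s" "s \<le> 1" "t = a + s *\<^sub>R (b - a)"
        using t(1) by (auto simp: in_segment algebra_simps)
      obtain k where k: "k \<le> n" "\<bar>s - real k / real n\<bar> \<le> 1 / real n"
        using segment_grid [OF s(1,2) n] .
      have "p n k \<in> closed_segment a b"
        using k(1) n unfolding in_segment p_def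
        by (intro exI [of _ "real k / real n"]) (auto simp: algebra_simps)
      note taylor = C1_Lip_taylor [OF f K convex_closed_segment t(1) this]
      have pt: "p n k - t = (real k / real n - s) *\<^sub>R (b - a)"
        by (simp add: p_def s(3) algebra_simps)
      have "\<bar>X (\<eta> (p n k)) \<omega> - u\<bar> \<le> real K * (norm (p n k - t))\<^sup>2"
        using taylor t by (simp add: pt blinfun.scaleR_right)
      also have "\<dots> \<le> real K * ((1 / real n)\<^sup>2 * D)"
      proof (rule mult_left_mono)
        have "(norm (p n k - t))\<^sup>2 = (s - real k / real n)\<^sup>2 * D"
          by (simp add: pt D_def power_mult_distrib power2_commute)
        also have "\<dots> \<le> (1 / real n)\<^sup>2 * D"
          using k(2) n D by (intro mult_right_mono) (auto simp: abs_le_square_iff [symmetric])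
        finally show "(norm (p n k - t))\<^sup>2 \<le> (1 / real n)\<^sup>2 * D" .
      qed simp
      also have "\<dots> = real K * D / (real n)\<^sup>2"
        by (simp add: power_divide)
      finally have "\<bar>X (\<eta> (p n k)) \<omega> - u\<bar> \<le> real K * D / (real n)\<^sup>2" .
      then show "\<omega> \<in> (\<Union>k\<le>n. E n k)"
        using k(1) \<omega> by (auto simp: E_def)
    qed
  qed
  then have "AE \<omega> in M. \<forall>K. \<omega> \<notin> N K"
    by (simp add: AE_all_countable)
  then show ?thesis
  proof (rule AE_mp, intro AE_I2 impI allI ballI notI)
    fix \<omega> f' t assume \<omega>: "\<omega> \<in> space M" "\<forall>K. \<omega> \<notin> N K" and f: "C1_Lip (\<lambda>t. X (\<eta> t) \<omega>) f'"
      and t: "t \<in> closed_segment a b" "X (\<eta> t) \<omega> = u" "f' t (b - a) = 0"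
    obtain L where L: "L-lipschitz_on (closed_segment a b) f'"
      using C1_Lip_deriv_lipschitz [OF f bounded_closed_segment] by metis
    obtain K :: nat where "L \<le> real K" using real_arch_simple by blast
    with L have "(real K)-lipschitz_on (closed_segment a b) f'" by (auto intro: lipschitz_on_mono)
    with \<omega> f t show False by (auto simp: N_def)
  qed
qed

lemma vec2_norm_le: "norm (x :: real ^ 2) \<le> \<bar>x $ 1\<bar> + \<bar>x $ 2\<bar>"
  using norm_le_l1_cart [of x] by (simp add: sum_2)

text \<open>
  Bulinskaya's lemma in the plane: near a critical point at level \<open>u\<close> two neighbouring points of a grid
  of mesh \<open>1/n\<close> carry values within \<open>O(1/n\<^sup>2)\<close> of \<open>u\<close>, an event of probability \<open>O(1/n\<^sup>3)\<close>.
\<close>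

lemma AE_noncritical:
  "AE \<omega> in M. \<forall>f'. C1_Lip (\<lambda>t. X t \<omega>) f' \<longrightarrow> (\<forall>t. X t \<omega> = u \<longrightarrow> f' t \<noteq> 0)"
proof -
  \<comment> \<open>The radius \<open>m + 3\<close> leaves room for grid points at distance at most
    \<open>3 / n\<close> from a critical point of norm at most \<open>m\<close>.\<close>
  define N where "N K m = {\<omega> \<in> space M. \<exists>f'. C1_Lip (\<lambda>t. X t \<omega>) f' \<and> (real K)-lipschitz_on (cball 0 (real m + 3)) f' \<and>
     (\<exists>t\<in>cball 0 (real m). X t \<omega> = u \<and> f' t = 0)}" for K m :: nat
  obtain d where d: "d > 0" "\<And>h. 0 < norm h \<Longrightarrow> norm h < d \<Longrightarrow> 0 < covf h \<and> covf h < 1 \<and> (norm h)\<^sup>2 / 4 \<le> 1 - (covf h)\<^sup>2"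
    using covf_bounds by blast
  obtain n0 where n0: "n0 \<ge> 1" "1 / real n0 < d"
    using d(1) by (metis One_nat_def Suc_leI inverse_eq_divide reals_Archimedean3 nat_approx_posE zero_less_Suc)
  have "AE \<omega> in M. \<omega> \<notin> N K m" if m: "m \<ge> 1" for K m
  proof (rule AE_not_in_vanishing [where k = n0 and c = "32400 * (real m)\<^sup>2 * (real K)\<^sup>2"])
    \<comment> \<open>The Taylor remainder \<open>K\<close> times the square of the distance
      \<open>3 / n\<close>.\<close>
    define \<delta> where "\<delta> n = 9 * real K / (real n)\<^sup>2" for n :: nat
    define p where "p n = (\<lambda>(i, j). vector [of_int i / real n, of_int j / real n] :: real ^ 2)" for n :: nat
    define e where "e n = (1 / real n) *\<^sub>R (axis 1 1 :: real ^ 2)" for n :: nat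
    \<comment> \<open>The extra unit on either side absorbs the rounding of the coordinates.\<close>
    define I where "I n = {- int (m * n) - 1..int (m * n) + 1} \<times> {- int (m * n) - 1..int (m * n) + 1}" for n :: nat
    define E where "E n z = {\<omega> \<in> space M. \<bar>X (p n z) \<omega> - u\<bar> \<le> \<delta> n \<and> \<bar>X (p n z + e n) \<omega> - u\<bar> \<le> \<delta> n}" for n z
    have E [measurable]: "E n z \<in> sets M" for n z
      unfolding E_def by measurable
    have finI: "finite (I n)" for n by (simp add: I_def)
    show "(\<Union>z\<in>I n. E n z) \<in> sets M" for n using finI by auto
    \<comment> \<open>At most \<open>25 * m\<^sup>2 * n\<^sup>2\<close> grid points, each of
      probability at most \<open>1296 * K\<^sup>2 / n ^ 3\<close>. The bound starts at
      \<open>n0\<close>, where the mesh is fine enough for \<open>covf_bounds\<close>.\<close>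
    show "prob (\<Union>z\<in>I n. E n z) \<le> 32400 * (real m)\<^sup>2 * (real K)\<^sup>2 / real n" if "n \<ge> n0" for n
    proof -
      have n: "n \<ge> 1" "1 / real n < d"
      proof -
        show "n \<ge> 1" using that n0 by simp
        have "1 / real n \<le> 1 / real n0" using that n0 by (intro frac_le) auto
        then show "1 / real n < d" using n0(2) by linarith
      qed
      have ne: "norm (e n) = 1 / real n" by (simp add: e_def)
      have c: "0 < covf (e n)" "covf (e n) < 1" "(1 / real n)\<^sup>2 / 4 \<le> 1 - (covf (e n))\<^sup>2"
        using d(2) [of "e n"] n ne by auto
      have "prob (E n z) \<le> 1296 * (real K)\<^sup>2 / (real n) ^ 3" for z
      proof -
        have "prob (E n z) \<le> 8 * (\<delta> n)\<^sup>2 / sqrt (1 - (covf (e n))\<^sup>2)"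
          using X_pair_small_ball [of "p n z + e n" "p n z" "\<delta> n" u] c unfolding E_def by (simp add: \<delta>_def)
        also have "\<dots> \<le> 8 * (\<delta> n)\<^sup>2 / (1 / real n / 2)"
        proof (rule divide_left_mono)
          have "sqrt ((1 / real n)\<^sup>2 / 4) = 1 / real n / 2"
            by (simp add: real_sqrt_divide)
          with real_sqrt_le_mono [OF c(3)] show "1 / real n / 2 \<le> sqrt (1 - (covf (e n))\<^sup>2)" by simp
          moreover have "0 < 1 / real n / 2" using n by simp
          ultimately show "0 < sqrt (1 - (covf (e n))\<^sup>2) * (1 / real n / 2)"
            by (intro mult_pos_pos) linarith+
        qed auto
        also have "\<dots> = 1296 * (real K)\<^sup>2 / (real n) ^ 3"
          using n by (simp add: \<delta>_def power2_eq_square power3_eq_cube field_simps)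
        finally show ?thesis .
      qed
      then have "(\<Sum>z\<in>I n. prob (E n z)) \<le> real (card (I n)) * (1296 * (real K)\<^sup>2 / (real n) ^ 3)"
        by (rule sum_bounded_above)
      also have "\<dots> \<le> (5 * real m * real n)\<^sup>2 * (1296 * (real K)\<^sup>2 / (real n) ^ 3)"
      proof (rule mult_right_mono)
        have mn: "1 \<le> real m * real n" using m n
          by (metis mult_le_mono nat_mult_1 of_nat_1 of_nat_le_iff of_nat_mult)
        have "card (I n) = (2 * (m * n) + 3)\<^sup>2"
          by (simp add: I_def power2_eq_square) (simp add: nat_add_distrib nat_mult_distrib algebra_simps)
        then have "real (card (I n)) = (2 * (real m * real n) + 3)\<^sup>2" by simp
        also have "\<dots> \<le> (5 * real m * real n)\<^sup>2"
          using mn by (intro power_mono) auto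
        finally show "real (card (I n)) \<le> (5 * real m * real n)\<^sup>2" .
      qed auto
      also have "\<dots> = 32400 * (real m)\<^sup>2 * (real K)\<^sup>2 / real n"
        using n by (simp add: power2_eq_square power3_eq_cube field_simps)
      finally have "(\<Sum>z\<in>I n. prob (E n z)) \<le> 32400 * (real m)\<^sup>2 * (real K)\<^sup>2 / real n" .
      moreover have "prob (\<Union>z\<in>I n. E n z) \<le> (\<Sum>z\<in>I n. prob (E n z))"
        by (rule finite_measure_subadditive_finite [OF finI]) (use E in blast)
      ultimately show ?thesis by linarith
    qed
    show "N K m \<subseteq> (\<Union>z\<in>I n. E n z)" if n: "n \<ge> 1" for n
    proof
      fix \<omega> assume "\<omega> \<in> N K m"
      then obtain f' t where \<omega>: "\<omega> \<in> space M" and f: "C1_Lip (\<lambda>t. X t \<omega>) f'"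
        and K: "(real K)-lipschitz_on (cball 0 (real m + 3)) f'"
        and t: "norm t \<le> real m" "X t \<omega> = u" "f' t = 0"
        by (auto simp: N_def)
      define z where "z = (\<lfloor>t $ 1 * real n\<rfloor>, \<lfloor>t $ 2 * real n\<rfloor>)"
      have coord: "\<bar>t $ i\<bar> \<le> real m" for i
        using component_le_norm_cart [of t i] t(1) by linarith
      have zI: "\<lfloor>t $ i * real n\<rfloor> \<in> {- int (m * n) - 1..int (m * n) + 1}" for i
      proof -
        have "\<bar>t $ i * real n\<bar> \<le> real m * real n"
          unfolding abs_mult using coord by (intro mult_mono) auto
        then have "- real (m * n) \<le> t $ i * real n" "t $ i * real n \<le> real (m * n)"
          by (auto simp: abs_le_iff)
        then show ?thesis
          by (auto simp: le_floor_iff floor_le_iff)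
      qed
      have fl: "\<bar>of_int \<lfloor>t $ i * real n\<rfloor> / real n - t $ i\<bar> \<le> 1 / real n" for i
      proof -
        have "of_int \<lfloor>t $ i * real n\<rfloor> / real n - t $ i = (of_int \<lfloor>t $ i * real n\<rfloor> - t $ i * real n) / real n"
          using n by (simp add: field_simps)
        moreover have "\<bar>of_int \<lfloor>t $ i * real n\<rfloor> - t $ i * real n\<bar> \<le> 1" by linarith
        ultimately show ?thesis by (simp add: divide_right_mono)
      qed
      have pt: "norm (p n z - t) \<le> 2 / real n"
        using vec2_norm_le [of "p n z - t"] fl [of 1] fl [of 2] by (simp add: p_def z_def)
      have ne: "norm (e n) = 1 / real n" by (simp add: e_def)
      have pt': "norm (p n z + e n - t) \<le> 3 / real n"
        using norm_triangle_ineq [of "p n z - t" "e n"] pt ne by (simp add: algebra_simps)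
      have n1: "1 / real n \<le> 1" using n by simp
      have tb: "t \<in> cball 0 (real m + 3)" using t(1) by simp
      have near: "\<bar>X q \<omega> - u\<bar> \<le> \<delta> n" if q: "norm (q - t) \<le> 3 / real n" for q
      proof -
        have "norm q \<le> norm t + norm (q - t)" by (metis norm_triangle_sub)
        then have "q \<in> cball 0 (real m + 3)" using t(1) q n1 by simp
        from C1_Lip_taylor [OF f K convex_cball tb this]
        have "\<bar>X q \<omega> - u\<bar> \<le> real K * (norm (q - t))\<^sup>2"
          using t by simp
        also have "\<dots> \<le> real K * (3 / real n)\<^sup>2"
          using q by (intro mult_left_mono power_mono) auto
        also have "\<dots> = \<delta> n" by (simp add: \<delta>_def power_divide)
        finally show ?thesis .
      qed
      have "2 / real n \<le> 3 / real n" by (simp add: divide_right_mono)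
      then have "\<omega> \<in> E n z"
        using near pt pt' \<omega> by (auto simp: E_def)
      moreover have "z \<in> I n"
        using zI by (simp add: I_def z_def)
      ultimately show "\<omega> \<in> (\<Union>z\<in>I n. E n z)" by blast
    qed
  qed
  then have "AE \<omega> in M. \<forall>K. \<forall>m. \<omega> \<notin> N K (Suc m)"
    by (simp add: AE_all_countable)
  then show ?thesis
  proof (rule AE_mp, intro AE_I2 impI allI ballI notI)
    fix \<omega> f' t assume \<omega>: "\<omega> \<in> space M" "\<forall>K m. \<omega> \<notin> N K (Suc m)" and f: "C1_Lip (\<lambda>t. X t \<omega>) f'"
      and t: "X t \<omega> = u" "f' t = 0"
    obtain m :: nat where "norm t \<le> real m" using real_arch_simple by blast
    then have m: "norm t \<le> real (Suc m)" by simp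
    obtain L where L: "L-lipschitz_on (cball 0 (real (Suc m) + 3)) f'"
      using C1_Lip_deriv_lipschitz [OF f bounded_cball] by metis
    obtain K :: nat where "L \<le> real K" using real_arch_simple by blast
    with L have "(real K)-lipschitz_on (cball 0 (real (Suc m) + 3)) f'" by (auto intro: lipschitz_on_mono)
    with \<omega> f t m show False by (fastforce simp: N_def)
  qed
qed

end

section \<open>Rotations of rectangles\<close>

text \<open>The parametrization by the unit square also covers degenerate rectangles, with
  \<open>v\<close> or \<open>w\<close> equal to 0.\<close>

definition parallelogram :: "'a::real_vector \<Rightarrow> 'a \<Rightarrow> 'a \<Rightarrow> 'a set" where
  "parallelogram p v w = (\<lambda>(\<alpha>, \<beta>). p + \<alpha> *\<^sub>R v + \<beta> *\<^sub>R w) ` ({0..1} \<times> {0..1})"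

lemma parallelogramI: "0 \<le> \<alpha> \<Longrightarrow> \<alpha> \<le> 1 \<Longrightarrow> 0 \<le> \<beta> \<Longrightarrow> \<beta> \<le> 1 \<Longrightarrow> p + \<alpha> *\<^sub>R v + \<beta> *\<^sub>R w \<in> parallelogram p v w"
  by (auto simp: parallelogram_def intro!: image_eqI [of _ _ "(\<alpha>, \<beta>)"])

lemma compact_parallelogram: "compact (parallelogram p v (w :: 'a::euclidean_space))"
  unfolding parallelogram_def
  by (intro compact_continuous_image compact_Times) (auto simp: case_prod_unfold intro!: continuous_intros)

lemma convex_parallelogram: "convex (parallelogram p v (w :: 'a::euclidean_space))"
proof -
  have "linear (\<lambda>z. fst z *\<^sub>R v + snd z *\<^sub>R w :: 'a)"
    by (intro linearI) (auto simp: algebra_simps)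
  then have "convex ((\<lambda>x. p + x) ` (\<lambda>z. fst z *\<^sub>R v + snd z *\<^sub>R w) ` ({0..1} \<times> {0..1}))"
    by (intro convex_translation convex_linear_image convex_Times) auto
  also have "(\<lambda>x. p + x) ` (\<lambda>z. fst z *\<^sub>R v + snd z *\<^sub>R w) ` ({0..1} \<times> {0..1}) = parallelogram p v w"
    by (auto simp: parallelogram_def image_image case_prod_unfold add.assoc)
  finally show ?thesis .
qed

lemma vec2_expand: "(x :: real ^ 2) = (x $ 1) *\<^sub>R axis 1 1 + (x $ 2) *\<^sub>R axis 2 1"
  by (simp add: vec_eq_iff forall_2 axis_def)

lemma rotation_matrix_inverse:
  assumes "rotation_matrix R"
  shows "R *v (transpose R *v x) = x" "transpose R *v (R *v x) = x"
  using assms by (simp_all only: rotation_matrix_def orthogonal_matrix_def matrix_vector_mul_assoc matrix_vector_mul_lid)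

text \<open>The second fact, that two nonzero sides span the plane, is all that interior points need
  of the right angle.\<close>

lemma rectangleE:
  assumes "rectangle T"
  obtains p v w where "T = parallelogram p v w"
    and "\<And>L :: (real ^ 2) \<Rightarrow>\<^sub>L real. v \<noteq> 0 \<Longrightarrow> w \<noteq> 0 \<Longrightarrow> blinfun_apply L v = 0 \<Longrightarrow> blinfun_apply L w = 0 \<Longrightarrow> L = 0"
proof -
  obtain s t R a where R: "rotation_matrix R"
    and T: "T = (\<lambda>x. R *v (x + a)) ` {x. x $ 1 \<in> closed_segment 0 s \<and> x $ 2 \<in> closed_segment 0 t}"
    using assms by (auto simp: rectangle_def)
  define v where "v = s *\<^sub>R (R *v axis 1 1)"
  define w where "w = t *\<^sub>R (R *v axis 2 1)"
  have Rx: "R *v x = (x $ 1) *\<^sub>R (R *v axis 1 1) + (x $ 2) *\<^sub>R (R *v axis 2 1)" for x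
    by (subst vec2_expand [of x]) (simp add: matrix_vector_right_distrib matrix_vector_mult_scaleR)
  have seg: "x \<in> closed_segment 0 r \<longleftrightarrow> (\<exists>\<alpha>\<in>{0..1}. x = \<alpha> * r)" for x r :: real
    by (auto simp: in_segment)
  have "T = parallelogram (R *v a) v w"
  proof (intro subset_antisym subsetI)
    fix y assume "y \<in> T"
    then obtain x where x: "y = R *v (x + a)" "x $ 1 \<in> closed_segment 0 s" "x $ 2 \<in> closed_segment 0 t"
      by (auto simp: T)
    then obtain \<alpha> \<beta> where ab: "\<alpha> \<in> {0..1}" "\<beta> \<in> {0..1}" "x $ 1 = \<alpha> * s" "x $ 2 = \<beta> * t"
      by (auto simp: seg)
    have "y = R *v a + \<alpha> *\<^sub>R v + \<beta> *\<^sub>R w"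
      unfolding x(1) matrix_vector_right_distrib Rx [of x] ab(3,4) by (simp add: v_def w_def)
    with ab show "y \<in> parallelogram (R *v a) v w"
      by (auto intro: parallelogramI)
  next
    fix y assume "y \<in> parallelogram (R *v a) v w"
    then obtain \<alpha> \<beta> where ab: "\<alpha> \<in> {0..1}" "\<beta> \<in> {0..1}" "y = R *v a + \<alpha> *\<^sub>R v + \<beta> *\<^sub>R w"
      by (auto simp: parallelogram_def)
    define x :: "real ^ 2" where "x = vector [\<alpha> * s, \<beta> * t]"
    have "y = R *v (x + a)"
      unfolding ab(3) matrix_vector_right_distrib Rx [of x] by (simp add: v_def w_def x_def)
    moreover have "x $ 1 \<in> closed_segment 0 s" "x $ 2 \<in> closed_segment 0 t"
      using ab by (auto simp: seg x_def)
    ultimately show "y \<in> T" by (auto simp: T)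
  qed
  moreover have "L = 0" if "v \<noteq> 0" "w \<noteq> 0" "blinfun_apply L v = 0" "blinfun_apply L w = 0" for L :: "(real ^ 2) \<Rightarrow>\<^sub>L real"
  proof (rule blinfun_eqI)
    fix z
    have "blinfun_apply L (R *v axis 1 1) = 0" "blinfun_apply L (R *v axis 2 1) = 0"
      using that by (auto simp: v_def w_def blinfun.scaleR_right)
    moreover have "z = R *v (transpose R *v z)"
      by (simp only: rotation_matrix_inverse [OF R])
    ultimately show "blinfun_apply L z = blinfun_apply 0 z"
      by (subst \<open>z = _\<close>, subst Rx) (simp add: blinfun.add_right blinfun.scaleR_right)
  qed
  ultimately show ?thesis using that by blast
qed

text \<open>The ends are not at level \<open>u\<close>, so \<open>t\<close> lies strictly between
  them; a nonzero slope along the edge then ascends towards one of the two ends.\<close>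

lemma edge_ascent:
  fixes f' :: "'a::real_normed_vector \<Rightarrow>\<^sub>L real"
  assumes t: "t \<in> closed_segment a b" and ab: "a \<in> T" "b \<in> T" "f a \<noteq> u" "f b \<noteq> u"
    and f: "f t = u" "f' (b - a) \<noteq> 0"
  shows "\<exists>q\<in>T. f' (q - t) > 0"
proof -
  obtain s where s: "0 \<le> s" "s \<le> 1" "t = (1 - s) *\<^sub>R a + s *\<^sub>R b"
    using t by (auto simp: in_segment)
  have "s \<noteq> 0" "s \<noteq> 1" using s f ab by auto
  then have s': "0 < s" "s < 1" using s by auto
  have "b - t = (1 - s) *\<^sub>R (b - a)" "a - t = (- s) *\<^sub>R (b - a)"
    by (auto simp: s(3) algebra_simps)
  then have "f' (b - t) = (1 - s) * f' (b - a)" "f' (a - t) = - s * f' (b - a)"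
    by (simp_all only: blinfun.scaleR_right real_scaleR_def)
  then have "f' (b - t) > 0 \<or> f' (a - t) > 0"
    using f(2) s' by (cases "f' (b - a) > 0") (auto simp: mult_pos_neg)
  then show ?thesis using ab by blast
qed

text \<open>Boundary and degenerate cases reduce to an edge. In the interior, a nonzero derivative
  is nonzero on one side vector, and one can move both ways along it.\<close>

lemma regular_on_parallelogram:
  fixes p v w :: "'a::euclidean_space" and f' :: "'a \<Rightarrow> 'a \<Rightarrow>\<^sub>L real"
  defines "V \<equiv> {p, p + v, p + w, p + v + w}"
  assumes E: "\<And>a b t. a \<in> V \<Longrightarrow> b \<in> V \<Longrightarrow> t \<in> closed_segment a b \<Longrightarrow> f t = u \<Longrightarrow> f' t (b - a) \<noteq> 0"
    and span: "\<And>L :: 'a \<Rightarrow>\<^sub>L real. v \<noteq> 0 \<Longrightarrow> w \<noteq> 0 \<Longrightarrow> blinfun_apply L v = 0 \<Longrightarrow> blinfun_apply L w = 0 \<Longrightarrow> L = 0"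
    and I: "\<And>t. f t = u \<Longrightarrow> f' t \<noteq> 0"
  shows "regular_on u f f' (parallelogram p v w)"
  unfolding regular_on_def
proof (intro ballI impI)
  let ?T = "parallelogram p v w"
  fix t assume "t \<in> ?T" and ft: "f t = u"
  then obtain \<alpha> \<beta> where ab: "0 \<le> \<alpha>" "\<alpha> \<le> 1" "0 \<le> \<beta>" "\<beta> \<le> 1" and t: "t = p + \<alpha> *\<^sub>R v + \<beta> *\<^sub>R w"
    by (auto simp: parallelogram_def)
  have VT: "V \<subseteq> ?T"
    using parallelogramI [of 0 0 p v w] parallelogramI [of 1 0 p v w] parallelogramI [of 0 1 p v w]
      parallelogramI [of 1 1 p v w] by (auto simp: V_def)
  \<comment> \<open>The segment from a vertex to itself has direction 0, so the hypothesis on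
    segments also excludes level \<open>u\<close> at the corners.\<close>
  have Vu: "f c \<noteq> u" if "c \<in> V" for c
    using E [OF that that, of c] by (auto simp: blinfun.zero_right)
  have edge: "\<exists>q\<in>?T. f' t (q - t) > 0" if "t \<in> closed_segment a b" "a \<in> V" "b \<in> V" for a b
    using edge_ascent [OF that(1), of ?T f u "f' t"] that VT Vu E ft by blast
  consider "v = 0" | "w = 0" | "\<alpha> = 0" | "\<alpha> = 1" | "\<beta> = 0" | "\<beta> = 1"
    | "v \<noteq> 0" "w \<noteq> 0" "0 < \<alpha>" "\<alpha> < 1" "0 < \<beta>" "\<beta> < 1"
    using ab by fastforce
  then show "\<exists>q\<in>?T. f' t (q - t) > 0"
  proof cases
    case 1
    then have "t \<in> closed_segment p (p + w)"
      using ab unfolding in_segment t by (intro exI [of _ \<beta>]) (auto simp: algebra_simps)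
    then show ?thesis by (rule edge) (auto simp: V_def)
  next
    case 2
    then have "t \<in> closed_segment p (p + v)"
      using ab unfolding in_segment t by (intro exI [of _ \<alpha>]) (auto simp: algebra_simps)
    then show ?thesis by (rule edge) (auto simp: V_def)
  next
    case 3
    then have "t \<in> closed_segment p (p + w)"
      using ab unfolding in_segment t by (intro exI [of _ \<beta>]) (auto simp: algebra_simps)
    then show ?thesis by (rule edge) (auto simp: V_def)
  next
    case 4
    then have "t \<in> closed_segment (p + v) (p + v + w)"
      using ab unfolding in_segment t by (intro exI [of _ \<beta>]) (auto simp: algebra_simps)
    then show ?thesis by (rule edge) (auto simp: V_def)
  next
    case 5
    then have "t \<in> closed_segment p (p + v)"
      using ab unfolding in_segment t by (intro exI [of _ \<alpha>]) (auto simp: algebra_simps)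
    then show ?thesis by (rule edge) (auto simp: V_def)
  next
    case 6
    then have "t \<in> closed_segment (p + w) (p + v + w)"
      using ab unfolding in_segment t by (intro exI [of _ \<alpha>]) (auto simp: algebra_simps)
    then show ?thesis by (rule edge) (auto simp: V_def)
  next
    case 7
    have q: "\<exists>q\<in>?T. f' t (q - t) > 0"
      if x: "x = v \<or> x = w" "f' t x \<noteq> 0" for x
    proof -
      define c where "c = (if x = v then \<alpha> else \<beta>)"
      have c: "0 < c" "c < 1" using 7 by (auto simp: c_def)
      have "p + 1 *\<^sub>R v + \<beta> *\<^sub>R w \<in> ?T" "p + 0 *\<^sub>R v + \<beta> *\<^sub>R w \<in> ?T"
        "p + \<alpha> *\<^sub>R v + 1 *\<^sub>R w \<in> ?T" "p + \<alpha> *\<^sub>R v + 0 *\<^sub>R w \<in> ?T"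
        using ab by (auto intro!: parallelogramI simp del: scaleR_one scaleR_zero_left)
      \<comment> \<open>The two points where the line through \<open>t\<close> in direction
        \<open>x\<close> leaves the parallelogram.\<close>
      then have T: "t + (1 - c) *\<^sub>R x \<in> ?T" "t + (- c) *\<^sub>R x \<in> ?T"
        using x(1) by (auto simp: c_def t algebra_simps)
      show ?thesis
      proof (cases "f' t x > 0")
        case True
        then show ?thesis using c
          by (intro bexI [OF _ T(1)]) (simp add: blinfun.scaleR_right)
      next
        case False
        then show ?thesis using c x
          by (intro bexI [OF _ T(2)]) (simp add: blinfun.minus_right blinfun.scaleR_right mult_pos_neg)
      qed
    qed
    have "f' t v \<noteq> 0 \<or> f' t w \<noteq> 0"
      using span [of "f' t"] I [OF ft] 7 by blast
    then show ?thesis using q by blast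
  qed
qed

section \<open>Mean Euler characteristics under rotation\<close>

text \<open>\<open>g\<close> stands for an Euler characteristic, which is measurable for the
  completion only; an almost everywhere equal version brings the integral back to
  \<open>M\<close>.\<close>

lemma completion_integral_AE:
  fixes g g' :: "'w \<Rightarrow> real"
  assumes [measurable]: "g' \<in> borel_measurable M" and ae: "AE \<omega> in M. g \<omega> = g' \<omega>"
  shows "(LINT \<omega>|completion M. g \<omega>) = (LINT \<omega>|M. g' \<omega>)"
proof -
  have g': "g' \<in> borel_measurable (completion M)"
    by (rule measurable_completion) simp
  have ae': "AE \<omega> in completion M. g \<omega> = g' \<omega>"
    by (rule AE_completion [OF ae])
  have "g \<in> borel_measurable (completion M)"
  proof (rule measurableI)
    fix B :: "real set" assume "B \<in> sets borel"
    then have "g' -` B \<inter> space (completion M) \<in> sets (completion M)"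
      using g' by (rule measurable_sets [rotated])
    then show "g -` B \<inter> space (completion M) \<in> sets (completion M)"
      by (rule completion.in_sets_AE [rotated]) (use ae' in \<open>auto elim!: AE_mp\<close>)
  qed simp
  then have "(LINT \<omega>|completion M. g \<omega>) = (LINT \<omega>|completion M. g' \<omega>)"
    using g' ae' by (rule integral_cong_AE)
  also have "\<dots> = (LINT \<omega>|M. g' \<omega>)"
    by (rule integral_completion) simp
  finally show ?thesis .
qed

context smooth_gaussian_field
begin

text \<open>Surjectivity of the derivative of \<open>\<eta>\<close> carries noncritical points of
  the field over to its composition with \<open>\<eta>\<close>; on the finitely many segments
  between vertices the composed field is treated directly.\<close>

lemma AE_regular_on:
  assumes \<eta>: "C1_Lip \<eta> \<eta>'" "\<And>t. surj (blinfun_apply (\<eta>' t))" and T: "rectangle T"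
  shows "AE \<omega> in M. \<exists>f'. C1_Lip (\<lambda>t. X (\<eta> t) \<omega>) f' \<and> regular_on u (\<lambda>t. X (\<eta> t) \<omega>) f' T"
proof -
  obtain p v w where pvw: "T = parallelogram p v w"
    "\<And>L :: (real ^ 2) \<Rightarrow>\<^sub>L real. v \<noteq> 0 \<Longrightarrow> w \<noteq> 0 \<Longrightarrow> blinfun_apply L v = 0 \<Longrightarrow> blinfun_apply L w = 0 \<Longrightarrow> L = 0"
    using rectangleE [OF T] by metis
  define V where "V = {p, p + v, p + w, p + v + w}"
  have "AE \<omega> in M. \<forall>z\<in>V \<times> V. \<forall>f'. C1_Lip (\<lambda>t. X (\<eta> t) \<omega>) f' \<longrightarrow>
     (\<forall>t\<in>closed_segment (fst z) (snd z). X (\<eta> t) \<omega> = u \<longrightarrow> f' t (snd z - fst z) \<noteq> 0)"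
    by (intro AE_ball_countable' AE_segment_noncritical countable_finite) (auto simp: V_def)
  with AE_noncritical [of u] AE_C1_Lip show ?thesis
  proof eventually_elim
    case (elim \<omega>)
    obtain g' where g': "C1_Lip (\<lambda>t. X t \<omega>) g'" using elim(2) by blast
    have f: "C1_Lip (\<lambda>t. X (\<eta> t) \<omega>) (\<lambda>t. g' (\<eta> t) o\<^sub>L \<eta>' t)"
      by (rule C1_Lip_compose [OF g' \<eta>(1)])
    have "regular_on u (\<lambda>t. X (\<eta> t) \<omega>) (\<lambda>t. g' (\<eta> t) o\<^sub>L \<eta>' t) T"
      unfolding pvw(1)
    proof (rule regular_on_parallelogram)
      fix a b t assume ab: "a \<in> {p, p + v, p + w, p + v + w}" "b \<in> {p, p + v, p + w, p + v + w}"
        and t: "t \<in> closed_segment a b" "X (\<eta> t) \<omega> = u"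
      have "(a, b) \<in> V \<times> V" using ab by (auto simp: V_def)
      from elim(3) [rule_format, OF this f] t show "(g' (\<eta> t) o\<^sub>L \<eta>' t) (b - a) \<noteq> 0"
        by (metis fst_conv snd_conv)
    next
      fix t assume "X (\<eta> t) \<omega> = u"
      then have "g' (\<eta> t) \<noteq> 0" using elim(1) g' by blast
      then obtain z where "g' (\<eta> t) z \<noteq> 0"
        by (metis blinfun_eqI zero_blinfun.rep_eq)
      moreover obtain y where "z = \<eta>' t y" using \<eta>(2) by (metis surjD)
      ultimately show "g' (\<eta> t) o\<^sub>L \<eta>' t \<noteq> 0"
        by (metis blinfun_apply_blinfun_compose zero_blinfun.rep_eq)
    qed (use pvw(2) in blast)
    with f show ?case by blast
  qed
qed

lemma mean_euler_eq_integral: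
  assumes \<eta>: "C1_Lip \<eta> \<eta>'" "\<And>t. surj (blinfun_apply (\<eta>' t))" and T: "rectangle T"
    and [measurable]: "\<Phi> \<in> borel_measurable (\<Pi>\<^sub>M t\<in>UNIV. borel)"
    and \<Phi>: "\<And>f f'. C1_Lip f f' \<Longrightarrow> regular_on u f f' T \<Longrightarrow>
           \<Phi> f = real_of_int (euler_characteristic (top_of_set {t \<in> T. f t \<ge> u}))"
  shows "mean_euler M (\<lambda>t. X (\<eta> t)) u T = (LINT \<omega>|M. \<Phi> (\<lambda>t. X (\<eta> t) \<omega>))"
  unfolding mean_euler_def excursion_set_def
proof (rule completion_integral_AE)
  have "(\<lambda>\<omega> t. X (\<eta> t) \<omega>) \<in> measurable M (\<Pi>\<^sub>M t\<in>UNIV. borel)"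
    by (intro measurable_PiM_single') auto
  then show "(\<lambda>\<omega>. \<Phi> (\<lambda>t. X (\<eta> t) \<omega>)) \<in> borel_measurable M"
    by (rule measurable_compose) simp
  show "AE \<omega> in M. real_of_int (euler_characteristic (top_of_set {t \<in> T. u \<le> X (\<eta> t) \<omega>})) = \<Phi> (\<lambda>t. X (\<eta> t) \<omega>)"
    using AE_regular_on [OF \<eta> T, of u] by eventually_elim (auto simp: \<Phi>)
qed

text \<open>Pulling the domain back by \<open>R\<close> replaces the deformation by its composition
  with \<open>Q\<close>; isotropy of the law then removes \<open>Q\<close>.\<close>

lemma mean_euler_rotate:
  assumes \<theta>: "C1_Lip \<theta> \<theta>'" "\<And>t. surj (blinfun_apply (\<theta>' t))" and T: "rectangle T"
    and R: "rotation_matrix R" and Q: "rotation_matrix Q" and eq: "\<And>t. \<theta> (R *v t) = Q *v \<theta> t"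
  shows "mean_euler M (\<lambda>t. X (\<theta> t)) u ((\<lambda>x. R *v x) ` T) = mean_euler M (\<lambda>t. X (\<theta> t)) u T"
proof -
  obtain p v w where "T = parallelogram p v w"
    using rectangleE [OF T] by metis
  then have "compact T" "convex T" by (auto simp: compact_parallelogram convex_parallelogram)
  then obtain \<Phi> where \<Phi>: "\<Phi> \<in> borel_measurable (\<Pi>\<^sub>M t\<in>UNIV. borel)"
    and \<Phi>eq: "\<And>f f'. C1_Lip f f' \<Longrightarrow> regular_on u f f' T \<Longrightarrow>
           \<Phi> f = real_of_int (euler_characteristic (top_of_set {t \<in> T. f t \<ge> u}))"
    using euler_characteristic_measurable by blast
  \<comment> \<open>Composition with \<open>\<theta>\<close> acts measurably on path space, so
    isotropy can be used for paths of \<open>X\<close> itself.\<close>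
  have "(\<lambda>x t. x (\<theta> t)) \<in> measurable (\<Pi>\<^sub>M t\<in>UNIV. borel) (\<Pi>\<^sub>M t\<in>UNIV. borel)"
    by (intro measurable_PiM_single') auto
  then have \<Psi>: "(\<lambda>x. \<Phi> (\<lambda>t. x (\<theta> t))) \<in> borel_measurable (\<Pi>\<^sub>M t\<in>UNIV. borel)"
    by (rule measurable_compose [OF _ \<Phi>])
  have inv: "R *v (transpose R *v x) = x" "transpose R *v (R *v x) = x" for x
    by (simp_all only: rotation_matrix_inverse [OF R])
  have "mean_euler M (\<lambda>t. X (\<theta> t)) u ((\<lambda>x. R *v x) ` T) = mean_euler M (\<lambda>t. X (Q *v \<theta> t)) u T"
  proof -
    have "euler_characteristic (top_of_set (excursion_set u (\<lambda>t. X (\<theta> t) \<omega>) ((\<lambda>x. R *v x) ` T)))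
        = euler_characteristic (top_of_set (excursion_set u (\<lambda>t. X (Q *v \<theta> t) \<omega>) T))" for \<omega>
    proof (rule euler_characteristic_homeomorphic)
      have "excursion_set u (\<lambda>t. X (\<theta> t) \<omega>) ((\<lambda>x. R *v x) ` T) = (\<lambda>x. R *v x) ` excursion_set u (\<lambda>t. X (Q *v \<theta> t) \<omega>) T"
        by (auto simp: excursion_set_def eq)
      moreover have "top_of_set ((\<lambda>x. R *v x) ` S) homeomorphic_space top_of_set S" for S
        unfolding homeomorphic_space_def homeomorphic_maps_def
        by (intro exI [of _ "\<lambda>x. transpose R *v x"] exI [of _ "\<lambda>x. R *v x"] conjI)
          (auto simp: inv continuous_map_in_subtopology simp del: transpose_matrix_vector
             intro!: linear_continuous_on matrix_vector_mul_bounded_linear)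
      ultimately show "top_of_set (excursion_set u (\<lambda>t. X (\<theta> t) \<omega>) ((\<lambda>x. R *v x) ` T)) homeomorphic_space
          top_of_set (excursion_set u (\<lambda>t. X (Q *v \<theta> t) \<omega>) T)"
        by simp
    qed
    then show ?thesis by (simp add: mean_euler_def)
  qed
  also have "\<dots> = (LINT \<omega>|M. \<Phi> (\<lambda>t. X (Q *v \<theta> t) \<omega>))"
  proof (rule mean_euler_eq_integral [OF _ _ T \<Phi> \<Phi>eq])
    have bl: "bounded_linear (\<lambda>x. Q *v x)" by (rule matrix_vector_mul_bounded_linear)
    show "C1_Lip (\<lambda>t. Q *v \<theta> t) (\<lambda>t. Blinfun (\<lambda>x. Q *v x) o\<^sub>L \<theta>' t)"
      using C1_Lip_compose [OF C1_Lip_bounded_linear [OF bl, of 0] \<theta>(1)] by simp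
    have Qinv: "Q *v (transpose Q *v x) = x" for x
      by (simp only: rotation_matrix_inverse [OF Q])
    show "surj (blinfun_apply (Blinfun (\<lambda>x. Q *v x) o\<^sub>L \<theta>' t))" for t
    proof (rule surjI [of _ "\<lambda>x. inv_into UNIV (blinfun_apply (\<theta>' t)) (transpose Q *v x)"])
      show "blinfun_apply (Blinfun (\<lambda>x. Q *v x) o\<^sub>L \<theta>' t) (inv_into UNIV (blinfun_apply (\<theta>' t)) (transpose Q *v x)) = x" for x
        using \<theta>(2) [of t] by (simp add: bounded_linear_Blinfun_apply [OF bl] surj_f_inv_f Qinv del: transpose_matrix_vector)
    qed
  qed
  also have "\<dots> = (LINT \<omega>|M. \<Phi> (\<lambda>t. X (\<theta> t) \<omega>))"
    by (rule isotropic_integral [OF Q \<Psi>])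
  also have "\<dots> = mean_euler M (\<lambda>t. X (\<theta> t)) u T"
    by (rule mean_euler_eq_integral [OF \<theta> T \<Phi> \<Phi>eq, symmetric])
  finally show ?thesis .
qed

end

section \<open>Plane rotations and spiral deformations\<close>

definition cpx :: "real ^ 2 \<Rightarrow> complex" where "cpx v = Complex (v $ 1) (v $ 2)"

definition rot :: "real \<Rightarrow> real ^ 2 ^ 2" where
  "rot \<alpha> = vector [vector [cos \<alpha>, - sin \<alpha>], vector [sin \<alpha>, cos \<alpha>]]"

lemma cpx_eq_iff [simp]: "cpx v = cpx w \<longleftrightarrow> v = w"
  by (auto simp: cpx_def vec_eq_iff forall_2)

lemma cpx_0 [simp]: "cpx 0 = 0" by (simp add: cpx_def Complex_eq_0)

lemma cpx_eq_0_iff [simp]: "cpx v = 0 \<longleftrightarrow> v = 0"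
  using cpx_eq_iff [of v 0] by simp

lemma cpx_scaleR [simp]: "cpx (r *\<^sub>R v) = of_real r * cpx v"
  by (simp add: cpx_def complex_eq_iff)

lemma cpx_add: "cpx (v + w) = cpx v + cpx w"
  by (simp add: cpx_def complex_eq_iff)

lemma cmod_cpx [simp]: "cmod (cpx v) = norm v"
  by (simp add: cpx_def cmod_def norm_vec_def L2_set_def sum_2)

lemma cpx_rot: "cpx (rot \<alpha> *v v) = cis \<alpha> * cpx v"
  by (simp add: cpx_def rot_def complex_eq_iff matrix_vector_mult_def sum_2)

lemma cpx_e1: "cpx (r *\<^sub>R axis 1 1) = of_real r"
  by (simp add: cpx_def complex_eq_iff axis_def)

lemma rot_0 [simp]: "rot 0 *v x = x"
  by (simp only: cpx_eq_iff [symmetric] cpx_rot) simp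

lemma rot_add: "rot (\<alpha> + \<beta>) *v x = rot \<alpha> *v (rot \<beta> *v x)"
  by (simp only: cpx_eq_iff [symmetric] cpx_rot cis_mult [symmetric] mult.assoc)

lemma norm_rot [simp]: "norm (rot \<alpha> *v x) = norm x"
  by (simp add: cmod_cpx [symmetric] cpx_rot norm_mult del: cmod_cpx)

lemma rot_scaleR: "rot \<alpha> *v (r *\<^sub>R x) = r *\<^sub>R (rot \<alpha> *v x)"
  by (simp only: cpx_eq_iff [symmetric] cpx_rot cpx_scaleR) simp

lemma ex_rot: "\<exists>\<alpha>. v = rot \<alpha> *v (norm v *\<^sub>R axis 1 1)"
proof -
  have "cpx v = cis (Arg (cpx v)) * of_real (norm v)"
    using rcis_cmod_Arg [of "cpx v"] by (simp add: rcis_def mult.commute)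
  then show ?thesis
    by (intro exI [of _ "Arg (cpx v)"]) (simp only: cpx_eq_iff [symmetric] cpx_rot cpx_e1)
qed

lemma rotation_matrix_rot: "rotation_matrix (rot \<alpha>)"
proof -
  have "orthogonal_transformation (\<lambda>x. rot \<alpha> *v x)"
    by (simp add: orthogonal_transformation)
  then have "orthogonal_matrix (matrix (\<lambda>x. rot \<alpha> *v x))"
    by (simp add: orthogonal_transformation_matrix)
  then show ?thesis
    using sin_cos_squared_add3 [of \<alpha>] by (simp add: rotation_matrix_def det_2 rot_def)
qed

lemma rotation_matrixE:
  assumes "rotation_matrix R"
  obtains \<alpha> where "R = rot \<alpha>"
proof -
  have o: "transpose R ** R = mat 1" and d: "det R = 1"
    using assms by (auto simp: rotation_matrix_def orthogonal_matrix_def)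
  have c: "(transpose R ** R) $ i $ i = 1" for i by (simp add: o mat_def)
  have 1: "R $ 1 $ 1 * R $ 1 $ 1 + R $ 2 $ 1 * R $ 2 $ 1 = 1" "R $ 1 $ 2 * R $ 1 $ 2 + R $ 2 $ 2 * R $ 2 $ 2 = 1"
    using c [of 1] c [of 2] by (auto simp: matrix_matrix_mult_def transpose_def sum_2)
  have "R $ 1 $ 1 * R $ 2 $ 2 - R $ 1 $ 2 * R $ 2 $ 1 = 1"
    using d by (simp add: det_2)
  \<comment> \<open>The squares of the entries sum to 2, which is also twice the
    determinant.\<close>
  then have "(R $ 1 $ 1 - R $ 2 $ 2)\<^sup>2 + (R $ 1 $ 2 + R $ 2 $ 1)\<^sup>2 = 0"
    using 1 by (simp add: power2_eq_square algebra_simps)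
  then have 2: "R $ 2 $ 2 = R $ 1 $ 1" "R $ 1 $ 2 = - R $ 2 $ 1"
    by (auto simp: sum_power2_eq_zero_iff)
  obtain \<alpha> where "R $ 1 $ 1 = cos \<alpha>" "R $ 2 $ 1 = sin \<alpha>"
    using 1(1) sincos_total_2pi [of "R $ 1 $ 1" "R $ 2 $ 1"] by (auto simp: power2_eq_square)
  then have "R = rot \<alpha>"
    using 2 by (simp add: vec_eq_iff forall_2 rot_def)
  then show ?thesis using that by blast
qed

section \<open>Polar coordinates and equivariance of spirals\<close>

lemma abs_angle_eq_iff: "abs_angle x = abs_angle y \<longleftrightarrow> cos x = cos y \<and> sin x = sin y"
proof -
  have "abs_angle x = abs_angle y \<longleftrightarrow> [x = y] (rmod (2 * pi))"
    by (rule angle.abs_eq_iff)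
  also have "\<dots> \<longleftrightarrow> (\<exists>n::int. y = x + 2 * pi * of_int n)"
    by (auto simp: rcong_altdef algebra_simps)
  also have "\<dots> \<longleftrightarrow> sin y = sin x \<and> cos y = cos x"
    by (simp add: sin_cos_eq_iff)
  finally show ?thesis by auto
qed

lemma ex_abs_angle: "\<exists>x. a = abs_angle x"
  by (induction a rule: angle.abs_induct) auto

lemma polar_abs: "polar (r, abs_angle x) = rot x *v (r *\<^sub>R axis 1 1)"
proof -
  have "cpx (polar (r, abs_angle x)) = cis x * of_real r"
    by (simp add: polar_def cpx_def cos_angle.abs_eq sin_angle.abs_eq complex_eq_iff)
  then show ?thesis
    by (simp only: cpx_eq_iff [symmetric] cpx_rot cpx_e1)
qed

lemma rot_polar: "rot \<beta> *v polar (r, a) = polar (r, a + abs_angle \<beta>)"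
proof -
  obtain x where "a = abs_angle x" using ex_abs_angle by blast
  then show ?thesis
    by (simp add: plus_angle.abs_eq polar_abs rot_add [symmetric] add.commute)
qed

lemma norm_polar: "norm (polar (r, a)) = \<bar>r\<bar>"
  using ex_abs_angle [of a] by (auto simp: polar_abs)

lemma inj_polar: "inj_on polar ({0<..} \<times> UNIV)"
proof (rule inj_onI, clarsimp)
  fix r s :: real and a b assume rs: "0 < r" "0 < s" and eq: "polar (r, a) = polar (s, b)"
  have r: "r = s" using norm_polar [of r a] norm_polar [of s b] rs eq by simp
  obtain x y where xy: "a = abs_angle x" "b = abs_angle y" using ex_abs_angle by metis
  have "cis x = cis y"
    using arg_cong [OF eq, of cpx] rs r by (simp add: xy polar_abs cpx_rot)
  then show "r = s \<and> a = b"
    using r by (simp add: xy abs_angle_eq_iff complex_eq_iff)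
qed

lemma polar_inv_polar: "r > 0 \<Longrightarrow> polar_inv (polar (r, a)) = (r, a)"
  unfolding polar_inv_def by (rule inv_into_f_f [OF inj_polar]) auto

lemma ex_polar:
  assumes "v \<noteq> 0" obtains a where "v = polar (norm v, a)"
  using ex_rot [of v] polar_abs by metis

lemma polar_polar_inv: "v \<noteq> 0 \<Longrightarrow> polar (polar_inv v) = v"
  by (metis ex_polar polar_inv_polar zero_less_norm_iff)

lemma int_mult_angle_add: "int_mult_angle k (a + b) = int_mult_angle k a + int_mult_angle k b"
proof -
  obtain x y where "a = abs_angle x" "b = abs_angle y" using ex_abs_angle by metis
  then show ?thesis
    by (simp add: int_mult_angle.abs_eq plus_angle.abs_eq distrib_left)
qed

text \<open>Adding an angle to the argument adds \<open>\<epsilon>\<close> times that angle to the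
  image, independently of the radius and of \<open>g\<close>.\<close>

lemma spiral_deformation_rotate:
  assumes \<theta>: "deformation \<theta>" "spiral_deformation \<theta>" and R: "rotation_matrix R"
  obtains Q where "rotation_matrix Q" "\<And>x. \<theta> (R *v x) = Q *v \<theta> x"
proof -
  obtain \<alpha> where \<alpha>: "R = rot \<alpha>" using rotation_matrixE [OF R] .
  have "bij \<theta>" and \<theta>0: "\<theta> 0 = 0" using \<theta>(1) by (auto simp: deformation_def)
  then have nz: "\<theta> x \<noteq> 0" if "x \<noteq> 0" for x using that by (metis bij_pointE)
  obtain f :: "real \<Rightarrow> real" and g \<epsilon> where fg: "\<And>r \<phi>. r > 0 \<Longrightarrow> polar_form \<theta> (r, \<phi>) = (f r, g r + int_mult_angle \<epsilon> \<phi>)"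
    using \<theta>(2) by (auto simp: spiral_deformation_def)
  have pol: "\<theta> (polar (r, \<phi>)) = polar (f r, g r + int_mult_angle \<epsilon> \<phi>)" if "r > 0" for r \<phi>
  proof -
    have "polar (r, \<phi>) \<noteq> 0" using norm_polar [of r \<phi>] that by auto
    then have "polar (polar_form \<theta> (r, \<phi>)) = \<theta> (polar (r, \<phi>))"
      unfolding polar_form_def by (simp add: polar_polar_inv nz)
    then show ?thesis using fg that by simp
  qed
  have "\<theta> (rot \<alpha> *v x) = rot (of_int \<epsilon> * \<alpha>) *v \<theta> x" for x
  proof (cases "x = 0")
    case False
    obtain a where x: "x = polar (norm x, a)" using ex_polar [OF False] .
    have "\<theta> (rot \<alpha> *v polar (norm x, a)) = rot (of_int \<epsilon> * \<alpha>) *v \<theta> (polar (norm x, a))"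
      using False by (simp add: rot_polar pol int_mult_angle_add int_mult_angle.abs_eq add.assoc)
    then show ?thesis using x by simp
  qed (simp add: \<theta>0)
  then show ?thesis
    using that rotation_matrix_rot \<alpha> by blast
qed

text \<open>By equivariance circles around 0 go to circles, so the norm of the image is a function
  \<open>f\<close> of the radius; it remains to see that this continuous function is increasing and
  onto.\<close>

lemma spiral_deformationI:
  assumes \<theta>: "bij \<theta>" "continuous_on UNIV \<theta>" "\<theta> 0 = 0" and \<epsilon>: "\<epsilon> \<in> {1, - 1 :: int}"
    and eq: "\<And>\<alpha> x. \<theta> (rot \<alpha> *v x) = rot (of_int \<epsilon> * \<alpha>) *v \<theta> x"
  shows "spiral_deformation \<theta>"
proof -
  let ?e = "axis 1 1 :: real ^ 2"
  have inj: "\<theta> x = \<theta> y \<Longrightarrow> x = y" for x y using \<theta>(1) by (metis bij_pointE)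
  have nz: "\<theta> x \<noteq> 0" if "x \<noteq> 0" for x using that \<theta> inj by metis
  have \<epsilon>2: "of_int \<epsilon> * (of_int \<epsilon> * x) = x" for x :: real using \<epsilon> by auto
  define f where "f r = norm (\<theta> (r *\<^sub>R ?e))" for r
  define g where "g r = snd (polar_inv (\<theta> (r *\<^sub>R ?e)))" for r
  have normf: "norm (\<theta> x) = f (norm x)" for x
    using ex_rot [of x] unfolding f_def by (metis eq norm_rot)
  have fpos: "f r > 0" if "r > 0" for r
    using that nz [of "r *\<^sub>R ?e"] by (simp add: f_def)
  have fg: "\<theta> (r *\<^sub>R ?e) = polar (f r, g r)" if "r > 0" for r
  proof -
    have "\<theta> (r *\<^sub>R ?e) \<noteq> 0" using that by (intro nz) auto
    from ex_polar [OF this] obtain a where "\<theta> (r *\<^sub>R ?e) = polar (f r, a)"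
      unfolding f_def by metis
    then show ?thesis using polar_inv_polar [OF fpos [OF that]] by (simp add: g_def)
  qed
  \<comment> \<open>Images with equal norm differ by a rotation, which equivariance moves back to
    the arguments; this uses that \<open>\<epsilon>\<close> is its own inverse.\<close>
  have finj: "r = s" if rs: "r > 0" "s > 0" "f r = f s" for r s
  proof -
    obtain x where "g r = g s + abs_angle x"
      using ex_abs_angle [of "g r - g s"] by (metis add.commute diff_add_cancel)
    then have "\<theta> (r *\<^sub>R ?e) = rot x *v \<theta> (s *\<^sub>R ?e)"
      using fg rs by (simp add: rot_polar)
    also have "\<dots> = \<theta> (rot (of_int \<epsilon> * x) *v (s *\<^sub>R ?e))"
      by (simp add: eq \<epsilon>2)
    finally have "r *\<^sub>R ?e = rot (of_int \<epsilon> * x) *v (s *\<^sub>R ?e)" by (rule inj)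
    then have "norm (r *\<^sub>R ?e) = norm (s *\<^sub>R ?e)" by simp
    then show "r = s" using rs by simp
  qed
  have contf: "continuous_on S f" for S
    unfolding f_def by (intro continuous_intros continuous_on_compose2 [OF \<theta>(2)]) auto
  have "f r < f s" if rs: "0 < r" "r < s" for r s
  proof (rule ccontr)
    assume "\<not> f r < f s"
    then have "f s \<le> f r" by simp
    \<comment> \<open>Since \<open>f\<close> vanishes at 0, the value \<open>f s\<close> would be
      attained a second time on \<open>{0..r}\<close>.\<close>
    moreover have "f 0 \<le> f s" by (simp add: f_def \<theta>(3))
    ultimately obtain x where x: "0 \<le> x" "x \<le> r" "f x = f s"
      using IVT' [of f 0 "f s" r] rs contf by auto
    have "x \<noteq> 0" using x fpos [of s] rs by (auto simp: f_def \<theta>(3))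
    then have "x = s" using finj [of x s] x rs by simp
    with x rs show False by simp
  qed
  then have mono: "strict_mono_on {0<..} f"
    by (auto simp: strict_mono_on_def)
  have surj: "f ` {0<..} = {0<..}"
  proof (intro subset_antisym subsetI)
    fix y :: real assume "y \<in> {0<..}"
    obtain x where x: "\<theta> x = y *\<^sub>R ?e" using \<theta>(1) by (metis bij_pointE)
    have "x \<noteq> 0" using x \<open>y \<in> {0<..}\<close> \<theta>(3) by auto
    moreover have "f (norm x) = y" using normf [of x] x \<open>y \<in> {0<..}\<close> by simp
    ultimately show "y \<in> f ` {0<..}" by force
  qed (use fpos in auto)
  have form: "polar_form \<theta> (r, \<phi>) = (f r, g r + int_mult_angle \<epsilon> \<phi>)" if "r > 0" for r \<phi>
  proof -
    obtain x where \<phi>: "\<phi> = abs_angle x" using ex_abs_angle by blast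
    have "\<theta> (polar (r, \<phi>)) = rot (of_int \<epsilon> * x) *v polar (f r, g r)"
      by (simp add: \<phi> polar_abs eq fg that)
    also have "\<dots> = polar (f r, g r + int_mult_angle \<epsilon> \<phi>)"
      by (simp add: rot_polar \<phi> int_mult_angle.abs_eq)
    finally show ?thesis
      by (simp add: polar_form_def polar_inv_polar fpos that)
  qed
  show ?thesis
    unfolding spiral_deformation_def using mono surj \<epsilon> form by blast
qed

section \<open>From isometric circle actions to spirals\<close>

text \<open>Additivity carries the derivative from 0 to every point, so \<open>z\<close> solves z' =
  c z and its product with the inverse exponential is constant.\<close>

lemma multiplicative_eq_exp:
  fixes z :: "real \<Rightarrow> complex"
  assumes add: "\<And>a b. z (a + b) = z a * z b" and d: "(z has_vector_derivative c) (at 0)" and z0: "z 0 = 1"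
  shows "z x = exp (c * of_real x)"
proof -
  have dz: "(z has_vector_derivative z x * c) (at x)" for x
  proof -
    have "((\<lambda>h. h - x) has_vector_derivative 1) (at x)"
      by (auto intro!: derivative_eq_intros)
    moreover have "(z has_vector_derivative c) (at (x - x))" using d by simp
    ultimately have "(z \<circ> (\<lambda>h. h - x) has_vector_derivative 1 *\<^sub>R c) (at x)"
      by (intro vector_diff_chain_at) auto
    then have "((\<lambda>h. z x * z (h - x)) has_vector_derivative z x * c) (at x)"
      by (auto simp: o_def intro!: has_vector_derivative_mult_right)
    then show ?thesis by (simp add: add [symmetric])
  qed
  have "((\<lambda>x. z x * exp (- (c * of_real x))) has_derivative (\<lambda>h. 0)) (at x)" for x
  proof -
    have "((\<lambda>x. exp (- (c * of_real x))) has_vector_derivative (- c) * exp (- (c * of_real x))) (at x)"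
      by (rule has_vector_derivative_real_field [of "\<lambda>w. exp (- (c * w))"]) (auto intro!: derivative_eq_intros)
    from has_vector_derivative_mult [OF dz [of x] this]
    show ?thesis by (simp add: has_vector_derivative_def)
  qed
  then have "\<exists>k. \<forall>x\<in>UNIV. z x * exp (- (c * of_real x)) = k"
    by (intro has_derivative_zero_constant) auto
  then have "z x * exp (- (c * of_real x)) = 1"
    using z0 by (metis UNIV_I exp_zero minus_zero mult.right_neutral mult_zero_right of_real_0)
  then show ?thesis
    by (simp add: exp_minus field_simps)
qed

lemma spiral_deformation_if_metric_invariant:
  fixes \<theta> :: "real ^ 2 \<Rightarrow> real ^ 2"
  assumes bij: "bij \<theta>" and \<theta>0: "\<theta> 0 = 0" and \<theta>: "C1_Lip \<theta> \<theta>'" and \<kappa>: "C1_Lip (inv_into UNIV \<theta>) \<kappa>'"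
    and inv: "\<And>\<alpha> x v. norm (\<theta>' (rot \<alpha> *v x) (rot \<alpha> *v v)) = norm (\<theta>' x v)"
  shows "spiral_deformation \<theta>"
proof -
  let ?e = "axis 1 1 :: real ^ 2"
  define \<kappa> where "\<kappa> = inv_into UNIV \<theta>"
  have \<kappa>\<theta>: "\<kappa> (\<theta> x) = x" and \<theta>\<kappa>: "\<theta> (\<kappa> x) = x" for x
    using bij by (simp_all add: \<kappa>_def bij_is_inj bij_is_surj surj_f_inv_f)
  have inj: "\<theta> x = \<theta> y \<Longrightarrow> x = y" for x y using \<kappa>\<theta> by metis
  have nz: "\<theta> x \<noteq> 0" if "x \<noteq> 0" for x using that \<theta>0 inj by metis
  have d\<theta>: "(\<theta> has_derivative blinfun_apply (\<theta>' x)) (at x)" and d\<kappa>: "(\<kappa> has_derivative blinfun_apply (\<kappa>' x)) (at x)" for x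
    using C1_Lip_has_derivative \<theta> \<kappa> by (auto simp: \<kappa>_def)
  have \<theta>'\<kappa>': "\<theta>' (\<kappa> y) (\<kappa>' y w) = w" for y w
  proof -
    have "((\<lambda>x. \<theta> (\<kappa> x)) has_derivative (\<lambda>w. \<theta>' (\<kappa> y) (\<kappa>' y w))) (at y)"
      by (rule has_derivative_compose [OF d\<kappa> d\<theta>])
    then have "((\<lambda>x. x) has_derivative (\<lambda>w. \<theta>' (\<kappa> y) (\<kappa>' y w))) (at y)"
      by (simp add: \<theta>\<kappa>)
    from has_derivative_unique [OF this has_derivative_ident] show ?thesis by metis
  qed
  define \<psi> where "\<psi> \<alpha> y = \<theta> (rot \<alpha> *v \<kappa> y)" for \<alpha> y
  have d\<psi>: "(\<psi> \<alpha> has_derivative (\<lambda>w. \<theta>' (rot \<alpha> *v \<kappa> y) (rot \<alpha> *v \<kappa>' y w))) (at y)" for \<alpha> y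
    unfolding \<psi>_def
    by (rule has_derivative_compose [OF has_derivative_compose [OF d\<kappa> bounded_linear_imp_has_derivative] d\<theta>])
      (rule matrix_vector_mul_bounded_linear)
  \<comment> \<open>The invariance of the metric makes the derivative of
    \<open>\<psi> \<alpha>\<close> preserve norms, because \<open>\<theta>'\<close> and
    \<open>\<kappa>'\<close> cancel.\<close>
  have lip: "norm (\<psi> \<alpha> x - \<psi> \<alpha> y) \<le> norm (x - y)" for \<alpha> x y
  proof -
    have "norm (\<psi> \<alpha> x - \<psi> \<alpha> y) \<le> 1 * norm (x - y)"
    proof (rule differentiable_bound [OF convex_UNIV])
      show "(\<psi> \<alpha> has_derivative (\<lambda>w. \<theta>' (rot \<alpha> *v \<kappa> y) (rot \<alpha> *v \<kappa>' y w))) (at y within UNIV)" for y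
        using d\<psi> by simp
      show "onorm (\<lambda>w. \<theta>' (rot \<alpha> *v \<kappa> y) (rot \<alpha> *v \<kappa>' y w)) \<le> 1" for y
        by (intro onorm_le) (simp add: inv \<theta>'\<kappa>')
    qed auto
    then show ?thesis by simp
  qed
  have \<psi>add: "\<psi> (\<alpha> + \<beta>) x = \<psi> \<alpha> (\<psi> \<beta> x)" for \<alpha> \<beta> x
    by (simp add: \<psi>_def rot_add \<kappa>\<theta>)
  have \<psi>0: "\<psi> 0 x = x" for x by (simp add: \<psi>_def \<theta>\<kappa>)
  \<comment> \<open>The reverse inequality comes from the inverse map, which belongs to the opposite
    angle.\<close>
  have isom: "norm (\<psi> \<alpha> x - \<psi> \<alpha> y) = norm (x - y)" for \<alpha> x y
    using lip [of \<alpha> x y] lip [of "- \<alpha>" "\<psi> \<alpha> x" "\<psi> \<alpha> y"] by (simp add: \<psi>add [symmetric] \<psi>0)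
  have \<kappa>0: "\<kappa> 0 = 0" using \<kappa>\<theta> \<theta>0 by metis
  have orth: "orthogonal_transformation (\<psi> \<alpha>)" for \<alpha>
    unfolding orthogonal_transformation_isometry using isom by (simp add: dist_norm \<psi>_def \<kappa>0 \<theta>0)
  have "\<exists>\<beta>. \<forall>x. \<psi> \<alpha> x = rot \<beta> *v x" for \<alpha>
  proof -
    \<comment> \<open>The half angle is used because the square of an orthogonal matrix has
      determinant 1.\<close>
    let ?H = "matrix (\<psi> (\<alpha> / 2))"
    have o: "orthogonal_matrix ?H"
      using orth orthogonal_transformation_matrix by blast
    have H: "\<psi> (\<alpha> / 2) x = ?H *v x" for x
      using orth [of "\<alpha> / 2"] by (simp add: orthogonal_transformation_linear matrix_works)
    have "\<psi> \<alpha> x = (?H ** ?H) *v x" for x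
      using \<psi>add [of "\<alpha> / 2" "\<alpha> / 2" x] by (simp add: H [symmetric] matrix_vector_mul_assoc [symmetric])
    moreover have "rotation_matrix (?H ** ?H)"
      unfolding rotation_matrix_def
      using orthogonal_matrix_mul [OF o o] det_orthogonal_matrix [OF o] by (auto simp: det_mul)
    ultimately show ?thesis by (metis rotation_matrixE)
  qed
  then obtain \<beta> where \<beta>: "\<And>\<alpha> x. \<psi> \<alpha> x = rot (\<beta> \<alpha>) *v x" by metis
  have \<theta>rot: "\<theta> (rot \<alpha> *v x) = rot (\<beta> \<alpha>) *v \<theta> x" for \<alpha> x
    using \<beta> [of \<alpha> "\<theta> x"] by (simp add: \<psi>_def \<kappa>\<theta>)
  \<comment> \<open>The angles \<open>\<beta> \<alpha>\<close> are chosen pointwise and need not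
    depend continuously on \<open>\<alpha>\<close>; the unit complex number is independent of that
    choice.\<close>
  define z where "z \<alpha> = cis (\<beta> \<alpha>)" for \<alpha>
  define y where "y = cpx (\<theta> ?e)"
  have y: "y \<noteq> 0" using nz [of ?e] by (simp add: y_def)
  have zc: "cpx (\<theta> (rot \<alpha> *v x)) = z \<alpha> * cpx (\<theta> x)" for \<alpha> x
    by (simp add: \<theta>rot cpx_rot z_def)
  have zadd: "z (a + b) = z a * z b" for a b
    using zc [of "a + b" ?e] zc [of a "rot b *v ?e"] zc [of b ?e] y by (simp add: rot_add y_def)
  have z0: "z 0 = 1" using zc [of 0 ?e] y by (simp add: y_def)
  \<comment> \<open>\<open>z\<close> is the image under \<open>\<theta>\<close> of the orbit of a
    unit vector, divided by its starting point, so it inherits differentiability.\<close>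
  have "\<exists>c. (z has_vector_derivative c) (at 0)"
  proof -
    have "((\<lambda>\<alpha>. rot \<alpha> *v ?e) has_derivative (\<lambda>h. vector [0, h])) (at 0)"
    proof -
      have eq: "(\<lambda>\<alpha>. rot \<alpha> *v ?e) = (\<lambda>\<alpha>. cos \<alpha> *\<^sub>R ?e + sin \<alpha> *\<^sub>R axis 2 1)"
        by (auto simp: fun_eq_iff vec_eq_iff forall_2 rot_def matrix_vector_mult_def sum_2 axis_def)
      have "((\<lambda>\<alpha>. cos \<alpha> *\<^sub>R ?e + sin \<alpha> *\<^sub>R axis 2 1) has_derivative (\<lambda>h. h *\<^sub>R axis 2 1)) (at 0)"
        by (auto intro!: derivative_eq_intros)
      moreover have "(\<lambda>h. h *\<^sub>R axis 2 1) = (\<lambda>h. vector [0, h] :: real ^ 2)"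
        by (auto simp: fun_eq_iff vec_eq_iff forall_2 axis_def)
      ultimately show ?thesis by (simp add: eq)
    qed
    from has_derivative_compose [OF this d\<theta>]
    have "((\<lambda>\<alpha>. \<theta> (rot \<alpha> *v ?e)) has_derivative (\<lambda>h. \<theta>' (rot 0 *v ?e) (vector [0, h]))) (at 0)" .
    moreover have "bounded_linear (\<lambda>v. cpx v / y)"
    proof (rule linear_conv_bounded_linear [THEN iffD1], rule linearI)
      show "cpx (a + b) / y = cpx a / y + cpx b / y" for a b
        by (simp add: cpx_add add_divide_distrib)
      show "cpx (r *\<^sub>R a) / y = r *\<^sub>R (cpx a / y)" for r a
        by (simp only: cpx_scaleR) (simp add: scaleR_conv_of_real)
    qed
    ultimately have "((\<lambda>\<alpha>. cpx (\<theta> (rot \<alpha> *v ?e)) / y) has_derivative (\<lambda>h. cpx (\<theta>' (rot 0 *v ?e) (vector [0, h])) / y)) (at 0)"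
      using bounded_linear.has_derivative by blast
    moreover have "(\<lambda>\<alpha>. cpx (\<theta> (rot \<alpha> *v ?e)) / y) = z"
      using y by (auto simp: zc y_def)
    ultimately have "z differentiable (at 0)"
      by (auto simp: differentiable_def)
    then show ?thesis by (simp add: vector_derivative_works) blast
  qed
  then obtain c where c: "(z has_vector_derivative c) (at 0)" by blast
  have zexp: "z x = exp (c * of_real x)" for x
    by (rule multiplicative_eq_exp [OF zadd c z0])
  have "cmod (z 1) = 1" by (simp add: z_def)
  \<comment> \<open>Modulus 1 makes the exponent imaginary; the period \<open>2 * pi\<close> then
    makes it an integer multiple of the imaginary unit.\<close>
  then have Rec: "Re c = 0" by (simp add: zexp norm_exp_eq_Re)
  have rot2pi: "rot (2 * pi) *v x = x" for x
    by (simp only: cpx_eq_iff [symmetric] cpx_rot) simp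
  have "z (2 * pi) = 1" using zc [of "2 * pi" ?e] y by (simp add: rot2pi y_def)
  then obtain n :: int where n: "Im c = of_int n"
    using Rec by (auto simp: zexp exp_eq_1)
  have zcis: "z x = cis (of_int n * x)" for x
    unfolding zexp cis_conv_exp using Rec n by (intro arg_cong [where f = exp]) (simp add: complex_eq_iff)
  have \<theta>rot': "\<theta> (rot \<alpha> *v x) = rot (of_int n * \<alpha>) *v \<theta> x" for \<alpha> x
    by (simp only: cpx_eq_iff [symmetric] zc zcis cpx_rot)
  have "n \<in> {1, - 1}"
  proof (rule ccontr)
    assume "n \<notin> {1, - 1}"
    \<comment> \<open>A nontrivial angle in the kernel of \<open>z\<close>: for \<open>n = 0\<close>
      every angle is, and otherwise the absolute value of \<open>n\<close> is at least 2, which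
      keeps the angle at most \<open>pi\<close>.\<close>
    define \<alpha> where "\<alpha> = (if n = 0 then pi else 2 * pi / \<bar>of_int n\<bar>)"
    have a: "0 < \<alpha>" "\<alpha> \<le> pi" "z \<alpha> = 1"
    proof -
      have "n = 0 \<or> 2 \<le> \<bar>n\<bar>" using \<open>n \<notin> {1, - 1}\<close> by auto
      then have n2: "n = 0 \<or> 2 \<le> \<bar>real_of_int n\<bar>" by linarith
      then show "0 < \<alpha>" "\<alpha> \<le> pi" by (auto simp: \<alpha>_def field_simps)
      have "real_of_int n * \<alpha> = 0 \<or> real_of_int n * \<alpha> = 2 * pi \<or> real_of_int n * \<alpha> = - (2 * pi)"
        by (cases n "0 :: int" rule: linorder_cases) (auto simp: \<alpha>_def)
      then show "z \<alpha> = 1" by (auto simp: zcis complex_eq_iff)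
    qed
    have "\<theta> (rot \<alpha> *v ?e) = \<theta> ?e"
      using zc [of \<alpha> ?e] a(3) by simp
    then have "rot \<alpha> *v ?e = ?e" by (rule inj)
    then have "cis \<alpha> * cpx ?e = cpx ?e" by (metis cpx_rot)
    then have "cos \<alpha> = 1" using cpx_e1 [of 1] by (simp add: complex_eq_iff)
    moreover have "cos \<alpha> < cos 0" using a by (intro cos_monotone_0_pi) auto
    ultimately show False by simp
  qed
  then show ?thesis
    using spiral_deformationI [OF bij C1_Lip_continuous [OF \<theta>] \<theta>0 _ \<theta>rot'] by blast
qed

section \<open>Excursion sets on segments\<close>

text \<open>The mesh \<open>n\<close> and the number \<open>k\<close> of intervals inspected are
  separate, so that induction can run along a fixed subdivision.\<close>

definition upcrossings :: "('a::real_vector \<Rightarrow> real) \<Rightarrow> 'a \<Rightarrow> 'a \<Rightarrow> nat \<Rightarrow> nat \<Rightarrow> nat set" where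
  "upcrossings f a b n k = {j. j < k \<and> f (a + (real j / real n) *\<^sub>R (b - a)) < 0 \<and> 0 \<le> f (a + (real (Suc j) / real n) *\<^sub>R (b - a))}"

lemma upcrossings_Suc:
  "upcrossings f a b n (Suc k) = (if f (a + (real k / real n) *\<^sub>R (b - a)) < 0 \<and> 0 \<le> f (a + (real (Suc k) / real n) *\<^sub>R (b - a))
     then insert k (upcrossings f a b n k) else upcrossings f a b n k)"
  by (auto simp: upcrossings_def less_Suc_eq)

lemma finite_upcrossings: "finite (upcrossings f a b n k)"
  by (simp add: upcrossings_def)

text \<open>The sum of the absolute values of \<open>Y\<close> and \<open>Y'\<close> has a positive
  minimum. At a zero of \<open>Y\<close> it equals that of \<open>Y'\<close>, and uniform continuity
  keeps \<open>Y'\<close> nonzero nearby.\<close>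

lemma no_critical_zero_small_intervals:
  fixes Y Y' :: "real \<Rightarrow> real"
  assumes Y: "\<And>s. (Y has_real_derivative Y' s) (at s)" and Y': "continuous_on UNIV Y'"
    and reg: "\<And>s. s \<in> {0..1} \<Longrightarrow> Y s = 0 \<Longrightarrow> Y' s \<noteq> 0"
  obtains \<delta> where "\<delta> > 0" "\<And>l r. 0 \<le> l \<Longrightarrow> l \<le> r \<Longrightarrow> r \<le> 1 \<Longrightarrow> r - l < \<delta> \<Longrightarrow>
     (\<forall>s\<in>{l..r}. Y s \<noteq> 0) \<or> (\<forall>s\<in>{l..r}. Y' s \<noteq> 0)"
proof -
  have contY: "continuous_on S Y" for S
    using Y by (meson DERIV_isCont continuous_at_imp_continuous_on)
  have contY': "continuous_on S Y'" for S
    using Y' continuous_on_subset by blast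
  have "\<exists>x\<in>{0..1}. \<forall>y\<in>{0..1}. \<bar>Y x\<bar> + \<bar>Y' x\<bar> \<le> \<bar>Y y\<bar> + \<bar>Y' y\<bar>"
    by (intro continuous_attains_inf continuous_intros contY contY') auto
  then obtain x where x: "x \<in> {0..1}" "\<And>y. y \<in> {0..1} \<Longrightarrow> \<bar>Y x\<bar> + \<bar>Y' x\<bar> \<le> \<bar>Y y\<bar> + \<bar>Y' y\<bar>"
    by blast
  define \<eta> where "\<eta> = \<bar>Y x\<bar> + \<bar>Y' x\<bar>"
  have \<eta>: "\<eta> > 0" using reg [OF x(1)] by (cases "Y x = 0") (auto simp: \<eta>_def)
  have "uniformly_continuous_on {0..1} Y'"
    by (intro compact_uniformly_continuous contY') auto
  then obtain \<delta> where \<delta>: "\<delta> > 0" "\<And>s t. s \<in> {0..1} \<Longrightarrow> t \<in> {0..1} \<Longrightarrow> \<bar>t - s\<bar> < \<delta> \<Longrightarrow> \<bar>Y' t - Y' s\<bar> < \<eta>"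
    using \<eta> unfolding uniformly_continuous_on_def dist_real_def by metis
  have "\<forall>s\<in>{l..r}. Y' s \<noteq> 0"
    if lr: "0 \<le> l" "l \<le> r" "r \<le> 1" "r - l < \<delta>" and s0: "s0 \<in> {l..r}" "Y s0 = 0" for l r s0
  proof
    fix s assume s: "s \<in> {l..r}"
    have "\<eta> \<le> \<bar>Y' s0\<bar>" using x(2) [of s0] s0 lr by (auto simp: \<eta>_def)
    moreover have "\<bar>Y' s - Y' s0\<bar> < \<eta>" using \<delta>(2) [of s0 s] s s0 lr by auto
    ultimately show "Y' s \<noteq> 0" by auto
  qed
  then show ?thesis
    using that [OF \<delta>(1)] by blast
qed

text \<open>A violation of either claim would produce slopes of both signs and a zero of
  \<open>Y\<close> in the interval, against both alternatives of the hypothesis.\<close>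

lemma excursion_small_interval:
  fixes Y Y' :: "real \<Rightarrow> real"
  assumes Y: "\<And>s. (Y has_real_derivative Y' s) (at s)" and Y': "continuous_on UNIV Y'"
    and nz: "(\<forall>s\<in>{l..r}. Y s \<noteq> 0) \<or> (\<forall>s\<in>{l..r}. Y' s \<noteq> 0)"
  shows "convex {s \<in> {l..r}. Y s \<ge> 0}"
    and "Y l < 0 \<Longrightarrow> Y r < 0 \<Longrightarrow> {s \<in> {l..r}. Y s \<ge> 0} = {}"
proof -
  have contY: "continuous_on S Y" for S
    using Y by (meson DERIV_isCont continuous_at_imp_continuous_on)
  have contY': "continuous_on S Y'" for S
    using Y' continuous_on_subset by blast
  have mvt: "\<exists>z>x. z < y \<and> Y y - Y x = (y - x) * Y' z" if "x < y" for x y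
    using MVT2 [of x y Y Y'] that Y by blast
  have sgn: False if "\<xi>1 \<in> {l..r}" "\<xi>2 \<in> {l..r}" "Y' \<xi>1 > 0" "Y' \<xi>2 < 0" "x \<in> {l..r}" "Y x = 0" for \<xi>1 \<xi>2 x
  proof -
    have "connected (Y' ` {l..r})"
      by (intro connected_continuous_image contY') auto
    then have "0 \<in> Y' ` {l..r}"
      using that unfolding connected_iff_interval by (meson image_eqI less_imp_le)
    then show False using nz that by auto
  qed
  have zero: "\<exists>x\<in>{l..r}. Y x = 0" if "a \<in> {l..r}" "b \<in> {l..r}" "Y a \<ge> 0" "Y b < 0" for a b
  proof -
    have "connected (Y ` {l..r})"
      by (intro connected_continuous_image contY) auto
    then have "0 \<in> Y ` {l..r}"
      using that unfolding connected_iff_interval by (meson image_eqI less_imp_le)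
    then show ?thesis by auto
  qed
  have "is_interval {s \<in> {l..r}. Y s \<ge> 0}"
    unfolding is_interval_1
  proof (intro ballI allI impI, rule ccontr)
    fix x z y assume x: "x \<in> {s \<in> {l..r}. Y s \<ge> 0}" and z: "z \<in> {s \<in> {l..r}. Y s \<ge> 0}"
      and y: "x \<le> y \<and> y \<le> z" "y \<notin> {s \<in> {l..r}. Y s \<ge> 0}"
    then have Yy: "Y y < 0" "x < y" "y < z" by (auto simp: less_le)
    obtain \<xi>1 \<xi>2 where "x < \<xi>1" "\<xi>1 < y" "Y y - Y x = (y - x) * Y' \<xi>1" "y < \<xi>2" "\<xi>2 < z" "Y z - Y y = (z - y) * Y' \<xi>2"
      using mvt [OF Yy(2)] mvt [OF Yy(3)] by blast
    moreover have "(y - x) * Y' \<xi>1 < 0" "(z - y) * Y' \<xi>2 > 0"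
      using x z Yy calculation by auto
    ultimately have "Y' \<xi>1 < 0" "Y' \<xi>2 > 0" "\<xi>1 \<in> {l..r}" "\<xi>2 \<in> {l..r}"
      using Yy x z by (auto simp: mult_less_0_iff zero_less_mult_iff)
    moreover obtain s where "s \<in> {l..r}" "Y s = 0"
      using zero [of x y] x y z Yy by auto
    ultimately show False using sgn by blast
  qed
  then show "convex {s \<in> {l..r}. Y s \<ge> 0}"
    by (simp add: is_interval_convex)
  show "{s \<in> {l..r}. Y s \<ge> 0} = {}" if Yl: "Y l < 0" "Y r < 0"
  proof (rule ccontr)
    assume "{s \<in> {l..r}. Y s \<ge> 0} \<noteq> {}"
    then obtain y where y: "y \<in> {l..r}" "Y y \<ge> 0" by blast
    then have lyr: "l < y" "y < r" using Yl by (auto simp: less_le)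
    obtain \<xi>1 \<xi>2 where "l < \<xi>1" "\<xi>1 < y" "Y y - Y l = (y - l) * Y' \<xi>1" "y < \<xi>2" "\<xi>2 < r" "Y r - Y y = (r - y) * Y' \<xi>2"
      using mvt [OF lyr(1)] mvt [OF lyr(2)] by blast
    moreover have "(y - l) * Y' \<xi>1 > 0" "(r - y) * Y' \<xi>2 < 0"
      using y Yl calculation by auto
    ultimately have "Y' \<xi>1 > 0" "Y' \<xi>2 < 0" "\<xi>1 \<in> {l..r}" "\<xi>2 \<in> {l..r}"
      using lyr by (auto simp: mult_less_0_iff zero_less_mult_iff)
    moreover obtain s where "s \<in> {l..r}" "Y s = 0"
      using zero [of y l] y Yl lyr by auto
    ultimately show False using sgn by blast
  qed
qed

text \<open>Passing to the next subinterval either adds nothing, extends the component that ends at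
  the common endpoint, or opens a new component; the last happens exactly at an upcrossing.\<close>

lemma excursion_components:
  fixes Y :: "real \<Rightarrow> real"
  assumes contY: "continuous_on UNIV Y" and n: "n \<ge> 1"
    and conv: "\<And>k. k < n \<Longrightarrow> convex {s \<in> {real k / real n..real (Suc k) / real n}. Y s \<ge> 0}"
    and emp: "\<And>k. k < n \<Longrightarrow> Y (real k / real n) < 0 \<Longrightarrow> Y (real (Suc k) / real n) < 0 \<Longrightarrow>
       {s \<in> {real k / real n..real (Suc k) / real n}. Y s \<ge> 0} = {}"
  shows "k \<le> n \<Longrightarrow> \<exists>\<C>. finite \<C> \<and> disjoint \<C> \<and> (\<forall>C\<in>\<C>. closed C \<and> convex C \<and> C \<noteq> {}) \<and>
     \<Union>\<C> = {s \<in> {0..real k / real n}. Y s \<ge> 0} \<and>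
     card \<C> = (if Y 0 \<ge> 0 then 1 else 0) + card (upcrossings Y 0 1 n k)"
proof (induction k)
  case 0
  show ?case
  proof (cases "Y 0 \<ge> 0")
    case True
    then show ?thesis
      by (intro exI [of _ "{{0}}"]) (auto simp: upcrossings_def)
  next
    case False
    then show ?thesis
      by (intro exI [of _ "{}"]) (auto simp: upcrossings_def)
  qed
next
  case (Suc k)
  then obtain \<C> where fin: "finite \<C>" and disj: "disjoint \<C>" and C: "\<And>C. C \<in> \<C> \<Longrightarrow> closed C \<and> convex C \<and> C \<noteq> {}"
    and U: "\<Union>\<C> = {s \<in> {0..real k / real n}. Y s \<ge> 0}"
    and card: "card \<C> = (if Y 0 \<ge> 0 then 1 else 0) + card (upcrossings Y 0 1 n k)"
    by auto
  define l where "l = real k / real n"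
  define r where "r = real (Suc k) / real n"
  have lr: "0 \<le> l" "l < r" using n by (auto simp: l_def r_def divide_strict_right_mono)
  define J where "J = {s \<in> {l..r}. Y s \<ge> 0}"
  have kn: "k < n" using Suc.prems by simp
  have convJ: "convex J" using conv [OF kn] by (simp add: J_def l_def r_def)
  have "J = {l..r} \<inter> {s. 0 \<le> Y s}" by (auto simp: J_def)
  then have closedJ: "closed J"
    by (simp add: closed_Collect_le contY continuous_intros closed_Int)
  have UJ: "\<Union>\<C> \<union> J = {s \<in> {0..r}. Y s \<ge> 0}"
    using lr by (auto simp: U J_def l_def [symmetric])
  have Cl: "C \<subseteq> {0..l}" if "C \<in> \<C>" for C
    using that U by (auto simp: l_def)
  have up: "upcrossings Y 0 1 n (Suc k) = (if Y l < 0 \<and> 0 \<le> Y r then insert k (upcrossings Y 0 1 n k) else upcrossings Y 0 1 n k)"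
    using upcrossings_Suc [of Y 0 1 n k] by (simp add: l_def r_def)
  have knot: "k \<notin> upcrossings Y 0 1 n k" by (simp add: upcrossings_def)
  consider "J = {}" | "J \<noteq> {}" "Y l \<ge> 0" | "J \<noteq> {}" "Y l < 0" by linarith
  then show ?case
  proof cases
    case 1
    then have "r \<notin> J" by simp
    then have "Y r < 0" using lr by (simp add: J_def)
    with 1 U card fin disj C UJ up show ?thesis
      by (intro exI [of _ \<C>]) (auto simp: r_def)
  next
    \<comment> \<open>The new piece contains \<open>l\<close> and is merged with the component
      \<open>D\<close> containing \<open>l\<close>; the count is unchanged.\<close>
    case 2
    then have "l \<in> \<Union>\<C>" using lr by (simp add: U l_def [symmetric])
    then obtain D where D: "D \<in> \<C>" "l \<in> D" by blast
    have "l \<in> J" using 2 lr by (simp add: J_def)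
    have "connected (D \<union> J)"
      using D \<open>l \<in> J\<close> C convJ by (intro connected_Un convex_connected) auto
    then have convDJ: "convex (D \<union> J)"
      by (simp add: is_interval_connected_1 [symmetric] is_interval_convex)
    have disjD: "disjnt C (D \<union> J)" if "C \<in> \<C>" "C \<noteq> D" for C
    proof -
      have "disjnt C D" using disj that D(1) by (auto simp: pairwise_def)
      moreover have "x = l" if "x \<in> C" "x \<in> J" for x
        using Cl [OF \<open>C \<in> \<C>\<close>] that by (auto simp: J_def)
      ultimately show ?thesis using D(2) by (auto simp: disjnt_iff)
    qed
    have notin: "D \<union> J \<notin> \<C> - {D}"
    proof
      assume "D \<union> J \<in> \<C> - {D}"
      then have "disjnt (D \<union> J) (D \<union> J)" using disjD by blast
      then show False using D by (auto simp: disjnt_iff)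
    qed
    let ?\<C> = "insert (D \<union> J) (\<C> - {D})"
    have "finite ?\<C>" using fin by simp
    moreover have "disjoint ?\<C>"
      using disj disjD by (auto simp: pairwise_insert disjnt_sym intro: pairwise_subset)
    moreover have "\<forall>C\<in>?\<C>. closed C \<and> convex C \<and> C \<noteq> {}"
      using C D closedJ convDJ 2 by auto
    moreover have "\<Union>?\<C> = {s \<in> {0..r}. Y s \<ge> 0}"
      unfolding UJ [symmetric] using D(1) by auto
    moreover have "card ?\<C> = card \<C>"
      using card_insert_disjoint [OF finite_Diff [OF fin] notin] card_Suc_Diff1 [OF fin D(1)] by simp
    ultimately show ?thesis
      using card up 2 by (intro exI [of _ ?\<C>]) (auto simp: r_def)
  next
    case 3
    \<comment> \<open>The emptiness hypothesis turns a nonempty piece starting below 0 into an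
      upcrossing.\<close>
    have Yr: "Y r \<ge> 0"
    proof (rule ccontr)
      assume "\<not> Y r \<ge> 0"
      then have "J = {}"
        using emp [OF kn] 3(2) unfolding J_def l_def r_def by simp
      then show False using 3(1) by simp
    qed
    have disjJ: "disjnt C J" if "C \<in> \<C>" for C
    proof -
      have "x = l" if "x \<in> C" "x \<in> J" for x
        using Cl [OF \<open>C \<in> \<C>\<close>] that by (auto simp: J_def)
      moreover have "l \<notin> J" using 3 by (simp add: J_def)
      ultimately show ?thesis unfolding disjnt_iff by blast
    qed
    have "J \<notin> \<C>" using disjJ [of J] 3 by (auto simp: disjnt_def)
    then have "card (insert J \<C>) = Suc (card \<C>)" using fin by simp
    moreover have "disjoint (insert J \<C>)"
      using disj disjJ by (auto simp: pairwise_insert disjnt_sym)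
    ultimately show ?thesis
      using card up 3 Yr knot fin C closedJ convJ UJ
      by (intro exI [of _ "insert J \<C>"]) (auto simp: r_def finite_upcrossings)
  qed
qed

text \<open>On a fine subdivision of the parameter interval the components are exactly those counted
  by \<open>excursion_components\<close>; an injective affine map carries them to the
  segment.\<close>

lemma euler_characteristic_segment:
  fixes f :: "'a::euclidean_space \<Rightarrow> real"
  assumes f: "C1_Lip f f'" and ab: "a \<noteq> b"
    and reg: "\<And>t. t \<in> closed_segment a b \<Longrightarrow> f t = 0 \<Longrightarrow> f' t (b - a) \<noteq> 0"
  shows "\<exists>n0. \<forall>n\<ge>n0. euler_characteristic (top_of_set {t \<in> closed_segment a b. f t \<ge> 0}) =
     int ((if f a \<ge> 0 then 1 else 0) + card (upcrossings f a b n n))"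
proof -
  define \<gamma> where "\<gamma> s = a + s *\<^sub>R (b - a)" for s
  define Y where "Y s = f (\<gamma> s)" for s
  define Y' where "Y' s = f' (\<gamma> s) (b - a)" for s
  have seg: "closed_segment a b = \<gamma> ` {0..1}"
    by (auto simp: closed_segment_image_interval \<gamma>_def algebra_simps image_def)
  have d: "(Y has_real_derivative Y' s) (at s)" for s
  proof -
    have "(\<gamma> has_derivative (\<lambda>h. h *\<^sub>R (b - a))) (at s)"
      unfolding \<gamma>_def by (auto intro!: derivative_eq_intros)
    from has_derivative_compose [OF this C1_Lip_has_derivative [OF f, of _ UNIV]]
    have "(Y has_derivative (\<lambda>h. f' (\<gamma> s) (h *\<^sub>R (b - a)))) (at s)"
      by (simp add: Y_def [abs_def])
    then show ?thesis
      by (simp add: has_field_derivative_def Y'_def blinfun.scaleR_right mult_commute_abs)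
  qed
  have cont\<gamma>: "continuous_on S \<gamma>" for S
    unfolding \<gamma>_def by (intro continuous_intros)
  have cont: "continuous_on UNIV Y'"
    unfolding Y'_def
    by (intro continuous_intros continuous_on_compose2 [OF C1_Lip_continuous_deriv [OF f, of UNIV] cont\<gamma>]) auto
  have contY: "continuous_on UNIV Y"
    using d by (meson DERIV_isCont continuous_at_imp_continuous_on)
  have reg': "Y' s \<noteq> 0" if "s \<in> {0..1}" "Y s = 0" for s
    using reg [of "\<gamma> s"] that by (auto simp: seg Y_def Y'_def)
  obtain \<delta> where \<delta>: "\<delta> > 0" "\<And>l r. 0 \<le> l \<Longrightarrow> l \<le> r \<Longrightarrow> r \<le> 1 \<Longrightarrow> r - l < \<delta> \<Longrightarrow>
     (\<forall>s\<in>{l..r}. Y s \<noteq> 0) \<or> (\<forall>s\<in>{l..r}. Y' s \<noteq> 0)"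
    using no_critical_zero_small_intervals [OF d cont reg'] by metis
  obtain n0 where n0: "inverse (real (Suc n0)) < \<delta>"
    using reals_Archimedean [OF \<delta>(1)] by blast
  have inj: "inj \<gamma>" using ab by (auto simp: inj_def \<gamma>_def)
  show ?thesis
  proof (intro exI [of _ "Suc n0"] allI impI)
    fix n assume n: "Suc n0 \<le> n"
    have "inverse (real n) \<le> inverse (real (Suc n0))"
      using n by (intro le_imp_inverse_le) auto
    then have n': "1 / real n < \<delta>" using n0 by (simp add: inverse_eq_divide)
    have nz: "(\<forall>s\<in>{real k / real n..real (Suc k) / real n}. Y s \<noteq> 0) \<or>
       (\<forall>s\<in>{real k / real n..real (Suc k) / real n}. Y' s \<noteq> 0)" if "k < n" for k
    proof (rule \<delta>(2))
      have "real (Suc k) / real n - real k / real n = 1 / real n"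
        by (simp add: diff_divide_distrib [symmetric])
      then show "real (Suc k) / real n - real k / real n < \<delta>" using n' by simp
      show "real (Suc k) / real n \<le> 1" using that by simp
    qed (auto simp: divide_right_mono)
    have n1: "n \<ge> 1" using n by simp
    from excursion_components [OF contY n1 excursion_small_interval [OF d cont nz] order_refl]
    obtain \<C> where fin: "finite \<C>" and disj: "disjoint \<C>" and C: "\<And>C. C \<in> \<C> \<Longrightarrow> closed C \<and> convex C \<and> C \<noteq> {}"
      and U: "\<Union>\<C> = {s \<in> {0..real n / real n}. Y s \<ge> 0}"
      and card: "card \<C> = (if Y 0 \<ge> 0 then 1 else 0) + card (upcrossings Y 0 1 n n)"
      by auto
    have U': "\<Union>\<C> = {s \<in> {0..1}. Y s \<ge> 0}" using U n1 by simp
    let ?\<C> = "(\<lambda>C. \<gamma> ` C) ` \<C>"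
    have "{t \<in> closed_segment a b. f t \<ge> 0} = \<gamma> ` {s \<in> {0..1}. Y s \<ge> 0}"
      by (auto simp: seg Y_def)
    also have "\<dots> = \<Union>?\<C>"
      unfolding U' [symmetric] by blast
    finally have eq: "{t \<in> closed_segment a b. f t \<ge> 0} = \<Union>?\<C>" .
    have "euler_characteristic (top_of_set (\<Union>?\<C>)) = int (card ?\<C>)"
    proof (rule euler_characteristic_Union_convex)
      show "finite ?\<C>" using fin by simp
      show "disjoint ?\<C>"
      proof (rule pairwiseI)
        fix D E assume "D \<in> ?\<C>" "E \<in> ?\<C>" "D \<noteq> E"
        then obtain D' E' where DE: "D' \<in> \<C>" "E' \<in> \<C>" "D = \<gamma> ` D'" "E = \<gamma> ` E'" by blast
        with \<open>D \<noteq> E\<close> have "disjnt D' E'" using disj by (metis pairwiseD)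
        then show "disjnt D E" unfolding DE by (auto simp: disjnt_iff dest: injD [OF inj])
      qed
      fix D assume "D \<in> ?\<C>"
      then obtain C' where C': "C' \<in> \<C>" "D = \<gamma> ` C'" by blast
      have "C' \<subseteq> {0..1}" using C'(1) U' by blast
      then have "compact C'"
        using C [OF C'(1)] compact_Int_closed [of "{0..1}" C'] by (simp add: Int_absorb1)
      then have "compact D" unfolding C'(2) by (intro compact_continuous_image cont\<gamma>)
      moreover have "convex D"
      proof -
        have "D = (\<lambda>x. a + x) ` (\<lambda>s. s *\<^sub>R (b - a)) ` C'" by (auto simp: C'(2) \<gamma>_def image_image)
        moreover have "linear (\<lambda>s. s *\<^sub>R (b - a))" by (intro linearI) (auto simp: algebra_simps)
        ultimately show ?thesis
          using C [OF C'(1)] by (simp add: convex_translation convex_linear_image)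
      qed
      ultimately show "closed D \<and> convex D \<and> D \<noteq> {}"
        using C C' by (auto simp: compact_imp_closed)
    qed
    also have "card ?\<C> = card \<C>"
      by (intro card_image inj_onI) (simp add: inj_image_eq_iff [OF inj])
    also have "card \<C> = (if f a \<ge> 0 then 1 else 0) + card (upcrossings f a b n n)"
      unfolding card by (simp add: Y_def \<gamma>_def upcrossings_def)
    finally show "euler_characteristic (top_of_set {t \<in> closed_segment a b. f t \<ge> 0}) =
       int ((if f a \<ge> 0 then 1 else 0) + card (upcrossings f a b n n))"
      unfolding eq .
  qed
qed

section \<open>Mean Euler characteristic on segments\<close>

lemma sum_lessThan_double: "(\<Sum>j<2 * n. g j) = (\<Sum>k<n. g (2 * k) + g (Suc (2 * k)))"
  for g :: "nat \<Rightarrow> 'a::comm_monoid_add"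
  by (induction n) (auto simp: ac_simps)

text \<open>Whatever the sign at the midpoint, an upcrossing of an interval is inherited by one of
  its halves.\<close>

lemma upcrossings_double:
  "card (upcrossings f a b n n) \<le> card (upcrossings f a b (2 * n) (2 * n))"
proof -
  define g where "g m j = (of_bool (f (a + (real j / real m) *\<^sub>R (b - a)) < 0 \<and> 0 \<le> f (a + (real (Suc j) / real m) *\<^sub>R (b - a))) :: nat)" for m j
  have card: "card (upcrossings f a b m m) = (\<Sum>j<m. g m j)" for m
    by (auto simp: upcrossings_def g_def sum.If_cases of_bool_def Int_def intro!: arg_cong [where f = card])
  have "g n k \<le> g (2 * n) (2 * k) + g (2 * n) (Suc (2 * k))" for k
  proof -
    have "real (2 * k) / real (2 * n) = real k / real n" "real (Suc (Suc (2 * k))) / real (2 * n) = real (Suc k) / real n"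
    proof -
      have e: "real (Suc (Suc (2 * k))) = 2 * real (Suc k)" "real (2 * k) = 2 * real k" "real (2 * n) = 2 * real n"
        by auto
      show "real (2 * k) / real (2 * n) = real k / real n" "real (Suc (Suc (2 * k))) / real (2 * n) = real (Suc k) / real n"
        unfolding e by (simp_all only: mult_divide_mult_cancel_left_if) simp_all
    qed
    then show ?thesis by (auto simp: g_def)
  qed
  then show ?thesis
    unfolding card sum_lessThan_double by (intro sum_mono)
qed

lemma closed_segment_rectangle: "rectangle (closed_segment x y)"
proof -
  obtain \<alpha> where \<alpha>: "y - x = rot \<alpha> *v (norm (y - x) *\<^sub>R axis 1 1)"
    using ex_rot by blast
  define a where "a = rot (- \<alpha>) *v x"
  have a: "rot \<alpha> *v a = x" by (simp add: a_def rot_add [symmetric])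
  have T: "closed_segment x y = (\<lambda>z. rot \<alpha> *v (z + a)) ` {z. z $ 1 \<in> closed_segment 0 (norm (y - x)) \<and> z $ 2 \<in> closed_segment 0 0}"
  proof (intro subset_antisym subsetI)
    fix t assume "t \<in> closed_segment x y"
    then obtain s where s: "0 \<le> s" "s \<le> 1" "t = x + s *\<^sub>R (y - x)"
      by (auto simp: in_segment algebra_simps)
    have "t = rot \<alpha> *v ((s * norm (y - x)) *\<^sub>R axis 1 1 + a)"
      unfolding s(3) by (subst \<alpha>) (simp add: matrix_vector_right_distrib a rot_scaleR [symmetric] add.commute)
    moreover have "s * norm (y - x) \<in> closed_segment 0 (norm (y - x))"
      using s by (auto simp: in_segment)
    ultimately show "t \<in> (\<lambda>z. rot \<alpha> *v (z + a)) ` {z. z $ 1 \<in> closed_segment 0 (norm (y - x)) \<and> z $ 2 \<in> closed_segment 0 0}"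
      by (intro image_eqI) (auto simp: axis_def)
  next
    fix t assume "t \<in> (\<lambda>z. rot \<alpha> *v (z + a)) ` {z. z $ 1 \<in> closed_segment 0 (norm (y - x)) \<and> z $ 2 \<in> closed_segment 0 0}"
    then obtain z where z: "t = rot \<alpha> *v (z + a)" "z $ 1 \<in> closed_segment 0 (norm (y - x))" "z $ 2 = 0"
      by auto
    then obtain s where s: "0 \<le> s" "s \<le> 1" "z $ 1 = s * norm (y - x)"
      by (auto simp: in_segment)
    have "z = s *\<^sub>R (norm (y - x) *\<^sub>R axis 1 1)"
      using z(3) s(3) by (simp add: vec_eq_iff forall_2 axis_def)
    then have "t = x + s *\<^sub>R (rot \<alpha> *v (norm (y - x) *\<^sub>R axis 1 1))"
      unfolding z(1) by (simp add: matrix_vector_right_distrib a rot_scaleR add.commute)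
    then have "t = x + s *\<^sub>R (y - x)" using \<alpha> by simp
    then show "t \<in> closed_segment x y"
      using s unfolding in_segment by (intro exI [of _ s]) (auto simp: algebra_simps)
  qed
  show ?thesis
    unfolding rectangle_def using T rotation_matrix_rot by blast
qed

context smooth_gaussian_field
begin

definition crossing_prob :: "real ^ 2 \<Rightarrow> real" where
  "crossing_prob h = prob {\<omega> \<in> space M. X 0 \<omega> < 0 \<and> 0 \<le> X h \<omega>}"

definition upper_prob :: real where
  "upper_prob = measure std_normal_distribution {0..}"

lemma prob_upper: "prob {\<omega> \<in> space M. 0 \<le> X t \<omega>} = upper_prob"
proof -
  have "upper_prob = measure (distr M borel (X t)) {0..}"
    by (simp only: X_law upper_prob_def)
  also have "\<dots> = prob {\<omega> \<in> space M. 0 \<le> X t \<omega>}"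
    by (subst measure_distr) (auto intro!: arg_cong [where f = prob])
  finally show ?thesis by simp
qed

text \<open>The counts on dyadic subdivisions increase to the Euler characteristic, so monotone
  convergence transfers bounds on the sums of crossing probabilities to the mean.\<close>

lemma mean_euler_segment:
  assumes \<eta>: "C1_Lip \<eta> \<eta>'" and ab: "a \<noteq> b"
    and bounds: "\<And>n. n \<ge> 1 \<Longrightarrow> (\<Sum>k<n. crossing_prob (\<eta> (a + (real (Suc k) / real n) *\<^sub>R (b - a)) - \<eta> (a + (real k / real n) *\<^sub>R (b - a)))) \<in> {A..B}"
  shows "mean_euler M (\<lambda>t. X (\<eta> t)) 0 (closed_segment a b) - upper_prob \<in> {A..B}"
proof -
  define p where "p m k = \<eta> (a + (real k / real (2 ^ m)) *\<^sub>R (b - a))" for m k :: nat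
  define f where "f m \<omega> = real ((if X (\<eta> a) \<omega> \<ge> 0 then 1 else 0) + card (upcrossings (\<lambda>t. X (\<eta> t) \<omega>) a b (2 ^ m) (2 ^ m)))" for m \<omega>
  define S where "S m = (\<Sum>k<2 ^ m. crossing_prob (p m (Suc k) - p m k))" for m
  have f_eq: "f m \<omega> = indicator {\<omega> \<in> space M. 0 \<le> X (\<eta> a) \<omega>} \<omega> +
      (\<Sum>k<2 ^ m. indicator {\<omega> \<in> space M. X (p m k) \<omega> < 0 \<and> 0 \<le> X (p m (Suc k)) \<omega>} \<omega>)"
    if "\<omega> \<in> space M" for m \<omega>
  proof -
    have "real (card (upcrossings (\<lambda>t. X (\<eta> t) \<omega>) a b (2 ^ m) (2 ^ m)))
      = (\<Sum>k<2 ^ m. if X (p m k) \<omega> < 0 \<and> 0 \<le> X (p m (Suc k)) \<omega> then 1 else 0)"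
      by (auto simp: sum.If_cases upcrossings_def p_def Int_def intro!: arg_cong [where f = card])
    also have "\<dots> = (\<Sum>k<2 ^ m. indicator {\<omega> \<in> space M. X (p m k) \<omega> < 0 \<and> 0 \<le> X (p m (Suc k)) \<omega>} \<omega>)"
      using that by (intro sum.cong) (auto simp: indicator_def)
    finally show ?thesis
      using that by (simp add: f_def indicator_def)
  qed
  define E where "E m k = {\<omega> \<in> space M. X (p m k) \<omega> < 0 \<and> 0 \<le> X (p m (Suc k)) \<omega>}" for m k
  define E0 where "E0 = {\<omega> \<in> space M. 0 \<le> X (\<eta> a) \<omega>}"
  have [measurable]: "E m k \<in> sets M" "E0 \<in> sets M" for m k
    unfolding E_def E0_def by measurable
  note f_eq = f_eq [folded E_def E0_def]
  have ind: "integrable M (indicator A :: _ \<Rightarrow> real)" "(LINT \<omega>|M. indicator A \<omega>) = prob A" if "A \<in> sets M" for A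
    using that by (auto simp: integrable_real_indicator less_top [symmetric] Int_absorb2 sets.sets_into_space)
  have f_meas [measurable]: "f m \<in> borel_measurable M" for m
    by (subst measurable_cong [OF f_eq]) auto
  have int_sum: "integrable M (\<lambda>\<omega>. \<Sum>k<2 ^ m. indicator (E m k) \<omega> :: real)" for m
    by (intro Bochner_Integration.integrable_sum ind) measurable
  have intf: "integrable M (f m)" for m
    by (subst Bochner_Integration.integrable_cong [OF refl f_eq])
      (auto intro!: Bochner_Integration.integrable_add int_sum ind)
  have Ef: "expectation (f m) = upper_prob + S m" for m
  proof -
    have "expectation (f m) = (LINT \<omega>|M. indicator E0 \<omega> + (\<Sum>k<2 ^ m. indicator (E m k) \<omega>))"
      by (intro Bochner_Integration.integral_cong f_eq refl)
    also have "\<dots> = (LINT \<omega>|M. indicator E0 \<omega>) + (\<Sum>k<2 ^ m. LINT \<omega>|M. indicator (E m k) \<omega>)"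
      by (subst Bochner_Integration.integral_add [OF _ int_sum], rule ind, measurable,
          subst Bochner_Integration.integral_sum) (auto intro!: ind)
    also have "\<dots> = prob E0 + (\<Sum>k<2 ^ m. prob (E m k))"
      by (simp add: ind)
    also have "\<dots> = upper_prob + S m"
      unfolding E_def E0_def prob_upper S_def crossing_prob_def
      by (subst prob_crossing_shift) simp
    finally show ?thesis .
  qed
  have SAB: "A \<le> S m" "S m \<le> B" for m
    using bounds [of "2 ^ m"] by (auto simp: S_def p_def)
  have mono: "f m \<omega> \<le> f (Suc m) \<omega>" for m \<omega>
    using upcrossings_double [of "\<lambda>t. X (\<eta> t) \<omega>" a b "2 ^ m"] by (simp add: f_def)
  then have inc: "incseq (\<lambda>m. f m \<omega>)" for \<omega>
    by (rule incseq_SucI)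
  have "incseq S"
  proof (rule incseq_SucI)
    fix m
    have "expectation (f m) \<le> expectation (f (Suc m))"
      using mono by (intro Bochner_Integration.integral_mono intf)
    then show "S m \<le> S (Suc m)" by (simp add: Ef)
  qed
  then obtain L where L: "S \<longlonglongrightarrow> L"
    using incseq_convergent [of S B] SAB(2) by metis
  have LAB: "A \<le> L" "L \<le> B"
    using LIMSEQ_le_const [OF L, of A] LIMSEQ_le_const2 [OF L, of B] SAB by auto
  let ?\<chi> = "\<lambda>\<omega>. real_of_int (euler_characteristic (top_of_set {t \<in> closed_segment a b. 0 \<le> X (\<eta> t) \<omega>}))"
  have lim\<chi>: "AE \<omega> in M. (\<lambda>m. f m \<omega>) \<longlonglongrightarrow> ?\<chi> \<omega>"
    using AE_segment_noncritical [of \<eta> a b 0] AE_C1_Lip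
  proof eventually_elim
    case (elim \<omega>)
    obtain g' where "C1_Lip (\<lambda>t. X t \<omega>) g'" using elim(2) by blast
    then have C: "C1_Lip (\<lambda>t. X (\<eta> t) \<omega>) (\<lambda>t. g' (\<eta> t) o\<^sub>L \<eta>' t)"
      by (rule C1_Lip_compose [OF _ \<eta>])
    obtain n0 where n0: "\<And>n. n \<ge> n0 \<Longrightarrow> euler_characteristic (top_of_set {t \<in> closed_segment a b. 0 \<le> X (\<eta> t) \<omega>}) =
        int ((if X (\<eta> a) \<omega> \<ge> 0 then 1 else 0) + card (upcrossings (\<lambda>t. X (\<eta> t) \<omega>) a b n n))"
      using euler_characteristic_segment [OF C ab] elim(1) C by blast
    have "f m \<omega> = ?\<chi> \<omega>" if "m \<ge> n0" for m
    proof -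
      have "n0 \<le> 2 ^ m" using that less_exp [of m] by linarith
      then show ?thesis by (subst n0) (auto simp: f_def)
    qed
    then show ?case
      by (intro tendsto_eventually) (auto simp: eventually_sequentially)
  qed
  \<comment> \<open>A measurable version of the Euler characteristic, obtained as a limit of the
    measurable counts.\<close>
  define u where "u \<omega> = lim (\<lambda>m. f m \<omega>)" for \<omega>
  have u [measurable]: "u \<in> borel_measurable M"
    unfolding u_def by measurable
  have ae: "AE \<omega> in M. ?\<chi> \<omega> = u \<omega>"
    using lim\<chi> by eventually_elim (simp add: u_def limI)
  have "integral\<^sup>L M u = upper_prob + L"
  proof (rule integral_monotone_convergence [OF intf])
    show "AE \<omega> in M. mono (\<lambda>m. f m \<omega>)" using inc by simp
    show "AE \<omega> in M. (\<lambda>m. f m \<omega>) \<longlonglongrightarrow> u \<omega>"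
      using lim\<chi> ae by eventually_elim simp
    show "(\<lambda>m. expectation (f m)) \<longlonglongrightarrow> upper_prob + L"
      unfolding Ef by (intro tendsto_intros L)
  qed (rule u)
  moreover have "mean_euler M (\<lambda>t. X (\<eta> t)) 0 (closed_segment a b) = integral\<^sup>L M u"
    unfolding mean_euler_def excursion_set_def by (rule completion_integral_AE [OF u ae])
  ultimately show ?thesis using LAB by simp
qed

text \<open>On a short segment \<open>\<eta>\<close> is affine up to a relative error, and so is the
  crossing probability linear in the distance. Both errors are proportional to the step, so their
  sum over any subdivision is at most \<open>\<epsilon> * h\<close>.\<close>

lemma mean_euler_short_segment:
  assumes \<eta>: "C1_Lip \<eta> \<eta>'" and v: "v \<noteq> 0" and \<epsilon>: "\<epsilon> > 0"
    and c: "c > 0" "((\<lambda>h. crossing_prob h / norm h) \<longlongrightarrow> c) (at 0)"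
  shows "\<exists>h0>0. \<forall>h. 0 < h \<longrightarrow> h < h0 \<longrightarrow>
    \<bar>mean_euler M (\<lambda>t. X (\<eta> t)) 0 (closed_segment x (x + h *\<^sub>R v)) - upper_prob - c * h * norm (\<eta>' x v)\<bar> \<le> \<epsilon> * h"
proof -
  define V where "V = norm (\<eta>' x v) + norm v"
  have V: "V > 0" using v by (auto simp: V_def add_nonneg_pos)
  \<comment> \<open>The term with \<open>V\<close> pays for replacing crossing probabilities by
    distances, the one with \<open>c * norm v\<close> for replacing increments by the derivative.
    The bound 1 makes each increment at most \<open>V\<close> times the step.\<close>
  define e where "e = min 1 (\<epsilon> / (V + c * norm v))"
  have Vc: "V + c * norm v > 0" using V c(1) by (simp add: add_pos_nonneg)
  have e: "e > 0" "e \<le> 1" "e * (V + c * norm v) \<le> \<epsilon>"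
  proof -
    have "e \<le> \<epsilon> / (V + c * norm v)" by (simp add: e_def)
    then show "e * (V + c * norm v) \<le> \<epsilon>" using Vc by (simp add: field_simps)
  qed (use Vc \<epsilon> in \<open>auto simp: e_def\<close>)
  have "\<forall>\<^sub>F h in at 0. dist (crossing_prob h / norm h) c < e"
    using c(2) e(1) by (rule tendstoD)
  then obtain d where d: "d > 0" "\<And>h. 0 < norm h \<Longrightarrow> norm h < d \<Longrightarrow> \<bar>crossing_prob h / norm h - c\<bar> < e"
    by (auto simp: eventually_at dist_norm dist_real_def)
  \<comment> \<open>The limit says nothing about lag 0, but increments of \<open>\<eta>\<close> may
    vanish.\<close>
  have cp0: "crossing_prob 0 = 0"
  proof -
    have "{\<omega> \<in> space M. X 0 \<omega> < 0 \<and> 0 \<le> X 0 \<omega>} = {}" by auto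
    then show ?thesis by (simp only: crossing_prob_def measure_empty)
  qed
  have cp: "\<bar>crossing_prob h - c * norm h\<bar> \<le> e * norm h" if "norm h < d" for h
  proof (cases "h = 0")
    case False
    then have "\<bar>crossing_prob h / norm h - c\<bar> * norm h \<le> e * norm h"
      using d(2) [of h] that by (intro mult_right_mono) auto
    moreover have "\<bar>crossing_prob h / norm h - c\<bar> * norm h = \<bar>(crossing_prob h / norm h - c) * norm h\<bar>"
      by (simp add: abs_mult)
    moreover have "(crossing_prob h / norm h - c) * norm h = crossing_prob h - c * norm h"
      using False by (simp add: left_diff_distrib)
    ultimately show ?thesis by simp
  qed (simp add: cp0)
  obtain K where K: "K > 0" "K-lipschitz_on (cball x (norm v)) \<eta>'"
    using C1_Lip_deriv_lipschitz [OF \<eta> bounded_cball] .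
  define h0 where "h0 = min 1 (min (e / (3 * K * norm v)) (d / V))"
  have h0: "h0 > 0" using e K d V v by (simp add: h0_def)
  show ?thesis
  proof (intro exI [of _ h0] conjI allI impI h0)
    fix h assume h: "0 < h" "h < h0"
    have h1: "h \<le> 1" "3 * K * norm v * h \<le> e" "h * V < d"
      using h K V v unfolding h0_def by (auto simp: field_simps)
    let ?b = "x + h *\<^sub>R v"
    \<comment> \<open>The factor 3 in \<open>h0\<close> arises here: 2 from the Taylor remainder at
      \<open>y\<close>, since two points of the segment are crudely at distance at most
      \<open>2 * h * norm v\<close>, and 1 from moving the derivative from \<open>y\<close> to
      \<open>x\<close>.\<close>
    have lin: "norm (\<eta> z - \<eta> y - \<eta>' x (z - y)) \<le> e * norm (z - y)"
      if yz: "y \<in> closed_segment x ?b" "z \<in> closed_segment x ?b" for y z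
    proof -
      have sub: "norm (w - x) \<le> h * norm v" if "w \<in> closed_segment x ?b" for w
        using segment_bound(1) [OF that] h by (simp add: norm_minus_commute)
      have le: "h * norm v \<le> norm v" using h1(1) h by (simp add: mult_left_le_one_le)
      have mem: "x \<in> cball x (norm v)" "y \<in> cball x (norm v)" "z \<in> cball x (norm v)"
        using sub [OF yz(1)] sub [OF yz(2)] le by (auto simp: dist_norm norm_minus_commute)
      have 1: "norm (\<eta> z - \<eta> y - \<eta>' y (z - y)) \<le> K * (norm (z - y))\<^sup>2"
        using C1_Lip_taylor [OF \<eta> K(2) convex_cball mem(2,3)] .
      have zy: "norm (z - y) \<le> 2 * (h * norm v)"
        using norm_triangle_ineq4 [of "z - x" "y - x"] sub [OF yz(1)] sub [OF yz(2)] by simp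
      have "norm ((\<eta>' y - \<eta>' x) (z - y)) \<le> norm (\<eta>' y - \<eta>' x) * norm (z - y)"
        by (rule norm_blinfun)
      also have "\<dots> \<le> (K * (h * norm v)) * norm (z - y)"
      proof (rule mult_right_mono)
        have "norm (\<eta>' y - \<eta>' x) \<le> K * norm (y - x)"
          using lipschitz_onD [OF K(2) mem(2,1)] by (simp add: dist_norm)
        also have "\<dots> \<le> K * (h * norm v)"
          using sub [OF yz(1)] K(1) by simp
        finally show "norm (\<eta>' y - \<eta>' x) \<le> K * (h * norm v)" .
      qed simp
      finally have 2: "norm ((\<eta>' y - \<eta>' x) (z - y)) \<le> K * (h * norm v) * norm (z - y)" .
      have "K * (norm (z - y))\<^sup>2 \<le> K * (2 * (h * norm v)) * norm (z - y)"
        unfolding power2_eq_square mult.assoc [symmetric] using zy K(1)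
        by (intro mult_right_mono) (auto simp: mult.assoc)
      moreover have split: "\<eta> z - \<eta> y - \<eta>' x (z - y) = (\<eta> z - \<eta> y - \<eta>' y (z - y)) + (\<eta>' y - \<eta>' x) (z - y)"
        by (simp add: blinfun.diff_left)
      moreover have "norm (\<eta> z - \<eta> y - \<eta>' x (z - y)) \<le> norm (\<eta> z - \<eta> y - \<eta>' y (z - y)) + norm ((\<eta>' y - \<eta>' x) (z - y))"
        unfolding split by (rule norm_triangle_ineq)
      ultimately have "norm (\<eta> z - \<eta> y - \<eta>' x (z - y)) \<le> K * (2 * (h * norm v)) * norm (z - y) + K * (h * norm v) * norm (z - y)"
        using 1 2 by linarith
      also have "\<dots> = 3 * K * norm v * h * norm (z - y)" by (simp add: algebra_simps)
      also have "\<dots> \<le> e * norm (z - y)"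
        using h1(2) by (intro mult_right_mono) auto
      finally show ?thesis .
    qed
    have sum: "(\<Sum>k<n. crossing_prob (\<eta> (x + (real (Suc k) / real n) *\<^sub>R (?b - x)) - \<eta> (x + (real k / real n) *\<^sub>R (?b - x))))
       \<in> {c * h * norm (\<eta>' x v) - \<epsilon> * h..c * h * norm (\<eta>' x v) + \<epsilon> * h}" if n: "n \<ge> 1" for n
    proof -
      define D where "D k = \<eta> (x + (real (Suc k) / real n) *\<^sub>R (?b - x)) - \<eta> (x + (real k / real n) *\<^sub>R (?b - x))" for k
      define r where "r = h / real n"
      have r: "r > 0" "r \<le> h" using h n by (auto simp: r_def field_simps)
      have bound: "\<bar>crossing_prob (D k) - c * r * norm (\<eta>' x v)\<bar> \<le> \<epsilon> * r" if k: "k < n" for k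
      proof -
        have pt: "x + (real j / real n) *\<^sub>R (?b - x) \<in> closed_segment x ?b" if "j \<le> n" for j
          using that n unfolding in_segment by (intro exI [of _ "real j / real n"]) (auto simp: algebra_simps)
        have "(x + (real (Suc k) / real n) *\<^sub>R (?b - x)) - (x + (real k / real n) *\<^sub>R (?b - x)) = r *\<^sub>R v"
          by (simp add: r_def scaleR_left_diff_distrib [symmetric] diff_divide_distrib [symmetric] distrib_right)
        with lin [OF pt [of k] pt [of "Suc k"]] k have "norm (D k - r *\<^sub>R \<eta>' x v) \<le> e * norm (r *\<^sub>R v)"
          by (simp add: D_def blinfun.scaleR_right)
        then have Dr: "norm (D k - r *\<^sub>R \<eta>' x v) \<le> e * r * norm v" using r by simp
        have "\<bar>norm (D k) - norm (r *\<^sub>R \<eta>' x v)\<bar> \<le> e * r * norm v"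
          using norm_triangle_ineq3 [of "D k" "r *\<^sub>R \<eta>' x v"] Dr by linarith
        then have nD: "\<bar>norm (D k) - r * norm (\<eta>' x v)\<bar> \<le> e * r * norm v" using r by simp
        have "e * (r * norm v) \<le> 1 * (r * norm v)" using e r by (intro mult_right_mono) auto
        then have nDV: "norm (D k) \<le> r * V" using nD by (simp add: V_def algebra_simps)
        also have "\<dots> \<le> h * V" using r V by simp
        finally have "norm (D k) < d" using h1(3) by simp
        then have "\<bar>crossing_prob (D k) - c * norm (D k)\<bar> \<le> e * norm (D k)" by (rule cp)
        also have "\<dots> \<le> e * (r * V)" using nDV e by simp
        finally have 1: "\<bar>crossing_prob (D k) - c * norm (D k)\<bar> \<le> e * (r * V)" .
        have "\<bar>c * norm (D k) - c * (r * norm (\<eta>' x v))\<bar> = c * \<bar>norm (D k) - r * norm (\<eta>' x v)\<bar>"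
          using c(1) by (simp add: abs_mult right_diff_distrib [symmetric])
        also have "\<dots> \<le> c * (e * r * norm v)" using nD c(1) by simp
        finally have "\<bar>crossing_prob (D k) - c * r * norm (\<eta>' x v)\<bar> \<le> e * (r * V) + c * (e * r * norm v)"
          using 1 by (simp add: mult.assoc)
        also have "\<dots> = e * (V + c * norm v) * r" by (simp add: algebra_simps)
        also have "\<dots> \<le> \<epsilon> * r" using e(3) r by (intro mult_right_mono) auto
        finally show ?thesis .
      qed
      have "\<bar>(\<Sum>k<n. crossing_prob (D k)) - c * h * norm (\<eta>' x v)\<bar> = \<bar>\<Sum>k<n. crossing_prob (D k) - c * r * norm (\<eta>' x v)\<bar>"
        using n by (simp add: sum_subtractf r_def)
      also have "\<dots> \<le> (\<Sum>k<n. \<epsilon> * r)"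
        using bound by (intro order_trans [OF sum_abs] sum_mono) auto
      also have "\<dots> = \<epsilon> * h" using n by (simp add: r_def)
      finally show ?thesis by (simp add: D_def abs_le_iff algebra_simps)
    qed
    have "x \<noteq> ?b" using v h by simp
    from mean_euler_segment [OF \<eta> this sum]
    show "\<bar>mean_euler M (\<lambda>t. X (\<eta> t)) 0 (closed_segment x ?b) - upper_prob - c * h * norm (\<eta>' x v)\<bar> \<le> \<epsilon> * h"
      by (auto simp: abs_le_iff)
  qed
qed

section \<open>The equivalence\<close>

lemma chi_isotropic_iff_spiral:
  assumes \<theta>: "deformation \<theta>"
  shows "chi_isotropic M X \<theta> \<longleftrightarrow> spiral_deformation \<theta>"
proof -
  have bij: "bij \<theta>" and \<theta>0: "\<theta> 0 = 0" using \<theta> by (auto simp: deformation_def)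
  obtain \<theta>' where d\<theta>: "C1_Lip \<theta> \<theta>'" using \<theta> C2_imp_C1_Lip by (auto simp: deformation_def)
  obtain \<kappa>' where d\<kappa>: "C1_Lip (inv_into UNIV \<theta>) \<kappa>'" using \<theta> C2_imp_C1_Lip by (auto simp: deformation_def)
  \<comment> \<open>The chain rule for \<open>\<theta>\<close> composed with its differentiable
    inverse gives a right inverse of the derivative.\<close>
  have surj: "surj (blinfun_apply (\<theta>' t))" for t
  proof -
    have "((\<lambda>x. \<theta> (inv_into UNIV \<theta> x)) has_derivative (\<lambda>w. \<theta>' (inv_into UNIV \<theta> (\<theta> t)) (\<kappa>' (\<theta> t) w))) (at (\<theta> t))"
      by (rule has_derivative_compose [OF C1_Lip_has_derivative [OF d\<kappa>] C1_Lip_has_derivative [OF d\<theta>, of _ UNIV]])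
    then have "((\<lambda>x. x) has_derivative (\<lambda>w. \<theta>' t (\<kappa>' (\<theta> t) w))) (at (\<theta> t))"
      using bij by (simp add: bij_is_surj surj_f_inv_f bij_is_inj)
    then have "(\<lambda>w. \<theta>' t (\<kappa>' (\<theta> t) w)) = (\<lambda>w. w)"
      using has_derivative_unique has_derivative_ident by blast
    then show ?thesis by (metis surjI)
  qed
  show ?thesis
  proof
    assume spiral: "spiral_deformation \<theta>"
    show "chi_isotropic M X \<theta>"
      unfolding chi_isotropic_def o_def
    proof (intro allI impI)
      fix T u and R :: "real ^ 2 ^ 2" assume T: "rectangle T" and R: "rotation_matrix R"
      obtain Q where "rotation_matrix Q" "\<And>x. \<theta> (R *v x) = Q *v \<theta> x"
        using spiral_deformation_rotate [OF \<theta> spiral R] by metis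
      from mean_euler_rotate [OF d\<theta> surj T R this]
      show "mean_euler M (\<lambda>t. X (\<theta> t)) u ((\<lambda>x. R *v x) ` T) = mean_euler M (\<lambda>t. X (\<theta> t)) u T" .
    qed
  next
    assume iso: "chi_isotropic M X \<theta>"
    obtain c where c: "c > 0" "((\<lambda>h. crossing_prob h / norm h) \<longlongrightarrow> c) (at 0)"
      using crossing_asymp unfolding crossing_prob_def by blast
    have "norm (\<theta>' (rot \<alpha> *v x) (rot \<alpha> *v v)) = norm (\<theta>' x v)" for \<alpha> x v
    proof (cases "v = 0")
      case False
      have "rot \<alpha> *v v \<noteq> 0" using False norm_rot [of \<alpha> v] by (metis norm_eq_zero)
      define a where "a = norm (\<theta>' (rot \<alpha> *v x) (rot \<alpha> *v v))"
      define b where "b = norm (\<theta>' x v)"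
      \<comment> \<open>The two expansions share the term \<open>upper_prob\<close>, and
        chi-isotropy equates their means; dividing by \<open>h\<close> compares the two
        norms.\<close>
      have "c * \<bar>a - b\<bar> \<le> 0 + \<epsilon>" if "\<epsilon> > 0" for \<epsilon>
      proof -
        have e2: "\<epsilon> / 2 > 0" using that by simp
        let ?E = "mean_euler M (\<lambda>t. X (\<theta> t)) 0"
        obtain h1 where h1: "h1 > 0" "\<And>h. 0 < h \<Longrightarrow> h < h1 \<Longrightarrow>
            \<bar>?E (closed_segment x (x + h *\<^sub>R v)) - upper_prob - c * h * b\<bar> \<le> \<epsilon> / 2 * h"
          using mean_euler_short_segment [OF d\<theta> False e2 c] unfolding b_def by blast
        obtain h2 where h2: "h2 > 0" "\<And>h. 0 < h \<Longrightarrow> h < h2 \<Longrightarrow>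
            \<bar>?E (closed_segment (rot \<alpha> *v x) (rot \<alpha> *v x + h *\<^sub>R (rot \<alpha> *v v))) - upper_prob - c * h * a\<bar> \<le> \<epsilon> / 2 * h"
          using mean_euler_short_segment [OF d\<theta> \<open>rot \<alpha> *v v \<noteq> 0\<close> e2 c] unfolding a_def by blast
        define h where "h = min h1 h2 / 2"
        have h: "0 < h" "h < h1" "h < h2" using h1(1) h2(1) by (auto simp: h_def)
        have "closed_segment (rot \<alpha> *v x) (rot \<alpha> *v x + h *\<^sub>R (rot \<alpha> *v v)) = (\<lambda>x. rot \<alpha> *v x) ` closed_segment x (x + h *\<^sub>R v)"
          using closed_segment_linear_image [OF matrix_vector_mul_linear, of "rot \<alpha>" x "x + h *\<^sub>R v"]
          by (simp add: matrix_vector_right_distrib rot_scaleR)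
        then have "?E (closed_segment (rot \<alpha> *v x) (rot \<alpha> *v x + h *\<^sub>R (rot \<alpha> *v v))) = ?E (closed_segment x (x + h *\<^sub>R v))"
          using iso closed_segment_rectangle rotation_matrix_rot unfolding chi_isotropic_def o_def by simp
        then have "\<bar>c * h * a - c * h * b\<bar> \<le> \<epsilon> / 2 * h + \<epsilon> / 2 * h"
          using h1(2) [OF h(1,2)] h2(2) [OF h(1,3)] by linarith
        moreover have "\<bar>c * h * a - c * h * b\<bar> = h * (c * \<bar>a - b\<bar>)"
        proof -
          have "c * h * a - c * h * b = h * (c * (a - b))" by (simp add: algebra_simps)
          then show ?thesis using h(1) c(1) by (simp add: abs_mult)
        qed
        ultimately have "h * (c * \<bar>a - b\<bar>) \<le> h * \<epsilon>" by (simp add: mult.commute)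
        then show ?thesis using h(1) by simp
      qed
      then have "c * \<bar>a - b\<bar> \<le> 0" by (rule field_le_epsilon)
      then have "a = b" using c(1) by (simp add: mult_le_0_iff)
      then show ?thesis by (simp add: a_def b_def)
    qed (simp add: blinfun.zero_right)
    then show "spiral_deformation \<theta>"
      by (rule spiral_deformation_if_metric_invariant [OF bij \<theta>0 d\<theta> d\<kappa>])
  qed
qed

end

theorem theorem4p4:
  fixes M :: "'w measure"
    and X :: "real ^ 2 \<Rightarrow> 'w \<Rightarrow> real"
    and \<theta> :: "real ^ 2 \<Rightarrow> real ^ 2"
  assumes "prob_space M"
    and "assumption_H M X"
    and "deformation \<theta>"
  shows "chi_isotropic M X \<theta> \<longleftrightarrow> spiral_deformation \<theta>"
proof -
  interpret smooth_gaussian_field M X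
    by (intro smooth_gaussian_field.intro smooth_gaussian_field_axioms.intro assms)
  show ?thesis
    by (rule chi_isotropic_iff_spiral [OF assms(3)])
qed

end
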